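(* Let $G$ be a bipartite graph with vertex set $\{x_1,\ldots,x_n\}$, let $R=K[x_1,\ldots,x_n]$ be a polynomial ring over a field $K$, let $I(G)\subset R$ be the edge ideal of $G$, and let $I(G)^\vee\subset R$ be the ideal of covers of $G$. The following hold. (a) If $G$ is unmixed, then $I(G)$ has non-increasing depth. (b) $I(G)^\vee$ has non-increasing depth. (c) $I(G)^\vee$ has non-decreasing regularity.
   Context: The edge ideal $I(G)$ is generated by all $x_ix_j$ with $\{x_i,x_j\}$ an edge of $G$. The ideal of covers $I(G)^\vee$ is generated by the monomials $\prod_{x_i\in C}x_i$ with $C$ a minimal vertex cover of $G$. A graph is unmixed if all its minimal vertex covers have the same cardinality. A homogeneous ideal $I\subset R$ has non-increasing depth if $\operatorname{depth}(R/I^k)\geq\operatorname{depth}(R/I^{k+1})$ for all $k\geq 1$, and has non-decreasing regularity if $\operatorname{reg}(R/I^k)\leq\operatorname{reg}(R/I^{k+1})$ for all $k\geq 1$, where $\operatorname{reg}$ is Castelnuovo--Mumford regularity. *)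

theory Defs
  imports
    "HOL-Library.Poly_Mapping"
    "HOL-Library.Extended_Nat"
    "HOL-Library.Extended_Real"
    "Jordan_Normal_Form.Matrix"
begin

section \<open>Polynomial rings and their ideals\<close>

text \<open>
  The polynomial ring \<open>K[x\<^sub>v : v \<in> V]\<close> is the type of finitely supported maps from exponent
  vectors to coefficients, with the convolution product of \<open>Poly_Mapping\<close>. The set of
  variables is a finite type \<open>'v\<close>, so that the number of variables is \<open>CARD('v)\<close>.
\<close>

type_synonym ('v, 'k) mpoly = "('v \<Rightarrow>\<^sub>0 nat) \<Rightarrow>\<^sub>0 'k"

definition var :: "'v \<Rightarrow> ('v, 'k::field) mpoly" where
  "var v = Poly_Mapping.single (Poly_Mapping.single v 1) 1"

definition mon_degree :: "('v::finite \<Rightarrow>\<^sub>0 nat) \<Rightarrow> nat" where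
  "mon_degree m = (\<Sum>v\<in>UNIV. Poly_Mapping.lookup m v)"

text \<open>The zero polynomial is homogeneous of every degree; it is the only one of negative degree.\<close>

definition homogeneous_of_degree :: "int \<Rightarrow> ('v::finite, 'k::field) mpoly \<Rightarrow> bool" where
  "homogeneous_of_degree d f \<longleftrightarrow> (\<forall>m\<in>Poly_Mapping.keys f. int (mon_degree m) = d)"

lemma module_times: "Modules.module ((*) :: 'a::comm_ring_1 \<Rightarrow> 'a \<Rightarrow> 'a)"
  by unfold_locales (simp_all add: algebra_simps)

text \<open>The ideals of a commutative ring are its submodules as a module over itself.\<close>

definition ideal_gen :: "'a::comm_ring_1 set \<Rightarrow> 'a set" where
  "ideal_gen B = Modules.module.span (*) B"

primrec ideal_power :: "'a::comm_ring_1 set \<Rightarrow> nat \<Rightarrow> 'a set" where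
  "ideal_power I 0 = UNIV"
| "ideal_power I (Suc k) = ideal_gen {f * g | f g. f \<in> I \<and> g \<in> ideal_power I k}"

definition irrelevant_ideal :: "('v, 'k::field) mpoly set" where
  "irrelevant_ideal = ideal_gen (range var)"

section \<open>Depth\<close>

definition regular_sequence_quot :: "'a::comm_ring_1 set \<Rightarrow> 'a list \<Rightarrow> bool" where
  "regular_sequence_quot I fs \<longleftrightarrow>
     ideal_gen (I \<union> set fs) \<noteq> UNIV \<and>
     (\<forall>i<length fs. \<forall>g. fs ! i * g \<in> ideal_gen (I \<union> set (take i fs)) \<longrightarrow>
                         g \<in> ideal_gen (I \<union> set (take i fs)))"

text \<open>
  This is \<open>depth(R/I)\<close>, the largest length of an \<open>R/I\<close>-regular sequence inside
  \<open>(x\<^sub>v : v \<in> V)\<close>. No sequence at all is regular on the zero module, to which this therefore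
  assigns the value \<open>0\<close>.
\<close>

definition depth_quot :: "('v, 'k::field) mpoly set \<Rightarrow> enat" where
  "depth_quot I =
     (SUP fs \<in> {fs. set fs \<subseteq> irrelevant_ideal \<and> regular_sequence_quot I fs}. enat (length fs))"

definition non_increasing_depth :: "('v, 'k::field) mpoly set \<Rightarrow> bool" where
  "non_increasing_depth I \<longleftrightarrow>
     (\<forall>k\<ge>1. depth_quot (ideal_power I k) \<ge> depth_quot (ideal_power I (k + 1)))"

section \<open>Castelnuovo--Mumford regularity\<close>

text \<open>
  A graded free resolution \<open>\<dots> \<rightarrow> F\<^sub>2 \<rightarrow> F\<^sub>1 \<rightarrow> F\<^sub>0 \<rightarrow> R/I \<rightarrow> 0\<close> by free modules of finite rank.
  The list \<open>ds i\<close> contains the degrees of the basis elements of \<open>F\<^sub>i\<close>, i.e. \<open>F\<^sub>i\<close> is the direct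
  sum of the modules \<open>R(-j)\<close> for \<open>j\<close> in \<open>ds i\<close>. The matrix \<open>D i\<close> represents
  \<open>F\<^bsub>i+1\<^esub> \<rightarrow> F\<^sub>i\<close>, and the vector \<open>a\<close> contains representatives of the images in \<open>R/I\<close> of the basis
  elements of \<open>F\<^sub>0\<close>. The maps preserve degrees, and the last three conditions express exactness
  at \<open>R/I\<close>, at \<open>F\<^sub>0\<close> and at \<open>F\<^bsub>i+1\<^esub>\<close>. The modules \<open>F\<^sub>i\<close> may vanish from some \<open>i\<close> on.
\<close>

definition graded_free_resolution ::
  "('v::finite, 'k::field) mpoly set \<Rightarrow> (nat \<Rightarrow> int list) \<Rightarrow> ('v, 'k) mpoly vec \<Rightarrow>
     (nat \<Rightarrow> ('v, 'k) mpoly mat) \<Rightarrow> bool" where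
  "graded_free_resolution I ds a D \<longleftrightarrow>
     a \<in> carrier_vec (length (ds 0)) \<and>
     (\<forall>i. D i \<in> carrier_mat (length (ds i)) (length (ds (Suc i)))) \<and>
     (\<forall>r<length (ds 0). homogeneous_of_degree (ds 0 ! r) (a $ r)) \<and>
     (\<forall>i. \<forall>r<length (ds i). \<forall>c<length (ds (Suc i)).
        homogeneous_of_degree (ds (Suc i) ! c - ds i ! r) (D i $$ (r, c))) \<and>
     (\<forall>f. \<exists>v\<in>carrier_vec (length (ds 0)). f - a \<bullet> v \<in> I) \<and>
     {v \<in> carrier_vec (length (ds 0)). a \<bullet> v \<in> I} =
       (\<lambda>w. D 0 *\<^sub>v w) ` carrier_vec (length (ds 1)) \<and>
     (\<forall>i. {v \<in> carrier_vec (length (ds (Suc i))). D i *\<^sub>v v = 0\<^sub>v (length (ds i))} =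
       (\<lambda>w. D (Suc i) *\<^sub>v w) ` carrier_vec (length (ds (Suc (Suc i)))))"

text \<open>Minimality: the image of \<open>F\<^bsub>i+1\<^esub>\<close> in \<open>F\<^sub>i\<close> lies in \<open>(x\<^sub>v : v \<in> V) F\<^sub>i\<close>.\<close>

definition minimal_graded_free_resolution ::
  "('v::finite, 'k::field) mpoly set \<Rightarrow> (nat \<Rightarrow> int list) \<Rightarrow> ('v, 'k) mpoly vec \<Rightarrow>
     (nat \<Rightarrow> ('v, 'k) mpoly mat) \<Rightarrow> bool" where
  "minimal_graded_free_resolution I ds a D \<longleftrightarrow>
     graded_free_resolution I ds a D \<and> (\<forall>i. elements_mat (D i) \<subseteq> irrelevant_ideal)"

text \<open>
  For homogeneous \<open>I\<close> the minimal graded free resolution of \<open>R/I\<close> exists and is unique up to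
  isomorphism, so that the numbers below do not depend on the choice.
\<close>

definition graded_betti :: "('v::finite, 'k::field) mpoly set \<Rightarrow> nat \<Rightarrow> int \<Rightarrow> nat" where
  "graded_betti I i j =
     count_list ((SOME ds. \<exists>a D. minimal_graded_free_resolution I ds a D) i) j"

text \<open>This is \<open>reg(R/I)\<close>; the zero module has regularity \<open>-\<infinity>\<close>.\<close>

definition reg_quot :: "('v::finite, 'k::field) mpoly set \<Rightarrow> ereal" where
  "reg_quot I =
     (SUP (i, j) \<in> {(i, j). graded_betti I i j \<noteq> 0}. ereal (real_of_int (j - int i)))"

definition non_decreasing_regularity :: "('v::finite, 'k::field) mpoly set \<Rightarrow> bool" where
  "non_decreasing_regularity I \<longleftrightarrow>
     (\<forall>k\<ge>1. reg_quot (ideal_power I k) \<le> reg_quot (ideal_power I (k + 1)))"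

section \<open>Graphs, edge ideals and ideals of covers\<close>

text \<open>A graph on the vertex set \<open>UNIV :: 'v set\<close> is given by its set of edges.\<close>

definition simple_graph :: "'v set set \<Rightarrow> bool" where
  "simple_graph E \<longleftrightarrow> (\<forall>e\<in>E. card e = 2)"

definition bipartite :: "'v set set \<Rightarrow> bool" where
  "bipartite E \<longleftrightarrow>
     (\<exists>A B. A \<union> B = UNIV \<and> A \<inter> B = {} \<and> (\<forall>e\<in>E. \<exists>a\<in>A. \<exists>b\<in>B. e = {a, b}))"

definition vertex_cover :: "'v set set \<Rightarrow> 'v set \<Rightarrow> bool" where
  "vertex_cover E C \<longleftrightarrow> (\<forall>e\<in>E. e \<inter> C \<noteq> {})"

definition minimal_vertex_cover :: "'v set set \<Rightarrow> 'v set \<Rightarrow> bool" where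
  "minimal_vertex_cover E C \<longleftrightarrow> vertex_cover E C \<and> (\<forall>C'. C' \<subset> C \<longrightarrow> \<not> vertex_cover E C')"

definition unmixed :: "'v set set \<Rightarrow> bool" where
  "unmixed E \<longleftrightarrow>
     (\<forall>C C'. minimal_vertex_cover E C \<longrightarrow> minimal_vertex_cover E C' \<longrightarrow> card C = card C')"

definition edge_ideal :: "'v set set \<Rightarrow> ('v, 'k::field) mpoly set" where
  "edge_ideal E = ideal_gen {var v * var w | v w. {v, w} \<in> E}"

definition cover_ideal :: "'v set set \<Rightarrow> ('v, 'k::field) mpoly set" where
  "cover_ideal E = ideal_gen {(\<Prod>v\<in>C. var v) | C. minimal_vertex_cover E C}"

end

theory Submission
  imports Defs "HOL-Library.Function_Algebras"
begin

text \<open>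
  Dividing by a monomial improves both invariants: if \<open>I\<close> is a monomial ideal and \<open>f\<close> a monomial
  with \<open>I : f \<noteq> R\<close>, then \<open>depth(R/I) \<le> depth(R/(I : f))\<close> and \<open>reg(R/(I : f)) \<le> reg(R/I)\<close>
  (\<open>colon_monomial_depth_reg\<close>). So it suffices to find a monomial \<open>f\<close> such that
  \<open>I\<^bsup>k+1\<^esup> : f = I\<^sup>k\<close>.

  For the ideal of covers, \<open>f\<close> is the product of the vertices on one side of the bipartition: a
  monomial lies in the \<open>k\<close>-th power if and only if it has degree at least \<open>k\<close> on every edge
  (\<open>cover_power_iff\<close>), and \<open>f\<close> has degree exactly one on every edge. For the edge ideal of an
  unmixed graph, \<open>f = xy\<close> for an edge \<open>{x, y}\<close> such that every neighbour of \<open>x\<close> is adjacent to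
  every neighbour of \<open>y\<close> (\<open>unmixed_swap_edge\<close>): if a product of edges contains \<open>{x, w}\<close> and
  \<open>{y, z}\<close>, these may be exchanged for \<open>{x, y}\<close> and \<open>{w, z}\<close>, which can then be cancelled against
  \<open>f\<close> (\<open>edge_power_colon\<close>).

  The two inequalities are proved for one variable \<open>x\<close> at a time, by means of the Koszul homology
  \<open>H\<^sub>i(R/I)\<close> with respect to all variables. Let \<open>z\<close> be a cycle modulo \<open>I : x\<close>. If \<open>xz\<close> is the
  boundary of \<open>w\<close> modulo \<open>I\<close>, then the terms of \<open>w\<close> without \<open>x\<close> yield a cycle modulo \<open>I\<close> that is
  homologous to \<open>z\<close> modulo \<open>I : x\<close> (\<open>koszul_vanishes_colon\<close>). Hence a nonzero class of
  \<open>H\<^sub>i(R/(I : x))\<close> in degree \<open>j\<close> forces one of \<open>H\<^sub>i(R/I)\<close> in degree \<open>j\<close> or \<open>j + 1\<close>.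

  It remains to read off depth and regularity from Koszul homology. Let \<open>J\<close> be contained in the
  irrelevant ideal of a polynomial ring in \<open>n\<close> variables. The irrelevant ideal contains an
  \<open>R/J\<close>-regular sequence of length \<open>d\<close> if and only if \<open>H\<^sub>i(R/J) = 0\<close> for all \<open>i > n - d\<close>: one
  direction holds because the irrelevant ideal annihilates the homology, the other by prime
  avoidance among the associated primes of \<open>R/J\<close>. If \<open>J\<close> is homogeneous, a minimal graded
  free resolution of \<open>R/J\<close> has a basis element of degree \<open>j\<close> in homological degree \<open>i\<close> if and only if \<open>H\<^sub>i(R/J)\<close> is nonzero in
  degree \<open>j\<close> (\<open>min_resolution_degrees\<close>), by passing from each syzygy module to the next. The
  Betti numbers refer to a chosen minimal resolution; that one exists is a consequence of Hilbert's
  basis theorem.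
\<close>

section \<open>Ideals and monomial ideals\<close>

abbreviation (input) lookup :: "('a \<Rightarrow>\<^sub>0 'b::zero) \<Rightarrow> 'a \<Rightarrow> 'b" where
  "lookup \<equiv> Poly_Mapping.lookup"

abbreviation (input) keys :: "('a \<Rightarrow>\<^sub>0 'b::zero) \<Rightarrow> 'a set" where
  "keys \<equiv> Poly_Mapping.keys"

abbreviation (input) single :: "'a \<Rightarrow> 'b \<Rightarrow> 'a \<Rightarrow>\<^sub>0 'b::zero" where
  "single \<equiv> Poly_Mapping.single"

definition is_ideal :: "'a::comm_ring_1 set \<Rightarrow> bool" where
  "is_ideal I \<longleftrightarrow> Modules.module.subspace (*) I"

lemma is_idealI:
  assumes "0 \<in> I" "\<And>f g. f \<in> I \<Longrightarrow> g \<in> I \<Longrightarrow> f + g \<in> I" "\<And>c f. f \<in> I \<Longrightarrow> c * f \<in> I"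
  shows "is_ideal I"
  unfolding is_ideal_def using assms by (rule Modules.module.subspaceI[OF module_times])

lemma
  assumes "is_ideal I"
  shows ideal_zero: "0 \<in> I"
    and ideal_add: "f \<in> I \<Longrightarrow> g \<in> I \<Longrightarrow> f + g \<in> I"
    and ideal_diff: "f \<in> I \<Longrightarrow> g \<in> I \<Longrightarrow> f - g \<in> I"
    and ideal_uminus: "f \<in> I \<Longrightarrow> - f \<in> I"
    and ideal_mult_left: "f \<in> I \<Longrightarrow> c * f \<in> I"
    and ideal_mult_right: "f \<in> I \<Longrightarrow> f * c \<in> I"
    and ideal_sum: "(\<And>x. x \<in> A \<Longrightarrow> h x \<in> I) \<Longrightarrow> sum h A \<in> I"
  using assms Modules.module.subspace_0[OF module_times, of I] Modules.module.subspace_add[OF module_times, of I f g] Modules.module.subspace_diff[OF module_times, of I f g]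
    Modules.module.subspace_neg[OF module_times, of I f] Modules.module.subspace_scale[OF module_times, of I f c] Modules.module.subspace_sum[OF module_times, of I A h]
  unfolding is_ideal_def by (simp_all add: mult.commute[of f c])

lemma is_ideal_ideal_gen [simp]: "is_ideal (ideal_gen B)"
  by (simp add: is_ideal_def ideal_gen_def Modules.module.subspace_span[OF module_times])

lemma ideal_gen_base: "b \<in> B \<Longrightarrow> b \<in> ideal_gen B"
  by (simp add: ideal_gen_def Modules.module.span_base[OF module_times])

lemma ideal_gen_minimal: "B \<subseteq> I \<Longrightarrow> is_ideal I \<Longrightarrow> ideal_gen B \<subseteq> I"
  by (simp add: ideal_gen_def is_ideal_def Modules.module.span_minimal[OF module_times])

lemma ideal_gen_mono: "B \<subseteq> C \<Longrightarrow> ideal_gen B \<subseteq> ideal_gen C"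
  by (simp add: ideal_gen_def Modules.module.span_mono[OF module_times])

lemma ideal_gen_ideal: "is_ideal I \<Longrightarrow> ideal_gen I = I"
  by (simp add: ideal_gen_def is_ideal_def Modules.module.span_eq_iff[OF module_times])

lemma ideal_gen_Un_gen: "ideal_gen (ideal_gen A \<union> B) = ideal_gen (A \<union> B)"
proof
  show "ideal_gen (ideal_gen A \<union> B) \<subseteq> ideal_gen (A \<union> B)"
    by (rule ideal_gen_minimal) (use ideal_gen_mono[of A "A \<union> B"] in \<open>auto intro: ideal_gen_base\<close>)
  show "ideal_gen (A \<union> B) \<subseteq> ideal_gen (ideal_gen A \<union> B)"
    by (rule ideal_gen_mono) (use ideal_gen_base in auto)
qed

lemma mem_ideal_gen_insert:
  assumes "is_ideal J"
  shows "g \<in> ideal_gen (insert f J) \<longleftrightarrow> (\<exists>c. g - c * f \<in> J)"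
  by (metis assms ideal_gen_def ideal_gen_ideal Modules.module.span_breakdown_eq[OF module_times])

lemma ideal_UNIV_iff: "is_ideal I \<Longrightarrow> I = UNIV \<longleftrightarrow> 1 \<in> I"
  using ideal_mult_left[of I 1] by auto

definition colon :: "'a::comm_ring_1 set \<Rightarrow> 'a \<Rightarrow> 'a set" where
  "colon I f = {g. f * g \<in> I}"

lemma is_ideal_colon:
  assumes "is_ideal I"
  shows "is_ideal (colon I f)"
proof (rule is_idealI)
  show "c * g \<in> colon I f" if "g \<in> colon I f" for c g
    using ideal_mult_left[OF assms, of "f * g" c] that by (simp add: colon_def mult_ac)
qed (auto simp: colon_def distrib_left ideal_zero[OF assms] ideal_add[OF assms])

text \<open>Both the homogeneous components of a polynomial and its part without a given variable arise by
  selecting terms.\<close>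

lift_definition filter_terms :: "('a \<Rightarrow> bool) \<Rightarrow> ('a \<Rightarrow>\<^sub>0 'b::zero) \<Rightarrow> ('a \<Rightarrow>\<^sub>0 'b)" is
  "\<lambda>P f m. if P m then f m else 0"
  by (erule finite_subset[rotated]) (auto split: if_splits)

lemma lookup_filter_terms: "lookup (filter_terms P f) m = (if P m then lookup f m else 0)"
  by transfer simp

lemma keys_filter_terms: "keys (filter_terms P f) = {m \<in> keys f. P m}"
  by (auto simp: in_keys_iff lookup_filter_terms split: if_splits)

lemma filter_terms_zero [simp]: "filter_terms P 0 = 0"
  by (rule poly_mapping_eqI) (simp add: lookup_filter_terms)

lemma filter_terms_add: "filter_terms P (f + g) = filter_terms P f + filter_terms P g"
  by (rule poly_mapping_eqI) (simp add: lookup_filter_terms lookup_add)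

lemma filter_terms_diff: "filter_terms P (f - g) = filter_terms P f - filter_terms P (g :: _ \<Rightarrow>\<^sub>0 'b::ab_group_add)"
  by (rule poly_mapping_eqI) (simp add: lookup_filter_terms lookup_minus)

lemma filter_terms_sum: "filter_terms P (\<Sum>x\<in>A. h x) = (\<Sum>x\<in>A. filter_terms P (h x))"
  by (induction A rule: infinite_finite_induct) (auto simp: filter_terms_add)

lemma filter_terms_single:
  "filter_terms P (single m c) = (if P m then single m c else 0)"
  by (rule poly_mapping_eqI) (simp add: lookup_filter_terms lookup_single when_def)

lemma filter_terms_eq_self_iff: "filter_terms P f = f \<longleftrightarrow> (\<forall>m\<in>keys f. P m)"
  by (auto simp: poly_mapping_eq_iff fun_eq_iff lookup_filter_terms in_keys_iff)

lemma poly_mapping_add_induct [case_names zero add]: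
  fixes f :: "'a \<Rightarrow>\<^sub>0 'b::comm_monoid_add"
  assumes "P 0" and "\<And>m c f. P f \<Longrightarrow> P (single m c + f)"
  shows "P f"
proof (induction f rule: update_induct)
  case const
  then show ?case by (rule assms(1))
next
  case (update f a b)
  have "Poly_Mapping.update a b f = single a b + f"
    by (rule poly_mapping_eqI) (use update(1) in \<open>auto simp: lookup_update lookup_add lookup_single when_def in_keys_iff\<close>)
  then show ?case using assms(2)[OF update(3)] by simp
qed

lemma filter_terms_single_mult:
  "filter_terms P (single b c * f) = single b c * filter_terms (\<lambda>m. P (b + m)) (f :: 'a::comm_monoid_add \<Rightarrow>\<^sub>0 'b::comm_semiring_1)"
  by (induction f rule: poly_mapping_add_induct) (auto simp: filter_terms_add filter_terms_single mult_single distrib_left)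

lemma lookup_single_mult_add:
  fixes f :: "'a::cancel_comm_monoid_add \<Rightarrow>\<^sub>0 'b::comm_semiring_1"
  shows "lookup (single b c * f) (b + m) = c * lookup f m"
  by (induction f rule: poly_mapping_add_induct)
    (auto simp: distrib_left lookup_add mult_single lookup_single when_def)

lemma keys_single_mult:
  fixes f :: "'a::cancel_comm_monoid_add \<Rightarrow>\<^sub>0 'b::comm_semiring_1"
  shows "keys (single b 1 * f) = (+) b ` keys f"
proof
  show "keys (single b 1 * f) \<subseteq> (+) b ` keys f"
    using keys_mult[of "single b (1::'b)" f] by (auto split: if_splits)
  show "(+) b ` keys f \<subseteq> keys (single b 1 * f)"
    by (auto simp: in_keys_iff lookup_single_mult_add)
qed

abbreviation xm :: "('v \<Rightarrow>\<^sub>0 nat) \<Rightarrow> ('v, 'k::field) mpoly" where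
  "xm m \<equiv> single m 1"

lemma xm_add: "xm (m + m') = xm m * xm m'"
  by (simp add: mult_single)

lemma poly_eq_sum: "f = (\<Sum>m\<in>keys f. single m (lookup f m))"
  by (rule poly_mapping_eqI)
    (simp add: lookup_sum lookup_single when_def in_keys_iff)

text \<open>Nonzero coefficients are units, so only the monomials of a polynomial matter.\<close>

lemma ideal_term_iff:
  fixes I :: "('v, 'k::field) mpoly set"
  assumes "is_ideal I" "c \<noteq> 0"
  shows "single m c \<in> I \<longleftrightarrow> xm m \<in> I"
proof
  assume "single m c \<in> I"
  then have "single 0 (inverse c) * single m c \<in> I"
    by (rule ideal_mult_left[OF assms(1)])
  then show "xm m \<in> I" using assms(2) by (simp add: mult_single)
next
  assume "xm m \<in> I"
  then have "single 0 c * xm m \<in> I"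
    by (rule ideal_mult_left[OF assms(1)])
  then show "single m c \<in> I" by (simp add: mult_single)
qed

lemma ideal_memI_keys:
  fixes I :: "('v, 'k::field) mpoly set"
  assumes "is_ideal I" "\<And>m. m \<in> keys f \<Longrightarrow> xm m \<in> I"
  shows "f \<in> I"
proof -
  have "(\<Sum>m\<in>keys f. single m (lookup f m)) \<in> I"
  proof (rule ideal_sum[OF assms(1)])
    fix m assume "m \<in> keys f"
    then show "single m (lookup f m) \<in> I"
      using assms(2)[of m] ideal_term_iff[OF assms(1), of "lookup f m" m]
      by (simp add: in_keys_iff)
  qed
  then show ?thesis unfolding poly_eq_sum[symmetric] .
qed

definition monomial_ideal :: "('v, 'k::field) mpoly set \<Rightarrow> bool" where
  "monomial_ideal I \<longleftrightarrow> is_ideal I \<and> (\<forall>f\<in>I. \<forall>m\<in>keys f. xm m \<in> I)"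

lemma monomial_ideal_mem_iff:
  "monomial_ideal I \<Longrightarrow> f \<in> I \<longleftrightarrow> (\<forall>m\<in>keys f. xm m \<in> I)"
  using ideal_memI_keys unfolding monomial_ideal_def by blast

lemma monomial_ideal_filter_terms: "monomial_ideal I \<Longrightarrow> f \<in> I \<Longrightarrow> filter_terms P f \<in> I"
  using monomial_ideal_mem_iff[of I f] monomial_ideal_mem_iff[of I "filter_terms P f"]
  by (simp add: keys_filter_terms)

lemma monomial_ideal_eqI:
  assumes "monomial_ideal I" "monomial_ideal J" "\<And>m. xm m \<in> I \<longleftrightarrow> xm m \<in> J"
  shows "I = J"
  using monomial_ideal_mem_iff[OF assms(1)] monomial_ideal_mem_iff[OF assms(2)] assms(3)
  by blast

lemma monomial_ideal_colon:
  assumes "monomial_ideal I"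
  shows "monomial_ideal (colon I (xm b))"
  unfolding monomial_ideal_def
proof (intro conjI ballI)
  show "is_ideal (colon I (xm b))"
    using assms by (simp add: monomial_ideal_def is_ideal_colon)
  show "xm m \<in> colon I (xm b)" if "f \<in> colon I (xm b)" "m \<in> keys f" for f m
    using that assms unfolding colon_def monomial_ideal_def
    by (fastforce simp: keys_single_mult mult_single)
qed

text \<open>The polynomials all of whose terms are divisible by an element of \<open>M\<close> form an ideal.\<close>

lemma mem_ideal_gen_monomials:
  fixes M :: "('v \<Rightarrow>\<^sub>0 nat) set"
  shows "f \<in> (ideal_gen (xm ` M) :: ('v, 'k::field) mpoly set) \<longleftrightarrow>
    (\<forall>m\<in>keys f. \<exists>a\<in>M. \<exists>b. m = a + b)"
proof
  let ?I = "{f :: ('v, 'k) mpoly. \<forall>m\<in>keys f. \<exists>a\<in>M. \<exists>b. m = a + b}"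
  have "is_ideal ?I"
  proof (rule is_idealI)
    fix c f :: "('v, 'k) mpoly" assume f: "f \<in> ?I"
    show "c * f \<in> ?I"
    proof (rule CollectI, rule ballI)
      fix m assume "m \<in> keys (c * f)"
      then obtain p q where pq: "m = p + q" "q \<in> keys f"
        using keys_mult[of c f] by auto
      then obtain a b where "a \<in> M" "q = a + b" using f by auto
      then show "\<exists>a\<in>M. \<exists>b. m = a + b" using pq by (metis add.left_commute)
    qed
  next
    fix f g :: "('v, 'k) mpoly" assume "f \<in> ?I" "g \<in> ?I"
    then show "f + g \<in> ?I" using keys_add[of f g] by blast
  qed simp
  then have "ideal_gen (xm ` M) \<subseteq> ?I"
    by (rule ideal_gen_minimal[rotated]) (auto intro!: exI[of _ 0])
  then show "f \<in> (ideal_gen (xm ` M) :: ('v, 'k) mpoly set) \<Longrightarrow>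
    \<forall>m\<in>keys f. \<exists>a\<in>M. \<exists>b. m = a + b" by blast
next
  assume *: "\<forall>m\<in>keys f. \<exists>a\<in>M. \<exists>b. m = a + b"
  show "f \<in> (ideal_gen (xm ` M) :: ('v, 'k) mpoly set)"
  proof (rule ideal_memI_keys)
    fix m assume "m \<in> keys f"
    then obtain a b where "a \<in> M" "m = a + b" using * by blast
    then show "xm m \<in> (ideal_gen (xm ` M) :: ('v, 'k) mpoly set)"
      using ideal_mult_right[of "ideal_gen (xm ` M)", OF _ ideal_gen_base] by (auto simp: xm_add)
  qed simp
qed

lemma monomial_ideal_ideal_gen: "monomial_ideal (ideal_gen (xm ` M))"
  unfolding monomial_ideal_def by (auto simp: mem_ideal_gen_monomials)

lemma poly_mapping_add_single_iff:
  "(\<exists>b. m = single v (1::nat) + b) \<longleftrightarrow> lookup m v \<noteq> 0"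
proof
  assume "lookup m v \<noteq> 0"
  then have "m = single v 1 + (m - single v 1)"
    by (intro poly_mapping_eqI) (auto simp: lookup_add lookup_minus lookup_single when_def)
  then show "\<exists>b. m = single v (1::nat) + b" by blast
qed (auto simp: lookup_add)

lemma mem_ideal_gen_vars:
  "f \<in> (ideal_gen (var ` U) :: ('v, 'k::field) mpoly set) \<longleftrightarrow>
    (\<forall>m\<in>keys f. \<exists>u\<in>U. lookup m u \<noteq> 0)"
proof -
  have "(var :: 'v \<Rightarrow> ('v, 'k) mpoly) ` U = xm ` ((\<lambda>u. single u 1) ` U)"
    by (auto simp: var_def)
  then show ?thesis
    by (simp add: mem_ideal_gen_monomials poly_mapping_add_single_iff[simplified])
qed

lemma ideal_gen_vars_sum:
  fixes f :: "('v::finite, 'k::field) mpoly"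
  assumes "f \<in> ideal_gen (var ` U)"
  obtains q where "f = (\<Sum>v\<in>U. var v * q v)"
proof -
  have inj: "inj_on (var :: 'v \<Rightarrow> ('v, 'k) mpoly) U"
  proof (rule inj_onI)
    fix u v :: 'v assume "(var u :: ('v, 'k) mpoly) = var v"
    then have "keys (var u :: ('v, 'k) mpoly) = keys (var v :: ('v, 'k) mpoly)" by (rule arg_cong)
    then have "keys (single u (1::nat)) = keys (single v (1::nat))"
      by (simp add: var_def)
    then show "u = v" by simp
  qed
  obtain u where "f = (\<Sum>v\<in>var ` U. u v * v)"
    using assms Modules.module.span_finite[OF module_times, of "var ` U"] by (auto simp: ideal_gen_def)
  then have "f = (\<Sum>v\<in>U. var v * u (var v))"
    using inj by (simp add: sum.reindex mult.commute)
  then show thesis by (rule that)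
qed

lemma mem_irrelevant_iff: "f \<in> irrelevant_ideal \<longleftrightarrow> lookup f 0 = 0"
proof -
  have "(\<exists>u. lookup m u \<noteq> 0) \<longleftrightarrow> m \<noteq> 0" for m :: "'a \<Rightarrow>\<^sub>0 nat"
    by (metis lookup_zero poly_mapping_eqI)
  then show ?thesis
    by (auto simp: irrelevant_ideal_def mem_ideal_gen_vars) (auto simp: in_keys_iff)
qed

lemma is_ideal_irrelevant [simp]: "is_ideal irrelevant_ideal"
  by (simp add: irrelevant_ideal_def)

lemma var_irrelevant [simp]: "var v \<in> irrelevant_ideal"
  by (simp add: irrelevant_ideal_def ideal_gen_base)

lemma one_not_irrelevant [simp]: "1 \<notin> irrelevant_ideal"
  by (simp add: mem_irrelevant_iff)

lemma monomial_ideal_subset_irrelevant: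
  assumes "monomial_ideal I" "I \<noteq> UNIV"
  shows "I \<subseteq> irrelevant_ideal"
proof
  fix f assume "f \<in> I"
  have "xm 0 \<notin> I" using assms ideal_UNIV_iff[of I] by (simp add: monomial_ideal_def)
  then have "0 \<notin> keys f" using \<open>f \<in> I\<close> assms(1) unfolding monomial_ideal_def by blast
  then show "f \<in> irrelevant_ideal" by (simp add: mem_irrelevant_iff in_keys_iff)
qed

section \<open>Homogeneous components\<close>

lemma homogeneous_zero [simp]: "homogeneous_of_degree t 0"
  by (simp add: homogeneous_of_degree_def)

lemma mon_degree_add: "mon_degree (m + m') = mon_degree m + mon_degree m'"
  by (simp add: mon_degree_def lookup_add sum.distrib)

lemma mon_degree_zero [simp]: "mon_degree 0 = 0"
  by (simp add: mon_degree_def)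

lemma mon_degree_single [simp]: "mon_degree (single v c) = c"
  by (simp add: mon_degree_def lookup_single when_def)

lemma homogeneous_add: "homogeneous_of_degree t f \<Longrightarrow> homogeneous_of_degree t g \<Longrightarrow> homogeneous_of_degree t (f + g)"
  using keys_add[of f g] unfolding homogeneous_of_degree_def by blast

lemma homogeneous_uminus: "homogeneous_of_degree t f \<Longrightarrow> homogeneous_of_degree t (- f)"
  unfolding homogeneous_of_degree_def by (simp add: keys_def)

lemma homogeneous_diff: "homogeneous_of_degree t f \<Longrightarrow> homogeneous_of_degree t g \<Longrightarrow> homogeneous_of_degree t (f - g)"
  using homogeneous_add[of t f "- g"] homogeneous_uminus[of t g] by simp

lemma homogeneous_sum: "(\<And>x. x \<in> A \<Longrightarrow> homogeneous_of_degree t (h x)) \<Longrightarrow> homogeneous_of_degree t (sum h A)"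
  by (induction A rule: infinite_finite_induct) (auto intro: homogeneous_add)

lemma homogeneous_mult:
  assumes "homogeneous_of_degree s f" "homogeneous_of_degree t g" "r = s + t"
  shows "homogeneous_of_degree r (f * g)"
  unfolding homogeneous_of_degree_def
proof
  fix m assume "m \<in> keys (f * g)"
  then obtain p q where "m = p + q" "p \<in> keys f" "q \<in> keys g"
    using keys_mult[of f g] by auto
  then show "int (mon_degree m) = r"
    using assms by (simp add: homogeneous_of_degree_def mon_degree_add)
qed

lemma homogeneous_one: "homogeneous_of_degree 0 1"
  by (simp add: homogeneous_of_degree_def)

lemma homogeneous_var: "homogeneous_of_degree 1 (var v)"
  by (simp add: homogeneous_of_degree_def var_def)

lemma homogeneous_irrelevant:
  "homogeneous_of_degree t f \<Longrightarrow> t \<noteq> 0 \<Longrightarrow> f \<in> irrelevant_ideal"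
  unfolding homogeneous_of_degree_def mem_irrelevant_iff
  by (metis in_keys_iff mon_degree_zero of_nat_0)

definition hcomp :: "int \<Rightarrow> ('v::finite, 'k::field) mpoly \<Rightarrow> ('v, 'k) mpoly" where
  "hcomp t = filter_terms (\<lambda>m. int (mon_degree m) = t)"

lemma homogeneous_hcomp [simp]: "homogeneous_of_degree t (hcomp t f)"
  by (auto simp: homogeneous_of_degree_def hcomp_def keys_filter_terms)

lemma hcomp_homogeneous: "homogeneous_of_degree t f \<Longrightarrow> hcomp t f = f"
  by (simp add: homogeneous_of_degree_def hcomp_def filter_terms_eq_self_iff)

lemma hcomp_zero [simp]: "hcomp t 0 = 0"
  and hcomp_diff: "hcomp t (f - g) = hcomp t f - hcomp t g"
  and hcomp_sum: "hcomp t (\<Sum>x\<in>A. h x) = (\<Sum>x\<in>A. hcomp t (h x))"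
  by (simp_all add: hcomp_def filter_terms_add filter_terms_diff filter_terms_sum)

lemma hcomp_mult:
  assumes "homogeneous_of_degree e a" "s = t - e"
  shows "hcomp t (a * f) = a * hcomp s f"
proof -
  have "hcomp t (single m c * f) = single m c * hcomp s f"
    if "int (mon_degree m) = e" for m c
  proof -
    have "(\<lambda>k. int (mon_degree (m + k)) = t) = (\<lambda>k. int (mon_degree k) = s)"
      using that assms(2) by (auto simp: mon_degree_add)
    then show ?thesis by (simp add: hcomp_def filter_terms_single_mult)
  qed
  then have "hcomp t ((\<Sum>m\<in>keys a. single m (lookup a m)) * f)
     = (\<Sum>m\<in>keys a. single m (lookup a m)) * hcomp s f"
    unfolding sum_distrib_right hcomp_sum
    using assms(1) by (intro sum.cong) (auto simp: homogeneous_of_degree_def)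
  then show ?thesis unfolding poly_eq_sum[symmetric] .
qed

definition graded_ideal :: "('v::finite, 'k::field) mpoly set \<Rightarrow> bool" where
  "graded_ideal I \<longleftrightarrow> is_ideal I \<and> (\<forall>f\<in>I. \<forall>t. hcomp t f \<in> I)"

lemma monomial_graded: "monomial_ideal I \<Longrightarrow> graded_ideal I"
  unfolding graded_ideal_def hcomp_def
  using monomial_ideal_filter_terms by (auto simp: monomial_ideal_def)

section \<open>The Koszul complex\<close>

text \<open>The Koszul signs and the lexicographic order require a numbering of the variables.\<close>

definition idx :: "'v::finite \<Rightarrow> nat" where
  "idx = (SOME f. inj f)"

lemma idx_eq_iff [simp]: "idx u = idx v \<longleftrightarrow> u = v"
proof -
  have "\<exists>f :: 'a \<Rightarrow> nat. inj f"
    using finite_imp_inj_to_nat_seg[of "UNIV :: 'a set"] by auto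
  then have "inj (idx :: 'a \<Rightarrow> nat)" unfolding idx_def by (rule someI_ex)
  then show ?thesis by (simp add: inj_eq)
qed

definition ksign :: "'v::finite \<Rightarrow> 'v set \<Rightarrow> 'a::comm_ring_1" where
  "ksign v S = (- 1) ^ card {u \<in> S. idx u < idx v}"

lemma ksign_square [simp]:
  fixes c :: "'a::comm_ring_1"
  shows "ksign v S * ksign v S = (1 :: 'a)" and "ksign v S * (ksign v S * c) = c"
proof -
  show *: "ksign v S * ksign v S = (1 :: 'a)"
    by (simp add: ksign_def flip: power_mult_distrib)
  show "ksign v S * (ksign v S * c) = c"
    by (simp add: * flip: mult.assoc)
qed

lemma ksign_insert:
  assumes "u \<notin> S"
  shows "ksign v (insert u S) = (if idx u < idx v then - ksign v S else ksign v S)"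
proof -
  have "{w \<in> insert u S. idx w < idx v} =
    (if idx u < idx v then insert u {w \<in> S. idx w < idx v} else {w \<in> S. idx w < idx v})"
    by auto
  then show ?thesis using assms by (simp add: ksign_def)
qed

lemma ksign_insert_self [simp]: "ksign v (insert v S) = ksign v S"
  by (cases "v \<in> S") (auto simp: ksign_insert insert_absorb)

text \<open>Adjoining two basis vectors in opposite orders changes the sign.\<close>

lemma ksign_swap:
  assumes "u \<noteq> v" "u \<notin> S" "v \<notin> S"
  shows "ksign u S * ksign v (insert u S) = - (ksign v S * ksign u (insert v S))"
  using assms by (auto simp: ksign_insert not_less dest: le_neq_implies_less)

text \<open>A Koszul chain is given by its coefficients: \<open>z S\<close> is the coefficient of the exterior product of
  the basis vectors \<open>e\<^sub>v\<close>, \<open>v \<in> S\<close>, in the order of their indices.\<close>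

definition kdiff :: "('v::finite set \<Rightarrow> ('v, 'k::field) mpoly) \<Rightarrow> 'v set \<Rightarrow> ('v, 'k) mpoly" where
  "kdiff z S = (\<Sum>v\<in>-S. ksign v S * var v * z (insert v S))"

lemma kdiff_zero [simp]: "kdiff (\<lambda>S. 0) S = 0"
  and kdiff_add: "kdiff (\<lambda>S. y S + z S) S = kdiff y S + kdiff z S"
  and kdiff_diff: "kdiff (\<lambda>S. y S - z S) S = kdiff y S - kdiff z S"
  and kdiff_mult: "kdiff (\<lambda>S. c * z S) S = c * kdiff z S"
  by (simp_all add: kdiff_def distrib_left right_diff_distrib sum.distrib sum_subtractf
    sum_distrib_left mult_ac)

lemma kdiff_sum: "kdiff (\<lambda>S. \<Sum>a\<in>A. h a S) S = (\<Sum>a\<in>A. kdiff (h a) S)"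
  by (induction A rule: infinite_finite_induct) (auto simp: kdiff_add)

lemma kdiff_mem:
  assumes "is_ideal J" "\<And>S. z S \<in> J"
  shows "kdiff z S \<in> J"
  unfolding kdiff_def using assms by (intro ideal_sum ideal_mult_left)

text \<open>The terms that remove \<open>v\<close> and \<open>u\<close> in the two possible orders cancel. They are paired through
  \<open>idx v < idx u\<close>, since in characteristic two it would not be enough that the sum equals its own
  negative.\<close>

lemma kdiff_kdiff [simp]: "kdiff (kdiff z) S = 0"
proof -
  define F where "F p = (case p of (v, u) \<Rightarrow>
    ksign v S * ksign u (insert v S) * (var v * var u * z (insert u (insert v S))))" for p
  define P where "P = {(v, u). v \<notin> S \<and> u \<notin> S \<and> idx v < idx u}"
  define Q where "Q = {(v, u). v \<notin> S \<and> u \<notin> S \<and> idx u < idx v}"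
  have neg: "F (u, v) = - F (v, u)" if "(v, u) \<in> P" for u v
  proof -
    have "u \<noteq> v" "u \<notin> S" "v \<notin> S" using that by (auto simp: P_def)
    then show ?thesis
      by (simp add: F_def ksign_swap[of v u S] insert_commute[of u v] mult.commute[of "var u"])
  qed
  have "kdiff (kdiff z) S = (\<Sum>v\<in>-S. \<Sum>u\<in>-insert v S. F (v, u))"
    by (simp add: kdiff_def F_def sum_distrib_left mult_ac)
  also have "\<dots> = sum F (SIGMA v:-S. - insert v S)"
    by (subst sum.Sigma) auto
  also have "(SIGMA v:-S. - insert v S) = P \<union> Q"
    by (auto simp: P_def Q_def not_less) (metis idx_eq_iff le_neq_implies_less)
  also have "sum F (P \<union> Q) = sum F P + sum F Q"
    by (rule sum.union_disjoint) (auto simp: P_def Q_def)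
  also have "sum F Q = (\<Sum>(v, u)\<in>P. F (u, v))"
    by (rule sum.reindex_bij_witness[of _ "\<lambda>(v, u). (u, v)" "\<lambda>(v, u). (u, v)"])
      (auto simp: P_def Q_def)
  also have "(\<Sum>(v, u)\<in>P. F (u, v)) = - sum F P"
    by (subst sum_negf[symmetric], rule sum.cong) (auto simp: neg)
  finally show ?thesis by simp
qed

text \<open>Exterior multiplication by \<open>e\<^sub>v\<close>.\<close>

definition kwedge :: "'v::finite \<Rightarrow> ('v set \<Rightarrow> ('v, 'k::field) mpoly) \<Rightarrow> 'v set \<Rightarrow> ('v, 'k) mpoly" where
  "kwedge v z S = (if v \<in> S then ksign v S * z (S - {v}) else 0)"

text \<open>Multiplication by a variable is homotopic to zero, so the irrelevant ideal annihilates Koszul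
  homology.\<close>

lemma kdiff_kwedge: "kdiff (kwedge v z) S = var v * z S - kwedge v (kdiff z) S"
proof (cases "v \<in> S")
  case False
  have "kdiff (kwedge v z) S = (\<Sum>u\<in>-S. if u = v then var v * z S else 0)"
    unfolding kdiff_def by (rule sum.cong) (use False in \<open>auto simp: kwedge_def mult_ac\<close>)
  then show ?thesis using False by (simp add: kwedge_def)
next
  case True
  define T where "T = S - {v}"
  have T: "v \<notin> T" "S = insert v T" using True by (auto simp: T_def)
  have "kwedge v (kdiff z) S = ksign v S * (\<Sum>u\<in>-T. ksign u T * var u * z (insert u T))"
    using True by (simp add: kwedge_def kdiff_def T_def)
  also have "-T = insert v (- S)" using T by auto
  also have "ksign v S * (\<Sum>u\<in>insert v (- S). ksign u T * var u * z (insert u T)) =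
    var v * z S + (\<Sum>u\<in>-S. ksign v T * ksign u T * var u * z (insert u T))"
    using T by (simp add: distrib_left sum_distrib_left mult_ac)
  also have "(\<Sum>u\<in>-S. ksign v T * ksign u T * var u * z (insert u T)) = (\<Sum>u\<in>-S. - (ksign u S * var u * kwedge v z (insert u S)))"
  proof (rule sum.cong)
    fix u assume u: "u \<in> - S"
    have "insert u S - {v} = insert u T" using u T by auto
    moreover have "ksign v T * ksign u T = - (ksign u S * ksign v (insert u S) :: ('a, 'b) mpoly)"
      using u T by (auto simp: ksign_insert insert_commute[of u v])
    ultimately show "ksign v T * ksign u T * var u * z (insert u T) = - (ksign u S * var u * kwedge v z (insert u S))"
      using T by (simp add: kwedge_def mult_ac)
  qed simp
  finally show ?thesis by (simp add: kdiff_def[of "kwedge v z"] sum_negf)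
qed

text \<open>The chains of homological degree \<open>i\<close> and, for \<open>Some j\<close>, of internal degree \<open>j\<close>, where each
  \<open>e\<^sub>v\<close> has degree one; \<open>None\<close> imposes no homogeneity. Depth involves regular sequences that need not
  be homogeneous, regularity needs the grading, and this option treats both at once.\<close>

definition kchain :: "int option \<Rightarrow> nat \<Rightarrow> ('v::finite set \<Rightarrow> ('v, 'k::field) mpoly) \<Rightarrow> bool" where
  "kchain jo i z \<longleftrightarrow> (\<forall>S. card S \<noteq> i \<longrightarrow> z S = 0) \<and>
     (\<forall>j S. jo = Some j \<longrightarrow> homogeneous_of_degree (j - int i) (z S))"

lemma kchain_add: "kchain jo i y \<Longrightarrow> kchain jo i z \<Longrightarrow> kchain jo i (\<lambda>S. y S + z S)"
  by (simp add: kchain_def homogeneous_add)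

lemma kchain_zero [simp]: "kchain jo i (\<lambda>S. 0)"
  by (simp add: kchain_def)

lemma kchain_kdiff:
  assumes "kchain jo (Suc i) z"
  shows "kchain jo i (kdiff z)"
  unfolding kchain_def
proof (intro conjI allI impI)
  fix S :: "'a set" assume "card S \<noteq> i"
  then show "kdiff z S = 0"
    using assms by (auto simp: kdiff_def kchain_def intro!: sum.neutral)
next
  fix j and S :: "'a set" assume "jo = Some j"
  have hs: "homogeneous_of_degree 0 (ksign v S :: ('a, 'b) mpoly)" for v
    by (auto simp: ksign_def minus_one_power_iff intro: homogeneous_one homogeneous_uminus)
  have "homogeneous_of_degree (j - int i) (ksign v S * (var v * z (insert v S)))" for v
    using assms \<open>jo = Some j\<close>
    by (intro homogeneous_mult[OF hs homogeneous_mult[OF homogeneous_var[of v]],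
        where t1 = "j - int (Suc i)"]) (auto simp: kchain_def)
  then show "homogeneous_of_degree (j - int i) (kdiff z S)"
    unfolding kdiff_def mult.assoc by (rule homogeneous_sum)
qed

lemma kdiff_kchain_zero: "kchain jo 0 z \<Longrightarrow> kdiff z S = 0"
  by (auto simp: kdiff_def kchain_def intro!: sum.neutral)

text \<open>\<open>H\<^sub>i(R/J) = 0\<close>, or its part of degree \<open>j\<close> for \<open>Some j\<close>. Chains with coefficients in \<open>R/J\<close> are
  represented by chains over \<open>R\<close>.\<close>

definition koszul_vanishes :: "int option \<Rightarrow> nat \<Rightarrow> ('v::finite, 'k::field) mpoly set \<Rightarrow> bool" where
  "koszul_vanishes jo i J \<longleftrightarrow> (\<forall>z. kchain jo i z \<longrightarrow> (\<forall>S. kdiff z S \<in> J) \<longrightarrow>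
     (\<exists>w. kchain jo (Suc i) w \<and> (\<forall>S. z S - kdiff w S \<in> J)))"

section \<open>Koszul homology of colon ideals\<close>

text \<open>The two parts of \<open>f = x \<cdot> xdiv x f + xfree x f\<close>.\<close>

definition xdiv :: "'v \<Rightarrow> ('v, 'k::field) mpoly \<Rightarrow> ('v, 'k) mpoly" where
  "xdiv x = Poly_Mapping.map_key ((+) (single x 1))"

definition xfree :: "'v \<Rightarrow> ('v, 'k::field) mpoly \<Rightarrow> ('v, 'k) mpoly" where
  "xfree x = filter_terms (\<lambda>m. lookup m x = 0)"

lemma lookup_xdiv: "lookup (xdiv x f) m = lookup f (single x 1 + m)"
  unfolding xdiv_def by (subst map_key.rep_eq) (auto simp: inj_on_def)

lemma xdiv_zero [simp]: "xdiv x 0 = 0"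
  by (rule poly_mapping_eqI) (simp add: lookup_xdiv)

lemma xdiv_xfree: "f = var x * xdiv x f + xfree x f"
proof (rule poly_mapping_eqI)
  fix m
  show "lookup f m = lookup (var x * xdiv x f + xfree x f) m"
  proof (cases "lookup m x = 0")
    case True
    then have "m \<notin> keys (var x * xdiv x f)"
      unfolding var_def keys_single_mult using poly_mapping_add_single_iff[of m x] by auto
    then show ?thesis using True by (simp add: lookup_add xfree_def lookup_filter_terms in_keys_iff)
  next
    case False
    then obtain b where "m = single x 1 + b"
      using poly_mapping_add_single_iff[of m x] by auto
    then show ?thesis using False
      by (simp add: lookup_add xfree_def lookup_filter_terms var_def lookup_single_mult_add lookup_xdiv)
  qed
qed

lemma xfree_var_mult: "xfree x (var x * f) = 0"
proof -
  have "filter_terms (\<lambda>m. False) f = 0"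
    by (rule poly_mapping_eqI) (simp add: lookup_filter_terms)
  then show ?thesis by (simp add: xfree_def var_def filter_terms_single_mult lookup_add)
qed

lemma xfree_idem [simp]: "xfree x (xfree x f) = xfree x f"
  by (simp add: xfree_def filter_terms_eq_self_iff keys_filter_terms)

lemma xfree_var_mult': "v \<noteq> x \<Longrightarrow> xfree x (var v * f) = var v * xfree x f"
  by (simp add: xfree_def var_def filter_terms_single_mult lookup_add lookup_single)

lemma xfree_ksign_mult: "xfree x (ksign v S * f) = ksign v S * xfree x f"
proof -
  have "xfree x (- f) = - xfree x f"
    by (rule poly_mapping_eqI) (simp add: xfree_def lookup_filter_terms)
  then show ?thesis by (auto simp: ksign_def minus_one_power_iff)
qed

lemma xfree_zero [simp]: "xfree x 0 = 0"
  by (simp add: xfree_def)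

lemma homogeneous_xdiv: "homogeneous_of_degree t f \<Longrightarrow> homogeneous_of_degree (t - 1) (xdiv x f)"
  by (auto simp: homogeneous_of_degree_def in_keys_iff lookup_xdiv mon_degree_add dest!: bspec)

lemma homogeneous_xfree: "homogeneous_of_degree t f \<Longrightarrow> homogeneous_of_degree t (xfree x f)"
  by (auto simp: homogeneous_of_degree_def xfree_def keys_filter_terms)

lemma homogeneous_ksign_mult: "homogeneous_of_degree t f \<Longrightarrow> homogeneous_of_degree t (ksign v S * f)"
  by (auto simp: ksign_def minus_one_power_iff homogeneous_uminus)

text \<open>Let \<open>xz = dw\<close> modulo \<open>I\<close> and \<open>w = x w\<^sub>1 + w\<^sub>0\<close> with \<open>w\<^sub>0\<close> free of \<open>x\<close>. The differential of \<open>w\<^sub>0\<close> is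
  \<open>x u + t\<close>, where \<open>u\<close> collects the coefficients of the terms of \<open>w\<^sub>0\<close> that contain \<open>e\<^sub>x\<close>, and \<open>t\<close> is
  free of \<open>x\<close>. Comparing the terms without \<open>x\<close> in \<open>xz - dw \<in> I\<close>, which is possible since \<open>I\<close> is a
  monomial ideal, gives \<open>t \<in> I\<close>. Then \<open>z = d w\<^sub>1 + u\<close> modulo \<open>I : x\<close>, and \<open>du\<close> consists of
  coefficients of \<open>t\<close> up to sign, so that \<open>u\<close> is a cycle modulo \<open>I\<close>.\<close>

lemma koszul_vanishes_colon:
  fixes I :: "('v::finite, 'k::field) mpoly set"
  assumes I: "monomial_ideal I"
    and van: "koszul_vanishes jo i I" "koszul_vanishes (map_option (\<lambda>j. j + 1) jo) i I"
  shows "koszul_vanishes jo i (colon I (var x))"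
  unfolding koszul_vanishes_def
proof (intro allI impI)
  fix z :: "'v set \<Rightarrow> ('v, 'k) mpoly"
  assume z: "kchain jo i z" and dz: "\<forall>S. kdiff z S \<in> colon I (var x)"
  have id: "is_ideal I" using I by (simp add: monomial_ideal_def)
  let ?j1 = "map_option (\<lambda>j. j + 1) jo"
  have "kchain ?j1 i (\<lambda>S. var x * z S)"
    using z by (auto simp: kchain_def intro!: homogeneous_mult[OF homogeneous_var])
  moreover have "kdiff (\<lambda>S. var x * z S) S \<in> I" for S
    using dz by (simp add: kdiff_mult colon_def)
  ultimately obtain w where w: "kchain ?j1 (Suc i) w" and zw: "\<And>S. var x * z S - kdiff w S \<in> I"
    using van(2) unfolding koszul_vanishes_def by blast
  define w1 where "w1 S = xdiv x (w S)" for S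
  define w0 where "w0 S = xfree x (w S)" for S
  define u where "u S = (if x \<in> S then 0 else ksign x S * w0 (insert x S))" for S
  define t where "t S = (\<Sum>v\<in>-insert x S. ksign v S * (var v * w0 (insert v S)))" for S
  have w1: "kchain jo (Suc i) w1"
  proof -
    have "homogeneous_of_degree (j - int (Suc i)) (w1 S)" if "jo = Some j" for j S
      using homogeneous_xdiv[of "j + 1 - int (Suc i)" "w S" x] w that
      by (simp add: kchain_def w1_def diff_diff_eq add.commute)
    then show ?thesis using w by (simp add: kchain_def w1_def)
  qed
  have u: "kchain jo i u"
    using w unfolding kchain_def u_def w0_def
    by (auto intro!: homogeneous_ksign_mult homogeneous_xfree)
  have dw0: "kdiff w0 S = var x * u S + t S" for S
  proof (cases "x \<in> S")
    case True
    then show ?thesis by (simp add: kdiff_def u_def t_def insert_absorb mult.assoc)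
  next
    case False
    then have "- S = insert x (- insert x S)" by auto
    then show ?thesis using False by (simp add: kdiff_def u_def t_def mult_ac)
  qed
  have dw: "kdiff w S = var x * kdiff w1 S + (var x * u S + t S)" for S
  proof -
    have "kdiff w S = kdiff (\<lambda>S. var x * w1 S + w0 S) S"
      using xdiv_xfree[of "w _" x] by (simp add: w1_def w0_def)
    then show ?thesis by (simp add: kdiff_add kdiff_mult dw0)
  qed
  have t: "t S \<in> I" for S
  proof -
    have free: "xfree x (t S) = t S"
      unfolding t_def xfree_def filter_terms_sum
      by (rule sum.cong) (auto simp: xfree_ksign_mult xfree_var_mult' w0_def simp flip: xfree_def)
    have eq: "var x * z S - kdiff w S = var x * (z S - kdiff w1 S - u S) - t S"
      by (simp add: dw algebra_simps)
    have "xfree x (var x * z S - kdiff w S) = - t S"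
      unfolding eq using xfree_var_mult[of x] free by (simp add: xfree_def filter_terms_diff)
    then have "- t S \<in> I" using monomial_ideal_filter_terms[OF I zw[of S]] by (metis xfree_def)
    then show ?thesis using ideal_uminus[OF id] by fastforce
  qed
  have du: "kdiff u S \<in> I" for S
  proof (cases "x \<in> S")
    case True
    then have "kdiff u S = 0" by (simp add: kdiff_def u_def)
    then show ?thesis by (simp add: ideal_zero[OF id])
  next
    case False
    then have S: "- S = insert x (- insert x S)" by auto
    have "kdiff u S = (\<Sum>v\<in>-insert x S. ksign v S * var v * u (insert v S))"
      unfolding kdiff_def by (subst S) (simp add: u_def)
    also have "\<dots> = (\<Sum>v\<in>-insert x S. - ksign x S * (ksign v (insert x S) * (var v * w0 (insert v (insert x S)))))"
    proof (rule sum.cong)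
      fix v assume "v \<in> - insert x S"
      then have v: "v \<noteq> x" "v \<notin> S" by auto
      have "ksign v S * var v * u (insert v S) =
        (ksign v S * ksign x (insert v S)) * (var v * w0 (insert v (insert x S)))"
        using v False by (simp add: u_def insert_commute mult_ac)
      also have "ksign v S * ksign x (insert v S) = - (ksign x S * ksign v (insert x S) :: ('v, 'k) mpoly)"
        using v False by (intro ksign_swap) auto
      finally show "ksign v S * var v * u (insert v S) =
        - ksign x S * (ksign v (insert x S) * (var v * w0 (insert v (insert x S))))"
        by (simp add: mult_ac)
    qed simp
    also have "\<dots> = - ksign x S * t (insert x S)"
      by (simp add: t_def sum_distrib_left)
    finally show ?thesis using ideal_mult_left[OF id t[of "insert x S"]] by (simp only:)
  qed
  obtain y where y: "kchain jo (Suc i) y" and uy: "\<And>S. u S - kdiff y S \<in> I"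
    using van(1) u du unfolding koszul_vanishes_def by blast
  show "\<exists>w. kchain jo (Suc i) w \<and> (\<forall>S. z S - kdiff w S \<in> colon I (var x))"
  proof (intro exI conjI allI)
    show "kchain jo (Suc i) (\<lambda>S. w1 S + y S)" using w1 y by (rule kchain_add)
    fix S
    have "var x * (z S - kdiff (\<lambda>S. w1 S + y S) S) =
        (var x * z S - kdiff w S) + t S + var x * (u S - kdiff y S)"
      by (simp add: dw kdiff_add algebra_simps)
    then show "z S - kdiff (\<lambda>S. w1 S + y S) S \<in> colon I (var x)"
      using ideal_add[OF id ideal_add[OF id zw[of S] t[of S]] ideal_mult_left[OF id uy[of S]]]
      by (simp add: colon_def)
  qed
qed

section \<open>Regular sequences and Koszul homology\<close>

lemma kchain_kwedge:
  assumes "kchain None i z"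
  shows "kchain None (Suc i) (kwedge v z)"
proof -
  have "z (S - {v}) = 0" if "v \<in> S" "card S \<noteq> Suc i" for S
    using that card.remove[of S v] assms unfolding kchain_def by (metis finite)
  then show ?thesis by (auto simp: kchain_def kwedge_def)
qed

lemma ideal_gen_insert_cofactors:
  assumes "is_ideal J" "kchain None i z" "\<And>S. z S \<in> ideal_gen (insert f J)"
  obtains c where "kchain None i c" "\<And>S. z S - f * c S \<in> J"
proof -
  obtain c0 where c0: "\<And>S. z S - c0 S * f \<in> J"
    using assms(3) unfolding mem_ideal_gen_insert[OF assms(1)] by metis
  show thesis
  proof
    show "kchain None i (\<lambda>S. if card S = i then c0 S else 0)" by (simp add: kchain_def)
    show "z S - f * (if card S = i then c0 S else 0) \<in> J" for S
      using c0[of S] assms(2) by (auto simp: kchain_def mult.commute ideal_zero[OF assms(1)])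
  qed
qed

text \<open>If \<open>f\<close> is regular on \<open>R/J\<close>, then \<open>H\<^sub>i\<^sub>+\<^sub>1(R/(J + (f)))\<close> maps onto the kernel of \<open>f\<close> on
  \<open>H\<^sub>i(R/J)\<close>; this kernel is everything for \<open>f\<close> in the irrelevant ideal. The chain \<open>y\<close> with
  \<open>dy = fz\<close> comes from the homotopies of the variables.\<close>

lemma koszul_vanishes_of_quotient:
  assumes J: "is_ideal J" and f: "f \<in> irrelevant_ideal" and reg: "\<And>g. f * g \<in> J \<Longrightarrow> g \<in> J"
    and van: "koszul_vanishes None (Suc i) (ideal_gen (insert f J))"
  shows "koszul_vanishes None i J"
  unfolding koszul_vanishes_def
proof (intro allI impI)
  fix z :: "'a set \<Rightarrow> ('a, 'b) mpoly"
  assume z: "kchain None i z" and dz: "\<forall>S. kdiff z S \<in> J"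
  obtain q where q: "f = (\<Sum>v\<in>UNIV. var v * q v)"
    using f ideal_gen_vars_sum unfolding irrelevant_ideal_def by metis
  define y where "y S = (\<Sum>v\<in>UNIV. q v * kwedge v z S)" for S
  have y: "kchain None (Suc i) y"
    using kchain_kwedge[OF z] by (simp add: y_def kchain_def)
  have dy: "kdiff y S - f * z S \<in> J" for S
  proof -
    have "kdiff y S = (\<Sum>v\<in>UNIV. q v * kdiff (kwedge v z) S)"
      unfolding y_def by (simp add: kdiff_sum kdiff_mult)
    also have "\<dots> = (\<Sum>v\<in>UNIV. var v * q v * z S) - (\<Sum>v\<in>UNIV. q v * kwedge v (kdiff z) S)"
      by (simp add: kdiff_kwedge right_diff_distrib sum_subtractf mult_ac)
    also have "(\<Sum>v\<in>UNIV. var v * q v * z S) = f * z S"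
      unfolding q sum_distrib_right ..
    finally have "kdiff y S - f * z S = - (\<Sum>v\<in>UNIV. q v * kwedge v (kdiff z) S)" by simp
    moreover have "(\<Sum>v\<in>UNIV. q v * kwedge v (kdiff z) S) \<in> J"
      using dz by (intro ideal_sum[OF J] ideal_mult_left[OF J])
        (auto simp: kwedge_def intro: ideal_mult_left[OF J] ideal_zero[OF J])
    ultimately show ?thesis by (simp add: ideal_uminus[OF J])
  qed
  let ?J = "ideal_gen (insert f J)"
  have sub: "J \<subseteq> ?J" "f \<in> ?J" by (auto intro: ideal_gen_base)
  have "kdiff y S \<in> ?J" for S
    using ideal_add[of ?J, OF _ subsetD[OF sub(1) dy[of S]] ideal_mult_right[of ?J f "z S", OF _ sub(2)]]
    by simp
  then obtain w where w: "kchain None (Suc (Suc i)) w" and yw: "\<And>S. y S - kdiff w S \<in> ?J"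
    using van y unfolding koszul_vanishes_def by blast
  have "kchain None (Suc i) (\<lambda>S. y S - kdiff w S)"
    using y kchain_kdiff[OF w] by (simp add: kchain_def)
  then obtain c where c: "kchain None (Suc i) c" and yc: "\<And>S. y S - kdiff w S - f * c S \<in> J"
    using ideal_gen_insert_cofactors[OF J, of "Suc i" "\<lambda>S. y S - kdiff w S" f] yw by blast
  have "z S - kdiff c S \<in> J" for S
  proof (rule reg)
    have "kdiff (\<lambda>S. y S - kdiff w S - f * c S) S \<in> J"
      by (rule kdiff_mem[OF J yc])
    then have "kdiff y S - f * kdiff c S \<in> J" by (simp add: kdiff_diff kdiff_mult)
    from ideal_diff[OF J this dy[of S]] show "f * (z S - kdiff c S) \<in> J"
      by (simp add: algebra_simps)
  qed
  then show "\<exists>w. kchain None (Suc i) w \<and> (\<forall>S. z S - kdiff w S \<in> J)" using c by blast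
qed

text \<open>The other part of the long exact sequence: \<open>H\<^sub>i(R/(J + (f)))\<close> lies between \<open>H\<^sub>i(R/J)\<close> and
  \<open>H\<^sub>i\<^sub>-\<^sub>1(R/J)\<close>.\<close>

lemma koszul_vanishes_quotient:
  assumes J: "is_ideal J" and reg: "\<And>g. f * g \<in> J \<Longrightarrow> g \<in> J"
    and van: "koszul_vanishes None i J" "\<And>k. i = Suc k \<Longrightarrow> koszul_vanishes None k J"
  shows "koszul_vanishes None i (ideal_gen (insert f J))"
  unfolding koszul_vanishes_def
proof (intro allI impI)
  let ?J = "ideal_gen (insert f J)"
  fix z :: "'a set \<Rightarrow> ('a, 'b) mpoly"
  assume z: "kchain None i z" and dz: "\<forall>S. kdiff z S \<in> ?J"
  have sub: "J \<subseteq> ?J" "f \<in> ?J" by (auto intro: ideal_gen_base)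
  show "\<exists>w. kchain None (Suc i) w \<and> (\<forall>S. z S - kdiff w S \<in> ?J)"
  proof (cases i)
    case 0
    then have "kdiff z S \<in> J" for S using z kdiff_kchain_zero ideal_zero[OF J] by metis
    then show ?thesis using van(1) z sub(1) unfolding koszul_vanishes_def by blast
  next
    case (Suc k)
    obtain c where c: "kchain None k c" and zc: "\<And>S. kdiff z S - f * c S \<in> J"
      using ideal_gen_insert_cofactors[OF J kchain_kdiff] z dz Suc by metis
    have "kdiff c S \<in> J" for S
    proof (rule reg)
      have "kdiff (\<lambda>S. kdiff z S - f * c S) S \<in> J" by (rule kdiff_mem[OF J zc])
      then show "f * kdiff c S \<in> J"
        using ideal_uminus[OF J] by (fastforce simp: kdiff_diff kdiff_mult)
    qed
    then obtain y where y: "kchain None (Suc k) y" and cy: "\<And>S. c S - kdiff y S \<in> J"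
      using van(2)[OF Suc] c unfolding koszul_vanishes_def by blast
    have "kchain None i (\<lambda>S. z S - f * y S)" using z y Suc by (simp add: kchain_def)
    moreover have "kdiff (\<lambda>S. z S - f * y S) S \<in> J" for S
      using ideal_add[OF J zc[of S] ideal_mult_left[OF J cy[of S], of f]]
      by (simp add: kdiff_diff kdiff_mult algebra_simps)
    ultimately obtain w where w: "kchain None (Suc i) w" and zw: "\<And>S. z S - f * y S - kdiff w S \<in> J"
      using van(1) unfolding koszul_vanishes_def by blast
    have "z S - kdiff w S \<in> ?J" for S
      using ideal_add[of ?J, OF _ subsetD[OF sub(1) zw[of S]] ideal_mult_right[of ?J f "y S", OF _ sub(2)]]
      by (simp add: algebra_simps)
    then show ?thesis using w by blast
  qed
qed

text \<open>Regular sequences can be built up and taken apart at their first element, at the cost of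
  enlarging the ideal.\<close>

lemma regular_sequence_quot_Cons:
  assumes "is_ideal J"
  shows "regular_sequence_quot J (f # fs) \<longleftrightarrow>
    (\<forall>g. f * g \<in> J \<longrightarrow> g \<in> J) \<and> regular_sequence_quot (ideal_gen (insert f J)) fs"
proof -
  have eq: "ideal_gen (ideal_gen (insert f J) \<union> A) = ideal_gen (J \<union> insert f A)" for A
    using ideal_gen_Un_gen[of "insert f J" A] by simp
  show ?thesis
    unfolding regular_sequence_quot_def eq
    using ideal_gen_ideal[OF assms] by (auto simp: All_less_Suc2)
qed

lemma regular_sequence_imp_koszul_vanishes:
  fixes J :: "('v::finite, 'k::field) mpoly set"
  assumes "is_ideal J" "set fs \<subseteq> irrelevant_ideal" "regular_sequence_quot J fs"
    and "card (UNIV :: 'v set) < i + length fs"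
  shows "koszul_vanishes None i J"
  using assms
proof (induction fs arbitrary: J i)
  case Nil
  have "z S = 0" if "kchain None i z" for z :: "'v set \<Rightarrow> ('v, 'k) mpoly" and S
    using that Nil.prems(4) card_mono[of UNIV S] unfolding kchain_def by fastforce
  then show ?case using ideal_zero[OF Nil.prems(1)] unfolding koszul_vanishes_def
    by (metis diff_self kchain_zero kdiff_zero)
next
  case (Cons f fs)
  have "koszul_vanishes None (Suc i) (ideal_gen (insert f J))"
    using Cons.prems by (intro Cons.IH) (auto simp: regular_sequence_quot_Cons)
  then show ?case
    using Cons.prems regular_sequence_quot_Cons[OF Cons.prems(1), of f fs]
    by (intro koszul_vanishes_of_quotient[of J f i]) auto
qed

text \<open>The top homology is the socle of \<open>R/J\<close>.\<close>

lemma socle_of_koszul_vanishes: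
  fixes J :: "('v::finite, 'k::field) mpoly set"
  assumes J: "is_ideal J" and van: "koszul_vanishes None (card (UNIV :: 'v set)) J" and g: "\<And>v. var v * g \<in> J"
  shows "g \<in> J"
proof -
  define z :: "'v set \<Rightarrow> ('v, 'k) mpoly" where "z S = (if S = UNIV then g else 0)" for S
  have "kchain None (card (UNIV :: 'v set)) z" by (auto simp: kchain_def z_def)
  moreover have "kdiff z S \<in> J" for S
    unfolding kdiff_def
    by (intro ideal_sum[OF J]) (auto simp: z_def mult.assoc ideal_zero[OF J] intro!: ideal_mult_left[OF J] g)
  ultimately obtain w where w: "kchain None (Suc (card (UNIV :: 'v set))) w" "\<And>S. z S - kdiff w S \<in> J"
    using van unfolding koszul_vanishes_def by blast
  have "kdiff w UNIV = 0" by (simp add: kdiff_def)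
  then show ?thesis using w(2)[of UNIV] by (simp add: z_def)
qed

text \<open>The first hypothesis, that a vanishing socle leaves room for a regular element, is proved below
  as \<open>exists_regular_element\<close>. The ideals that arise here are in general not homogeneous, so
  \<open>J \<subseteq> irrelevant_ideal\<close> takes the place of \<open>J \<noteq> UNIV\<close>: it survives the addition of \<open>f\<close>.\<close>

lemma koszul_vanishes_imp_regular_sequence:
  fixes J :: "('v::finite, 'k::field) mpoly set"
  assumes nzd: "\<And>J :: ('v, 'k) mpoly set. is_ideal J \<Longrightarrow>
      (\<And>g. (\<And>v. var v * g \<in> J) \<Longrightarrow> g \<in> J) \<Longrightarrow> \<exists>f\<in>irrelevant_ideal. \<forall>g. f * g \<in> J \<longrightarrow> g \<in> J"
    and "is_ideal J" "J \<subseteq> irrelevant_ideal"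
    and "\<And>i. card (UNIV :: 'v set) < i + d \<Longrightarrow> koszul_vanishes None i J"
  shows "\<exists>fs. length fs = d \<and> set fs \<subseteq> irrelevant_ideal \<and> regular_sequence_quot J fs"
  using assms(2-)
proof (induction d arbitrary: J)
  case 0
  then have "J \<noteq> UNIV" using one_not_irrelevant by blast
  then have "regular_sequence_quot J []"
    by (simp add: regular_sequence_quot_def ideal_gen_ideal 0)
  then show ?case by simp
next
  case (Suc d)
  obtain f where f: "f \<in> irrelevant_ideal" "\<And>g. f * g \<in> J \<Longrightarrow> g \<in> J"
    using nzd[OF Suc.prems(1) socle_of_koszul_vanishes[OF Suc.prems(1) Suc.prems(3)]] by auto
  have "\<exists>fs. length fs = d \<and> set fs \<subseteq> irrelevant_ideal \<and> regular_sequence_quot (ideal_gen (insert f J)) fs"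
  proof (rule Suc.IH)
    show "ideal_gen (insert f J) \<subseteq> irrelevant_ideal"
      using f(1) Suc.prems(2) by (intro ideal_gen_minimal) auto
    show "koszul_vanishes None i (ideal_gen (insert f J))" if "card (UNIV :: 'v set) < i + d" for i
      using that Suc.prems(1) f(2) by (intro koszul_vanishes_quotient Suc.prems(3)) auto
  qed simp
  then obtain fs where "length fs = d" "set fs \<subseteq> irrelevant_ideal" "regular_sequence_quot (ideal_gen (insert f J)) fs"
    by blast
  then show ?case
    using f by (intro exI[of _ "f # fs"]) (auto simp: regular_sequence_quot_Cons[OF Suc.prems(1)])
qed

lemma regular_sequence_vars:
  assumes "distinct vs"
  shows "regular_sequence_quot {0} (map var vs :: ('v::finite, 'k::field) mpoly list)"
proof -
  have gen: "ideal_gen ({0} \<union> var ` U) = (ideal_gen (var ` U) :: ('v, 'k) mpoly set)" for U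
    by (rule equalityI; rule ideal_gen_minimal) (auto intro: ideal_gen_base ideal_zero)
  have "1 \<notin> (ideal_gen (var ` U) :: ('v, 'k) mpoly set)" for U
    by (simp add: mem_ideal_gen_vars)
  moreover have "g \<in> (ideal_gen (var ` U) :: ('v, 'k) mpoly set)" if "var v * g \<in> ideal_gen (var ` U)" "v \<notin> U" for g v U
  proof -
    have "\<exists>u\<in>U. lookup m u \<noteq> 0" if "m \<in> keys g" for m
    proof -
      have "single v 1 + m \<in> keys (var v * g)"
        unfolding var_def keys_single_mult using that by blast
      then obtain u where "u \<in> U" "lookup (single v 1 + m) u \<noteq> 0"
        using \<open>var v * g \<in> _\<close> unfolding mem_ideal_gen_vars by blast
      then show ?thesis using \<open>v \<notin> U\<close> by (auto simp: lookup_add lookup_single when_def split: if_splits)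
    qed
    then show ?thesis unfolding mem_ideal_gen_vars by blast
  qed
  moreover have "vs ! i \<notin> set (take i vs)" if "i < length vs" for i
    using that assms by (auto simp: in_set_conv_nth nth_eq_iff_index_eq)
  ultimately show ?thesis
    unfolding regular_sequence_quot_def take_map set_map gen by (auto simp: take_map gen) (metis UNIV_I)
qed

lemma is_ideal_0 [simp]: "is_ideal {0}"
  by (rule is_idealI) auto

text \<open>The variables form a regular sequence on \<open>R\<close>, so the Koszul complex of \<open>R\<close> is exact in positive
  degrees. If a homogeneous cycle is the boundary of some chain, it is the boundary of a homogeneous
  component of that chain.\<close>

lemma koszul_exact:
  fixes z :: "'v::finite set \<Rightarrow> ('v, 'k::field) mpoly"
  assumes z: "kchain jo (Suc i) z" and dz: "\<And>S. kdiff z S = 0"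
  obtains w where "kchain jo (Suc (Suc i)) w" "\<And>S. z S = kdiff w S"
proof -
  obtain vs :: "'v list" where vs: "distinct vs" "set vs = UNIV"
    using finite_distinct_list[of "UNIV :: 'v set"] by auto
  have len: "length vs = card (UNIV :: 'v set)" using vs distinct_card by fastforce
  have "koszul_vanishes None (Suc i) ({0} :: ('v, 'k) mpoly set)"
    by (rule regular_sequence_imp_koszul_vanishes[OF _ _ regular_sequence_vars[OF vs(1)]])
      (auto simp: len)
  moreover have "kchain None (Suc i) z" using z by (simp add: kchain_def)
  ultimately obtain w where w: "kchain None (Suc (Suc i)) w" "\<And>S. z S = kdiff w S"
    using dz unfolding koszul_vanishes_def by auto
  show thesis
  proof (cases jo)
    case None
    then show thesis using that w by simp
  next
    case (Some j)
    define w' where "w' S = hcomp (j - int (Suc (Suc i))) (w S)" for S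
    have "kchain jo (Suc (Suc i)) w'" using w(1) by (simp add: kchain_def w'_def Some)
    moreover have "z S = kdiff w' S" for S
    proof -
      have h: "hcomp (j - int (Suc i)) (ksign v S * var v * f) = ksign v S * var v * hcomp (j - int (Suc (Suc i))) f" for v f
        by (rule hcomp_mult[where e = 1]) (auto intro!: homogeneous_ksign_mult homogeneous_var)
      have "z S = hcomp (j - int (Suc i)) (z S)"
        using z Some by (simp add: kchain_def hcomp_homogeneous)
      also have "\<dots> = kdiff w' S"
        unfolding w(2) kdiff_def hcomp_sum h w'_def ..
      finally show ?thesis .
    qed
    ultimately show thesis by (rule that)
  qed
qed

section \<open>Hilbert's basis theorem\<close>

text \<open>A monotone subsequence exists; if it decreases, it is constant from its minimum onwards.\<close>

lemma nat_seq_incseq_subseq: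
  fixes s :: "nat \<Rightarrow> nat"
  obtains h :: "nat \<Rightarrow> nat" where "strict_mono h" "\<And>i j. i \<le> j \<Longrightarrow> s (h i) \<le> s (h j)"
proof -
  obtain f where f: "strict_mono f" "monoseq (\<lambda>n. s (f n))"
    using seq_monosub[of s] by auto
  show thesis
  proof (cases "\<forall>m. \<forall>n\<ge>m. s (f m) \<le> s (f n)")
    case True
    then show thesis using that f(1) by blast
  next
    case False
    then have dec: "s (f n) \<le> s (f m)" if "m \<le> n" for m n
      using f(2) that unfolding monoseq_def by blast
    obtain N where N: "\<And>n. s (f N) \<le> s (f n)"
      using ex_has_least_nat[of "\<lambda>_. True" _ "\<lambda>n. s (f n)"] by auto
    show thesis
    proof (rule that[of "\<lambda>n. f (N + n)"])
      show "strict_mono (\<lambda>n. f (N + n))" using f(1) by (simp add: strict_mono_def)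
      show "s (f (N + i)) \<le> s (f (N + j))" for i j
        using dec[of N "N + i"] N[of "N + j"] by simp
    qed
  qed
qed

lemma dickson_seq:
  fixes a :: "nat \<Rightarrow> 'v \<Rightarrow> nat"
  assumes "finite V"
  shows "\<exists>h :: nat \<Rightarrow> nat. strict_mono h \<and> (\<forall>v\<in>V. \<forall>i j. i \<le> j \<longrightarrow> a (h i) v \<le> a (h j) v)"
  using assms
proof (induction V)
  case empty
  show ?case by (rule exI[of _ id]) (simp add: strict_mono_def)
next
  case (insert v V)
  from insert.IH obtain h :: "nat \<Rightarrow> nat"
    where h: "strict_mono h" "\<forall>v\<in>V. \<forall>i j. i \<le> j \<longrightarrow> a (h i) v \<le> a (h j) v"
    by (elim exE conjE)
  obtain r :: "nat \<Rightarrow> nat" where r: "strict_mono r" "\<And>i j. i \<le> j \<Longrightarrow> a (h (r i)) v \<le> a (h (r j)) v"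
    by (rule nat_seq_incseq_subseq[of "\<lambda>i. a (h i) v"], rule that)
  have "strict_mono (\<lambda>i. h (r i))" using h(1) r(1) by (simp add: strict_mono_def)
  moreover have "r i \<le> r j" if "i \<le> j" for i j using r(1) that by (simp add: strict_mono_less_eq)
  ultimately have "\<forall>u\<in>insert v V. \<forall>i j. i \<le> j \<longrightarrow> a (h (r i)) u \<le> a (h (r j)) u"
    using h(2) r(2) by simp
  then show ?case using \<open>strict_mono (\<lambda>i. h (r i))\<close> by (intro exI[of _ "\<lambda>i. h (r i)"] conjI)
qed

lemma dickson_pair:
  fixes s :: "nat \<Rightarrow> ('v::finite \<Rightarrow>\<^sub>0 nat)"
  obtains i j where "i < j" "\<And>v. lookup (s i) v \<le> lookup (s j) v"
proof -
  obtain h :: "nat \<Rightarrow> nat" where h: "strict_mono h" "\<And>v i j. i \<le> j \<Longrightarrow> lookup (s (h i)) v \<le> lookup (s (h j)) v"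
    using dickson_seq[of "UNIV :: 'v set" "\<lambda>i. lookup (s i)"] by auto
  show thesis
    using that[of "h 0" "h 1"] h(2)[of 0 1] h(1) by (simp add: strict_mono_def)
qed

lemma poly_mapping_le_iff_add:
  fixes m m' :: "'v \<Rightarrow>\<^sub>0 nat"
  shows "(\<exists>b. m' = m + b) \<longleftrightarrow> (\<forall>v. lookup m v \<le> lookup m' v)"
proof
  assume "\<forall>v. lookup m v \<le> lookup m' v"
  then have "m' = m + (m' - m)"
    by (intro poly_mapping_eqI) (simp add: lookup_add lookup_minus)
  then show "\<exists>b. m' = m + b" by blast
qed (auto simp: lookup_add)

text \<open>Otherwise one could choose an infinite sequence of elements of \<open>A\<close> none of which is divisible by
  an earlier one.\<close>

lemma dickson_basis:
  fixes A :: "('v::finite \<Rightarrow>\<^sub>0 nat) set"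
  obtains A0 where "finite A0" "A0 \<subseteq> A" "\<And>a. a \<in> A \<Longrightarrow> \<exists>a0\<in>A0. \<exists>b. a = a0 + b"
proof (rule ccontr)
  assume no_basis: "\<not> thesis"
  note basis = that
  have "\<exists>a\<in>A. \<forall>a0\<in>F. \<not> (\<exists>b. a = a0 + b)" if F: "finite F" "F \<subseteq> A" for F
  proof (rule ccontr)
    assume "\<not> ?thesis"
    then have "\<exists>a0\<in>F. \<exists>b. a = a0 + b" if "a \<in> A" for a using that by blast
    then show False using no_basis basis[OF F] by blast
  qed
  then have "\<forall>F. \<exists>a. finite F \<and> F \<subseteq> A \<longrightarrow> a \<in> A \<and> (\<forall>a0\<in>F. \<not> (\<exists>b. a = a0 + b))"
    by meson
  then obtain pick where "\<forall>F. finite F \<and> F \<subseteq> A \<longrightarrow>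
      pick F \<in> A \<and> (\<forall>a0\<in>F. \<not> (\<exists>b. pick F = a0 + b))"
    unfolding choice_iff by blast
  then have pick: "pick F \<in> A" "a0 \<in> F \<Longrightarrow> \<not> (\<exists>b. pick F = a0 + b)"
    if "finite F" "F \<subseteq> A" for F a0 using that by blast+
  define F where "F n = ((\<lambda>F. insert (pick F) F) ^^ n) {}" for n
  have F: "finite (F n) \<and> F n \<subseteq> A" for n
    by (induction n) (auto simp: F_def intro: pick(1))
  have F_Suc: "F (Suc n) = insert (pick (F n)) (F n)" for n by (simp add: F_def)
  have "mono F" unfolding mono_iff_le_Suc F_Suc by auto
  have "pick (F i) \<in> F j" if "i < j" for i j
    using monoD[OF \<open>mono F\<close>, of "Suc i" j] that F_Suc[of i] by auto
  moreover obtain i j where "i < j"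
      "\<And>v. lookup (pick (F i)) v \<le> lookup (pick (F j)) v"
    by (rule dickson_pair[of "\<lambda>i. pick (F i)"], rule that)
  ultimately show False using pick(2)[of "F j" "pick (F i)"] F[of j] by (auto simp: poly_mapping_le_iff_add)
qed

definition lex_less :: "('v::finite \<Rightarrow>\<^sub>0 nat) \<Rightarrow> ('v \<Rightarrow>\<^sub>0 nat) \<Rightarrow> bool" where
  "lex_less m m' \<longleftrightarrow> (\<exists>v. lookup m v < lookup m' v \<and>
     (\<forall>u. idx u < idx v \<longrightarrow> lookup m u = lookup m' u))"

lemma lex_less_trans: "lex_less a b \<Longrightarrow> lex_less b c \<Longrightarrow> lex_less a c"
proof -
  assume "lex_less a b" "lex_less b c"
  then obtain u v where u: "lookup a u < lookup b u"
      "\<And>w. idx w < idx u \<Longrightarrow> lookup a w = lookup b w"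
    and v: "lookup b v < lookup c v"
      "\<And>w. idx w < idx v \<Longrightarrow> lookup b w = lookup c w"
    unfolding lex_less_def by blast
  consider "idx u < idx v" | "u = v" | "idx v < idx u" using nat_neq_iff idx_eq_iff by metis
  then show ?thesis
  proof cases
    case 1
    then show ?thesis unfolding lex_less_def using u v by (intro exI[of _ u]) auto
  next
    case 2
    then show ?thesis unfolding lex_less_def using u v by (intro exI[of _ u]) auto
  next
    case 3
    then show ?thesis unfolding lex_less_def using u v by (intro exI[of _ v]) auto
  qed
qed

lemma lex_less_add: "lex_less m m' \<Longrightarrow> lex_less (b + m) (b + m')"
  by (auto simp: lex_less_def lookup_add)

lemma lex_less_total: "m \<noteq> m' \<Longrightarrow> lex_less m m' \<or> lex_less m' m"
proof -
  assume "m \<noteq> m'"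
  then obtain v where "lookup m v \<noteq> lookup m' v"
    by (auto simp: poly_mapping_eq_iff fun_eq_iff)
  then obtain v where "lookup m v \<noteq> lookup m' v"
    "\<And>u. lookup m u \<noteq> lookup m' u \<Longrightarrow> idx v \<le> idx u"
    using ex_has_least_nat[of "\<lambda>v. lookup m v \<noteq> lookup m' v" v idx] by auto
  then show ?thesis unfolding lex_less_def by (metis linorder_neqE_nat not_le)
qed

text \<open>In an infinite descending chain some monomial would divide a later one, hence not be larger.\<close>

lemma wf_lex_less: "wfP lex_less"
  unfolding wfp_def wf_iff_no_infinite_down_chain
proof
  assume "\<exists>s. \<forall>i. (s (Suc i), s i) \<in> {(m :: 'a \<Rightarrow>\<^sub>0 nat, m'). lex_less m m'}"
  then obtain s :: "nat \<Rightarrow> ('a \<Rightarrow>\<^sub>0 nat)" where s: "\<And>i. lex_less (s (Suc i)) (s i)" by auto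
  have less: "lex_less (s j) (s i)" if "i < j" for i j
    using that by (induction rule: strict_inc_induct) (auto intro: s lex_less_trans)
  obtain i j where "i < j" "\<And>v. lookup (s i) v \<le> lookup (s j) v"
    by (rule dickson_pair[of s], rule that)
  then show False using less[of i j] unfolding lex_less_def by (meson not_le)
qed

definition is_lead :: "('v::finite, 'k::field) mpoly \<Rightarrow> ('v \<Rightarrow>\<^sub>0 nat) \<Rightarrow> bool" where
  "is_lead f m \<longleftrightarrow> m \<in> keys f \<and> (\<forall>m'\<in>keys f. m' = m \<or> lex_less m' m)"

lemma is_lead_exists:
  assumes "f \<noteq> 0"
  obtains m where "is_lead f m"
proof -
  have "\<exists>m\<in>K. \<forall>m'\<in>K. m' = m \<or> lex_less m' m" if "finite K" "K \<noteq> {}" for K :: "('a \<Rightarrow>\<^sub>0 nat) set"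
    using that
  proof (induction K rule: finite_ne_induct)
    case (insert a K)
    then obtain m where m: "m \<in> K" "\<forall>m'\<in>K. m' = m \<or> lex_less m' m" by blast
    show ?case
    proof (cases "lex_less m a")
      case True
      then have "\<forall>m'\<in>insert a K. m' = a \<or> lex_less m' a"
        using m(2) lex_less_trans[OF _ True] by auto
      then show ?thesis by blast
    next
      case False
      then have "\<forall>m'\<in>insert a K. m' = m \<or> lex_less m' m"
        using m(2) lex_less_total[of a m] by auto
      then show ?thesis using m(1) by blast
    qed
  qed auto
  then show thesis using that assms unfolding is_lead_def by (metis finite_keys keys_eq_empty)
qed

text \<open>Finitely many elements of \<open>I\<close> suffice for their leading monomials to divide all leading monomials
  of elements of \<open>I\<close>. Division with remainder by them ends with remainder zero.\<close>

lemma hilbert_basis: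
  fixes I :: "('v::finite, 'k::field) mpoly set"
  assumes I: "is_ideal I"
  shows "\<exists>B. finite B \<and> I = ideal_gen B"
proof -
  obtain A0 where A0: "finite A0" "A0 \<subseteq> {m. \<exists>f\<in>I. is_lead f m}"
    "\<And>m. m \<in> {m. \<exists>f\<in>I. is_lead f m} \<Longrightarrow> \<exists>a\<in>A0. \<exists>b. m = a + b"
    by (rule dickson_basis, rule that)
  have "\<forall>a\<in>A0. \<exists>f. f \<in> I \<and> is_lead f a" using A0(2) by auto
  from bchoice[OF this] obtain g where "\<forall>a\<in>A0. g a \<in> I \<and> is_lead (g a) a" ..
  then have g: "g a \<in> I" "is_lead (g a) a" if "a \<in> A0" for a using that by auto
  have gI: "ideal_gen (g ` A0) \<subseteq> I" using g I by (intro ideal_gen_minimal) auto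
  have "f \<in> ideal_gen (g ` A0)" if "f \<in> I" "is_lead f m" for f m
    using that
  proof (induction m arbitrary: f rule: wfp_induct_rule[OF wf_lex_less])
    case (1 m)
    obtain a b where a: "a \<in> A0" and m: "m = b + a" using A0(3)[of m] 1(2,3) by (auto simp: add.commute)
    define c where "c = lookup f m / lookup (g a) a"
    define f' where "f' = f - single b c * g a"
    have ga: "lookup (g a) a \<noteq> 0"
      using g(2)[OF a] by (simp add: is_lead_def in_keys_iff)
    have f'I: "f' \<in> I" unfolding f'_def by (intro ideal_diff[OF I] ideal_mult_left[OF I] 1(2) g a)
    have m0: "lookup f' m = 0"
      using ga by (simp add: f'_def lookup_minus m lookup_single_mult_add c_def)
    have less: "lex_less k m" if "k \<in> keys f'" for k
    proof -
      have "k \<in> keys f \<or> k \<in> keys (single b c * g a)"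
        using that keys_diff[of f "single b c * g a"] by (auto simp: f'_def)
      moreover have "\<exists>q\<in>keys (g a). k = b + q" if "k \<in> keys (single b c * g a)"
        using that keys_mult[of "single b c" "g a"] by (auto split: if_splits)
      moreover have "k \<noteq> m" using that m0 by (auto simp: in_keys_iff)
      ultimately show ?thesis using 1(3) g(2)[OF a] lex_less_add m unfolding is_lead_def by metis
    qed
    have "f' \<in> ideal_gen (g ` A0)"
    proof (cases "f' = 0")
      case False
      then obtain k where k: "is_lead f' k" by (rule is_lead_exists)
      then show ?thesis using 1(1)[OF less f'I k] by (simp add: is_lead_def)
    qed (simp add: ideal_zero)
    moreover have "single b c * g a \<in> ideal_gen (g ` A0)"
      using a by (intro ideal_mult_left ideal_gen_base) auto
    moreover have "f = f' + single b c * g a" by (simp add: f'_def)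
    ultimately show ?case by (metis ideal_add is_ideal_ideal_gen)
  qed
  then have "I \<subseteq> ideal_gen (g ` A0)"
    using is_lead_exists ideal_zero[OF is_ideal_ideal_gen] by (metis subsetI)
  then show ?thesis using gI A0(1) by blast
qed

definition noetherian :: "'a::comm_ring_1 itself \<Rightarrow> bool" where
  "noetherian _ \<longleftrightarrow> (\<forall>I :: 'a set. is_ideal I \<longrightarrow> (\<exists>B. finite B \<and> I = ideal_gen B))"

lemma noetherian_mpoly: "noetherian TYPE(('v::finite, 'k::field) mpoly)"
  by (simp add: noetherian_def hilbert_basis)

lemma noetherian_ideal_fg:
  "noetherian TYPE('a::comm_ring_1) \<Longrightarrow> is_ideal (I :: 'a set) \<Longrightarrow> \<exists>B. finite B \<and> I = ideal_gen B"
  by (simp add: noetherian_def)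

lemma noetherian_wf:
  assumes "noetherian TYPE('a::comm_ring_1)"
  shows "wf {(J, I). is_ideal I \<and> is_ideal J \<and> I \<subset> (J :: 'a set)}"
  unfolding wf_iff_no_infinite_down_chain
proof
  assume "\<exists>s. \<forall>i. (s (Suc i), s i) \<in> {(J, I). is_ideal I \<and> is_ideal J \<and> I \<subset> (J :: 'a set)}"
  then obtain s :: "nat \<Rightarrow> 'a set"
    where "\<forall>i. (s (Suc i), s i) \<in> {(J, I). is_ideal I \<and> is_ideal J \<and> I \<subset> J}" ..
  then have s: "is_ideal (s i)" "s i \<subset> s (Suc i)" for i by auto
  have mono: "s i \<subseteq> s j" if "i \<le> j" for i j
    by (rule lift_Suc_mono_le[of s, OF psubset_imp_subset[OF s(2)] that])
  have "is_ideal (\<Union>i. s i)"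
  proof (rule is_idealI)
    fix f g assume "f \<in> (\<Union>i. s i)" "g \<in> (\<Union>i. s i)"
    then obtain i j where "f \<in> s i" "g \<in> s j" by blast
    then have "f \<in> s (max i j)" "g \<in> s (max i j)" using mono[of i "max i j"] mono[of j "max i j"] by auto
    then show "f + g \<in> (\<Union>i. s i)" using ideal_add[OF s(1)] by blast
  next
    show "0 \<in> (\<Union>i. s i)" using ideal_zero[OF s(1)] by auto
    show "c * f \<in> (\<Union>i. s i)" if "f \<in> (\<Union>i. s i)" for c f
      using that ideal_mult_left[OF s(1)] by auto
  qed
  from noetherian_ideal_fg[OF assms this]
  obtain B where B: "finite B" "(\<Union>i. s i) = ideal_gen B" by (elim exE conjE)
  have "\<exists>N. B' \<subseteq> s N" if "finite B'" "B' \<subseteq> B" for B'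
    using that
  proof (induction B')
    case (insert b B')
    then obtain N where "B' \<subseteq> s N" by auto
    moreover obtain i where "b \<in> s i" using insert.prems ideal_gen_base[of b B] B(2) by auto
    ultimately have "insert b B' \<subseteq> s (max N i)" using mono[of i "max N i"] mono[of N "max N i"] by auto
    then show ?case ..
  qed auto
  then obtain N where "B \<subseteq> s N" using B(1) by blast
  then have "(\<Union>i. s i) \<subseteq> s N" unfolding B(2) by (rule ideal_gen_minimal) (rule s(1))
  then show False using s(2)[of N] by blast
qed

lemma noetherian_maximal:
  assumes "noetherian TYPE('a::comm_ring_1)" "A \<in> Q" "\<And>I. I \<in> Q \<Longrightarrow> is_ideal (I :: 'a set)"
  shows "\<exists>M\<in>Q. \<forall>I\<in>Q. \<not> M \<subset> I"
proof (rule wfE_min[OF noetherian_wf[OF assms(1)] assms(2)])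
  fix M assume M: "M \<in> Q" and "\<And>I. (I, M) \<in> {(J, I). is_ideal I \<and> is_ideal J \<and> I \<subset> J} \<Longrightarrow> I \<notin> Q"
  then have "\<not> M \<subset> I" if "I \<in> Q" for I using that assms(3)[OF M] assms(3)[OF that] by auto
  then show ?thesis using M by auto
qed

section \<open>Associated primes and regular elements\<close>

definition is_prime_ideal :: "'a::comm_ring_1 set \<Rightarrow> bool" where
  "is_prime_ideal P \<longleftrightarrow> is_ideal P \<and> 1 \<notin> P \<and> (\<forall>a b. a * b \<in> P \<longrightarrow> a \<in> P \<or> b \<in> P)"

lemma mem_colon: "h \<in> colon J g \<longleftrightarrow> g * h \<in> J"
  by (simp add: colon_def)

text \<open>A maximal element among the proper ideals \<open>J : g\<close> is prime.\<close>

lemma associated_prime_above: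
  assumes noeth: "noetherian TYPE('a::comm_ring_1)" and J: "is_ideal (J :: 'a set)" and "g0 \<notin> J"
  obtains g where "g \<notin> J" "colon J g0 \<subseteq> colon J g" "is_prime_ideal (colon J g)"
proof -
  let ?Q = "{colon J g | g. g \<notin> J \<and> colon J g0 \<subseteq> colon J g}"
  have "colon J g0 \<in> ?Q" using assms(3) by blast
  then have "\<exists>C\<in>?Q. \<forall>I\<in>?Q. \<not> C \<subset> I"
    by (rule noetherian_maximal[OF noeth]) (use is_ideal_colon[OF J] in auto)
  then obtain g where g: "g \<notin> J" "colon J g0 \<subseteq> colon J g" and "\<forall>I\<in>?Q. \<not> colon J g \<subset> I"
    by auto
  then have max: False if "h \<notin> J" "colon J g \<subset> colon J h" for h
    using that by blast
  have "is_prime_ideal (colon J g)"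
    unfolding is_prime_ideal_def
  proof (intro conjI allI impI)
    show "is_ideal (colon J g)" by (rule is_ideal_colon[OF J])
    show "1 \<notin> colon J g" using g(1) by (simp add: mem_colon)
    fix a b assume ab: "a * b \<in> colon J g"
    show "a \<in> colon J g \<or> b \<in> colon J g"
    proof (rule disjCI)
      assume "b \<notin> colon J g"
      then have "g * b \<notin> J" by (simp add: mem_colon)
      moreover have "colon J g \<subseteq> colon J (g * b)"
        using ideal_mult_left[OF J] by (auto simp: mem_colon mult.commute[of g b] mult.assoc)
      ultimately have "colon J (g * b) = colon J g" using max by blast
      moreover have "a \<in> colon J (g * b)" using ab by (simp add: mem_colon mult_ac)
      ultimately show "a \<in> colon J g" by simp
    qed
  qed
  then show thesis by (rule that[OF g(1,2)])
qed

lemma colon_mult_prime: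
  assumes "is_prime_ideal (colon J g)" "r \<notin> colon J g"
  shows "colon J (r * g) = colon J g"
proof -
  have "h \<in> colon J (r * g) \<longleftrightarrow> r * h \<in> colon J g" for h by (simp add: mem_colon mult_ac)
  moreover have "r * h \<in> colon J g \<longleftrightarrow> h \<in> colon J g" for h
    using assms ideal_mult_left[of "colon J g" h r] unfolding is_prime_ideal_def by blast
  ultimately show ?thesis by blast
qed

text \<open>By Noetherian induction: if \<open>J : g\<^sub>1\<close> is prime, an associated prime \<open>J : g\<close> of \<open>R/J\<close> either is
  associated to \<open>R/(J + (g\<^sub>1))\<close>, or some multiple of \<open>g\<close> is nonzero in the submodule generated by
  \<open>g\<^sub>1\<close>, which is isomorphic to \<open>R/(J : g\<^sub>1)\<close>, and then \<open>J : g = J : g\<^sub>1\<close>.\<close>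

lemma finite_associated_primes:
  assumes noeth: "noetherian TYPE('a::comm_ring_1)" and "is_ideal (J :: 'a set)"
  shows "finite {P. \<exists>g. g \<notin> J \<and> P = colon J g \<and> is_prime_ideal P}"
  using assms(2)
proof (induction J rule: wf_induct_rule[OF noetherian_wf[OF noeth]])
  case (1 J)
  note J = 1(2)
  show ?case
  proof (cases "J = UNIV")
    case False
    then obtain g1 where g1: "g1 \<notin> J" "is_prime_ideal (colon J g1)"
      using associated_prime_above[OF noeth J] by (metis UNIV_eq_I)
    let ?J1 = "ideal_gen (insert g1 J)"
    have sub: "J \<subseteq> ?J1" "g1 \<in> ?J1" by (auto intro: ideal_gen_base)
    have "{P. \<exists>g. g \<notin> J \<and> P = colon J g \<and> is_prime_ideal P}
      \<subseteq> insert (colon J g1) {P. \<exists>g. g \<notin> ?J1 \<and> P = colon ?J1 g \<and> is_prime_ideal P}"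
    proof
      fix P assume "P \<in> {P. \<exists>g. g \<notin> J \<and> P = colon J g \<and> is_prime_ideal P}"
      then obtain g where g: "g \<notin> J" "P = colon J g" "is_prime_ideal (colon J g)" by blast
      show "P \<in> insert (colon J g1) {P. \<exists>g. g \<notin> ?J1 \<and> P = colon ?J1 g \<and> is_prime_ideal P}"
      proof (cases "\<forall>r. r * g \<in> ?J1 \<longrightarrow> r * g \<in> J")
        case True
        then have "colon ?J1 g = colon J g"
          using sub(1) by (auto simp: mem_colon mult.commute[of g])
        moreover have "g \<notin> ?J1" using True g(1) by (metis mult_1)
        ultimately show ?thesis using g by auto
      next
        case False
        then obtain r where r: "r * g \<in> ?J1" "r * g \<notin> J" by blast
        then obtain s where s: "r * g - s * g1 \<in> J" unfolding mem_ideal_gen_insert[OF J] by blast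
        have "s * g1 \<notin> J" using r(2) s ideal_add[OF J s, of "s * g1"] by auto
        then have "colon J (s * g1) = colon J g1"
          by (intro colon_mult_prime g1) (simp add: mem_colon mult.commute)
        moreover have "colon J (r * g) = colon J g"
          using r(2) by (intro colon_mult_prime g) (simp add: mem_colon mult.commute)
        moreover have "colon J (r * g) = colon J (s * g1)"
        proof -
          have "r * g * h \<in> J \<longleftrightarrow> s * g1 * h \<in> J" for h
            using ideal_mult_right[OF J s, of h] ideal_add[OF J, of "(r * g - s * g1) * h" "s * g1 * h"]
              ideal_diff[OF J, of "r * g * h" "(r * g - s * g1) * h"]
            by (auto simp: left_diff_distrib)
          then show ?thesis by (auto simp: mem_colon)
        qed
        ultimately show ?thesis using g by simp
      qed
    qed
    moreover have "finite {P. \<exists>g. g \<notin> ?J1 \<and> P = colon ?J1 g \<and> is_prime_ideal P}"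
      using sub g1(1) J by (intro 1(1)) auto
    ultimately show ?thesis by (meson finite.insertI finite_subset)
  qed simp
qed

lemma prime_ideal_prod:
  assumes "is_prime_ideal P" "finite A" "(\<Prod>a\<in>A. h a) \<in> P"
  shows "\<exists>a\<in>A. h a \<in> P"
  using assms(2,3)
  by (induction A) (use assms(1) in \<open>auto simp: is_prime_ideal_def\<close>)

text \<open>In an irredundant cover by at least two primes, choose for every \<open>P\<close> an element \<open>a\<^sub>P\<close> of \<open>A\<close> that lies
  in no other prime of the cover; then \<open>a\<^sub>P + \<Prod>\<^bsub>Q \<noteq> P\<^esub> a\<^sub>Q\<close> is an element of \<open>A\<close> outside all primes.\<close>

lemma prime_avoidance:
  assumes "finite \<P>" "\<And>P. P \<in> \<P> \<Longrightarrow> is_prime_ideal P" "is_ideal A" "A \<subseteq> \<Union>\<P>"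
  shows "\<exists>P\<in>\<P>. A \<subseteq> P"
  using assms
proof (induction \<P> rule: finite_psubset_induct)
  case (psubset \<P>)
  note A = psubset.prems(2)
  show ?case
  proof (cases "\<exists>P\<in>\<P>. A \<subseteq> \<Union>(\<P> - {P})")
    case True
    then obtain P where "P \<in> \<P>" "A \<subseteq> \<Union>(\<P> - {P})" by blast
    then show ?thesis using psubset.IH[of "\<P> - {P}"] psubset.prems by blast
  next
    case False
    have "\<forall>P\<in>\<P>. \<exists>a. a \<in> A \<and> (\<forall>Q\<in>\<P>. Q \<noteq> P \<longrightarrow> a \<notin> Q)"
    proof
      fix P assume "P \<in> \<P>"
      then have "\<not> A \<subseteq> \<Union>(\<P> - {P})" using False by simp
      then obtain a where "a \<in> A" "a \<notin> \<Union>(\<P> - {P})" unfolding subset_iff by auto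
      then show "\<exists>a. a \<in> A \<and> (\<forall>Q\<in>\<P>. Q \<noteq> P \<longrightarrow> a \<notin> Q)" by (intro exI[of _ a]) simp
    qed
    from bchoice[OF this] obtain a where "\<forall>P\<in>\<P>. a P \<in> A \<and> (\<forall>Q\<in>\<P>. Q \<noteq> P \<longrightarrow> a P \<notin> Q)" ..
    then have a: "a P \<in> A" "Q \<in> \<P> \<Longrightarrow> Q \<noteq> P \<Longrightarrow> a P \<notin> Q" if "P \<in> \<P>" for P Q
      using that by auto
    have aP: "a P \<in> P" if "P \<in> \<P>" for P using a[OF that] psubset.prems(3) by blast
    obtain P where P: "P \<in> \<P>" using psubset.prems(3) ideal_zero[OF A] by blast
    show ?thesis
    proof (cases "\<P> = {P}")
      case True
      then show ?thesis using psubset.prems(3) by auto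
    next
      case False
      then obtain Q0 where Q0: "Q0 \<in> \<P> - {P}" using P by blast
      let ?p = "\<Prod>Q\<in>\<P> - {P}. a Q"
      have fin: "finite (\<P> - {P})" using psubset.hyps by simp
      have p: "?p \<in> I" if "is_ideal I" "Q \<in> \<P> - {P}" "a Q \<in> I" for Q and I
        using ideal_mult_right[OF that(1,3)] prod.remove[OF fin that(2), of a] by simp
      have "a P + ?p \<in> A" using a(1) P Q0 by (intro ideal_add[OF A] p[OF A Q0]) auto
      then obtain Q where Q: "Q \<in> \<P>" "a P + ?p \<in> Q" using psubset.prems(3) by blast
      have idQ: "is_ideal Q" using psubset.prems(1)[OF Q(1)] by (simp add: is_prime_ideal_def)
      show ?thesis
      proof (cases "Q = P")
        case True
        then have "?p \<in> P" using ideal_diff[OF idQ Q(2), of "a P"] aP[OF P] by simp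
        then obtain Q' where "Q' \<in> \<P> - {P}" "a Q' \<in> P"
          using prime_ideal_prod[OF psubset.prems(1)[OF P] fin] by blast
        then show ?thesis using a(2) P by blast
      next
        case False
        then have "?p \<in> Q" using p[OF idQ, of Q] aP[OF Q(1)] Q(1) by simp
        then have "a P \<in> Q" using ideal_diff[OF idQ Q(2), of ?p] by simp
        then show ?thesis using a(2) P Q(1) False by blast
      qed
    qed
  qed
qed

text \<open>Every zero divisor lies in an associated prime. If the irrelevant ideal consisted of zero divisors,
  it would be contained in a single associated prime \<open>J : g\<close>, and \<open>g\<close> would be in the socle.\<close>

lemma exists_regular_element:
  fixes J :: "('v::finite, 'k::field) mpoly set"
  assumes J: "is_ideal J" and soc: "\<And>g. (\<And>v. var v * g \<in> J) \<Longrightarrow> g \<in> J"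
  shows "\<exists>f\<in>irrelevant_ideal. \<forall>g. f * g \<in> J \<longrightarrow> g \<in> J"
proof (rule ccontr)
  assume *: "\<not> ?thesis"
  let ?Ass = "{P. \<exists>g. g \<notin> J \<and> P = colon J g \<and> is_prime_ideal P}"
  have "irrelevant_ideal \<subseteq> \<Union>?Ass"
  proof
    fix f :: "('v, 'k) mpoly" assume "f \<in> irrelevant_ideal"
    then obtain g0 where g0: "g0 \<notin> J" "f * g0 \<in> J" using * by blast
    obtain g where g: "g \<notin> J" "colon J g0 \<subseteq> colon J g" "is_prime_ideal (colon J g)"
      by (rule associated_prime_above[OF noetherian_mpoly J g0(1)], rule that)
    have "f \<in> colon J g0" using g0(2) by (simp add: mem_colon mult.commute)
    then show "f \<in> \<Union>?Ass" using g by blast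
  qed
  then obtain P where P: "P \<in> ?Ass" "irrelevant_ideal \<subseteq> P"
    using prime_avoidance[OF finite_associated_primes[OF noetherian_mpoly J], of irrelevant_ideal] by auto
  then obtain g where g: "g \<notin> J" "irrelevant_ideal \<subseteq> colon J g" by blast
  have "var v * g \<in> J" for v
    using subsetD[OF g(2) var_irrelevant[of v]] by (simp add: mem_colon mult.commute)
  then show False using soc g(1) by blast
qed

theorem depth_quot_colon_var:
  fixes I :: "('v::finite, 'k::field) mpoly set"
  assumes I: "monomial_ideal I" and proper: "colon I (var x) \<noteq> UNIV"
  shows "depth_quot I \<le> depth_quot (colon I (var x))"
  unfolding depth_quot_def
proof (rule SUP_least)
  fix fs assume "fs \<in> {fs. set fs \<subseteq> irrelevant_ideal \<and> regular_sequence_quot I fs}"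
  then have fs: "set fs \<subseteq> irrelevant_ideal" "regular_sequence_quot I fs" by auto
  have id: "is_ideal I" using I by (simp add: monomial_ideal_def)
  have mon: "monomial_ideal (colon I (var x))"
    unfolding var_def by (rule monomial_ideal_colon[OF I])
  have "\<exists>gs. length gs = length fs \<and> set gs \<subseteq> irrelevant_ideal \<and> regular_sequence_quot (colon I (var x)) gs"
  proof (rule koszul_vanishes_imp_regular_sequence)
    show "colon I (var x) \<subseteq> irrelevant_ideal"
      using monomial_ideal_subset_irrelevant[OF mon proper] .
    show "koszul_vanishes None i (colon I (var x))" if "card (UNIV :: 'v set) < i + length fs" for i
      using regular_sequence_imp_koszul_vanishes[OF id fs that]
      by (intro koszul_vanishes_colon[OF I]) auto
  qed (use exists_regular_element is_ideal_colon[OF id] in auto)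
  then show "enat (length fs) \<le> (SUP fs\<in>{fs. set fs \<subseteq> irrelevant_ideal \<and>
      regular_sequence_quot (colon I (var x)) fs}. enat (length fs))"
    by (metis (mono_tags, lifting) SUP_upper mem_Collect_eq)
qed

section \<open>Submodules of free modules\<close>

text \<open>The elements of a free module \<open>R\<^sup>n\<close> are represented by functions on the natural numbers, so that
  free modules of all ranks are available in one type.\<close>

definition fscale :: "'a::comm_ring_1 \<Rightarrow> (nat \<Rightarrow> 'a) \<Rightarrow> nat \<Rightarrow> 'a" where
  "fscale c u = (\<lambda>r. c * u r)"

lemma fscale_apply [simp]: "fscale c u r = c * u r"
  by (simp add: fscale_def)

interpretation fmod: Modules.module fscale
  by unfold_locales (auto simp: fun_eq_iff algebra_simps)

lemma fun_sum_apply: "(\<Sum>a\<in>A. h a) r = (\<Sum>a\<in>A. h a (r :: nat) :: 'a::comm_ring_1)"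
  by (induction A rule: infinite_finite_induct) auto

text \<open>Induction on the rank: the last coordinates form a finitely generated ideal, and the elements with
  last coordinate zero a submodule of a free module of smaller rank.\<close>

lemma submodule_finitely_generated:
  fixes N :: "(nat \<Rightarrow> 'a::comm_ring_1) set"
  assumes noeth: "noetherian TYPE('a)"
    and "fmod.subspace N" "\<And>u r. u \<in> N \<Longrightarrow> n \<le> r \<Longrightarrow> u r = 0"
  shows "\<exists>G. finite G \<and> G \<subseteq> N \<and> N \<subseteq> fmod.span G"
  using assms(2,3)
proof (induction n arbitrary: N)
  case 0
  then have "u = 0" if "u \<in> N" for u using that by (auto simp: fun_eq_iff)
  then have "N \<subseteq> fmod.span {}" by auto
  then show ?case by blast
next
  case (Suc n)
  note N = Suc.prems(1)
  have ideal: "is_ideal ((\<lambda>u. u n) ` N)"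
  proof (rule is_idealI)
    show "0 \<in> (\<lambda>u. u n) ` N" using fmod.subspace_0[OF N] by (auto intro!: image_eqI[of _ _ 0])
    show "f + g \<in> (\<lambda>u. u n) ` N" if fg: "f \<in> (\<lambda>u. u n) ` N" "g \<in> (\<lambda>u. u n) ` N" for f g
    proof -
      obtain u v where "u \<in> N" "v \<in> N" "f = u n" "g = v n" using fg by auto
      then show ?thesis using fmod.subspace_add[OF N, of u v] by (intro image_eqI[of _ _ "u + v"]) auto
    qed
    show "c * f \<in> (\<lambda>u. u n) ` N" if f: "f \<in> (\<lambda>u. u n) ` N" for c f
    proof -
      obtain u where "u \<in> N" "f = u n" using f by auto
      then show ?thesis using fmod.subspace_scale[OF N, of u c] by (intro image_eqI[of _ _ "fscale c u"]) auto
    qed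
  qed
  from noetherian_ideal_fg[OF noeth this]
  obtain B where B: "finite B" "(\<lambda>u. u n) ` N = ideal_gen B" by (elim exE conjE)
  have "\<forall>b\<in>B. \<exists>u. u \<in> N \<and> u n = b"
  proof
    fix b assume "b \<in> B"
    then have "b \<in> (\<lambda>u. u n) ` N" unfolding B(2) by (rule ideal_gen_base)
    then show "\<exists>u. u \<in> N \<and> u n = b" by auto
  qed
  from bchoice[OF this] obtain f where f: "\<forall>b\<in>B. f b \<in> N \<and> f b n = b" ..
  let ?N0 = "{u \<in> N. u n = 0}"
  have "\<exists>G. finite G \<and> G \<subseteq> ?N0 \<and> ?N0 \<subseteq> fmod.span G"
  proof (rule Suc.IH)
    show "fmod.subspace ?N0"
      using fmod.subspace_0[OF N] fmod.subspace_add[OF N] fmod.subspace_scale[OF N]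
      by (intro fmod.subspaceI) auto
    show "u r = 0" if "u \<in> ?N0" "n \<le> r" for u r
      using that Suc.prems(2)[of u r] by (cases "r = n") auto
  qed
  then obtain G where G: "finite G" "G \<subseteq> ?N0" "?N0 \<subseteq> fmod.span G" by (elim exE conjE)
  have lift: "\<exists>w\<in>fmod.span (f ` B). w n = x" if "x \<in> ideal_gen B" for x
  proof -
    have "is_ideal {x. \<exists>w\<in>fmod.span (f ` B). w n = x}"
    proof (rule is_idealI)
      show "0 \<in> {x. \<exists>w\<in>fmod.span (f ` B). w n = x}"
        using fmod.span_zero[of "f ` B"] by (auto intro!: bexI[of _ 0])
      show "x + y \<in> {x. \<exists>w\<in>fmod.span (f ` B). w n = x}"
        if xy: "x \<in> {x. \<exists>w\<in>fmod.span (f ` B). w n = x}" "y \<in> {x. \<exists>w\<in>fmod.span (f ` B). w n = x}" for x y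
      proof -
        obtain u v where "u \<in> fmod.span (f ` B)" "v \<in> fmod.span (f ` B)" "u n = x" "v n = y" using xy by auto
        then show ?thesis using fmod.span_add[of u "f ` B" v] by (auto intro!: bexI[of _ "u + v"])
      qed
      show "c * x \<in> {x. \<exists>w\<in>fmod.span (f ` B). w n = x}"
        if x: "x \<in> {x. \<exists>w\<in>fmod.span (f ` B). w n = x}" for c x
      proof -
        obtain u where "u \<in> fmod.span (f ` B)" "u n = x" using x by auto
        then show ?thesis using fmod.span_scale[of u "f ` B" c] by (auto intro!: bexI[of _ "fscale c u"])
      qed
    qed
    moreover have "B \<subseteq> {x. \<exists>w\<in>fmod.span (f ` B). w n = x}"
      using f fmod.span_base[of _ "f ` B"] by auto
    ultimately have "ideal_gen B \<subseteq> {x. \<exists>w\<in>fmod.span (f ` B). w n = x}" by (rule ideal_gen_minimal[rotated])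
    then show ?thesis using that by blast
  qed
  have fN: "f ` B \<subseteq> N" using f by auto
  have "N \<subseteq> fmod.span (f ` B \<union> G)"
  proof
    fix u assume u: "u \<in> N"
    then have "u n \<in> ideal_gen B" using B(2) by blast
    then obtain w where w: "w \<in> fmod.span (f ` B)" "w n = u n" using lift by blast
    have "w \<in> N" using w(1) fmod.span_minimal[OF fN N] by blast
    then have "u - w \<in> ?N0" using fmod.subspace_diff[OF N u] w(2) by simp
    then have "u - w \<in> fmod.span (f ` B \<union> G)" using G(3) fmod.span_mono[of G "f ` B \<union> G"] by blast
    moreover have "w \<in> fmod.span (f ` B \<union> G)" using w(1) fmod.span_mono[of "f ` B" "f ` B \<union> G"] by blast
    ultimately have "(u - w) + w \<in> fmod.span (f ` B \<union> G)" by (rule fmod.span_add)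
    then show "u \<in> fmod.span (f ` B \<union> G)" by simp
  qed
  moreover have "finite (f ` B \<union> G)" "f ` B \<union> G \<subseteq> N" using B(1) G fN by auto
  ultimately show ?case by (intro exI[of _ "f ` B \<union> G"] conjI)
qed

section \<open>Homogeneous generators\<close>

text \<open>Homogeneous elements of degree \<open>t\<close> in the graded free module whose basis elements have the
  degrees \<open>e\<close>.\<close>

definition hvec :: "int list \<Rightarrow> int \<Rightarrow> (nat \<Rightarrow> ('v::finite, 'k::field) mpoly) \<Rightarrow> bool" where
  "hvec e t u \<longleftrightarrow> (\<forall>r<length e. homogeneous_of_degree (t - e ! r) (u r))"

definition vcomp :: "int list \<Rightarrow> int \<Rightarrow> (nat \<Rightarrow> ('v::finite, 'k::field) mpoly) \<Rightarrow> nat \<Rightarrow> ('v, 'k) mpoly" where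
  "vcomp e t u r = (if r < length e then hcomp (t - e ! r) (u r) else 0)"

definition graded_submodule :: "int list \<Rightarrow> (nat \<Rightarrow> ('v::finite, 'k::field) mpoly) set \<Rightarrow> bool" where
  "graded_submodule e N \<longleftrightarrow> fmod.subspace N \<and>
     (\<forall>u\<in>N. (\<forall>r\<ge>length e. u r = 0) \<and> (\<forall>t. vcomp e t u \<in> N))"

lemma sum_hcomp_shift:
  assumes "finite T" "\<And>m. m \<in> keys f \<Longrightarrow> int (mon_degree m) + d \<in> T"
  shows "(\<Sum>t\<in>T. hcomp (t - d) f) = f"
proof (rule poly_mapping_eqI)
  fix m
  have "lookup (\<Sum>t\<in>T. hcomp (t - d) f) m =
    (\<Sum>t\<in>T. if t = int (mon_degree m) + d then lookup f m else 0)"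
    unfolding lookup_sum hcomp_def lookup_filter_terms by (rule sum.cong) auto
  also have "\<dots> = lookup f m"
    using assms by (auto simp: in_keys_iff)
  finally show "lookup (\<Sum>t\<in>T. hcomp (t - d) f) m = lookup f m" .
qed

lemma vcomp_sum:
  assumes "\<And>r. length e \<le> r \<Longrightarrow> u r = 0"
  shows "\<exists>T. finite T \<and> u = (\<Sum>t\<in>T. vcomp e t u)"
proof (intro exI conjI)
  let ?T = "\<Union>r<length e. (\<lambda>m. int (mon_degree m) + e ! r) ` keys (u r)"
  show "finite ?T" by simp
  show "u = (\<Sum>t\<in>?T. vcomp e t u)"
  proof
    fix r
    show "u r = (\<Sum>t\<in>?T. vcomp e t u) r"
    proof (cases "r < length e")
      case True
      have "(\<Sum>t\<in>?T. hcomp (t - e ! r) (u r)) = u r"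
        by (rule sum_hcomp_shift) (use True in auto)
      then show ?thesis using True by (simp add: fun_sum_apply vcomp_def)
    next
      case False
      then show ?thesis using assms[of r] by (simp add: fun_sum_apply vcomp_def)
    qed
  qed
qed

definition act :: "nat \<Rightarrow> (nat \<Rightarrow> nat \<Rightarrow> 'a::comm_ring_1) \<Rightarrow> (nat \<Rightarrow> 'a) \<Rightarrow> nat \<Rightarrow> 'a" where
  "act m A u r = (\<Sum>c<m. A r c * u c)"

lemma hvec_vcomp: "hvec e t (vcomp e t u)"
  by (simp add: hvec_def vcomp_def)

definition graded_matrix :: "int list \<Rightarrow> int list \<Rightarrow> (nat \<Rightarrow> nat \<Rightarrow> ('v::finite, 'k::field) mpoly) \<Rightarrow> bool" where
  "graded_matrix e e' A \<longleftrightarrow>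
     (\<forall>r<length e. \<forall>c<length e'. homogeneous_of_degree (e' ! c - e ! r) (A r c))"

text \<open>The columns of \<open>A\<close> minimally generate their span, by Nakayama's lemma: no homogeneous relation
  between them has a coefficient that is a unit.\<close>

definition irredundant :: "int list \<Rightarrow> int list \<Rightarrow> (nat \<Rightarrow> nat \<Rightarrow> ('v::finite, 'k::field) mpoly) \<Rightarrow> bool" where
  "irredundant e e' A \<longleftrightarrow> (\<forall>t u. hvec e' t u \<longrightarrow> (\<forall>r<length e. act (length e') A u r = 0) \<longrightarrow>
     (\<forall>c<length e'. u c \<in> irrelevant_ideal))"

text \<open>The homogeneous components of finitely many generators again generate \<open>N\<close>; among all finite
  homogeneous generating sets, one of least cardinality is irredundant.\<close>

lemma minimal_homogeneous_generators:
  fixes N :: "(nat \<Rightarrow> ('v::finite, 'k::field) mpoly) set"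
  assumes N: "graded_submodule e N"
  shows "\<exists>G. finite G \<and> G \<subseteq> N \<and> N \<subseteq> fmod.span G \<and> (\<forall>g\<in>G. \<exists>t. hvec e t g) \<and>
    (\<forall>g\<in>G. g \<notin> fmod.span (G - {g}))"
proof -
  have sub: "fmod.subspace N" and supp: "\<And>u r. u \<in> N \<Longrightarrow> length e \<le> r \<Longrightarrow> u r = 0"
    and comp: "\<And>u t. u \<in> N \<Longrightarrow> vcomp e t u \<in> N"
    using N by (auto simp: graded_submodule_def)
  define gens where "gens G \<longleftrightarrow> finite G \<and> G \<subseteq> N \<and> N \<subseteq> fmod.span G \<and> (\<forall>g\<in>G. \<exists>t. hvec e t g)" for G
  have "\<exists>G. finite G \<and> G \<subseteq> N \<and> N \<subseteq> fmod.span G"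
    by (rule submodule_finitely_generated[OF noetherian_mpoly sub, of "length e"]) (rule supp)
  then obtain G where G: "finite G" "G \<subseteq> N" "N \<subseteq> fmod.span G" by (elim exE conjE)
  have "\<forall>g\<in>G. \<exists>T. finite T \<and> g = (\<Sum>t\<in>T. vcomp e t g)"
  proof
    fix g assume "g \<in> G"
    then have "\<And>r. length e \<le> r \<Longrightarrow> g r = 0" using G(2) supp by blast
    then show "\<exists>T. finite T \<and> g = (\<Sum>t\<in>T. vcomp e t g)" by (rule vcomp_sum)
  qed
  from bchoice[OF this] obtain T where T: "\<forall>g\<in>G. finite (T g) \<and> g = (\<Sum>t\<in>T g. vcomp e t g)" ..
  let ?H = "\<Union>g\<in>G. (\<lambda>t. vcomp e t g) ` T g"
  have "gens ?H"
    unfolding gens_def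
  proof (intro conjI)
    show "finite ?H" using G(1) T by auto
    show "?H \<subseteq> N" using G(2) comp by auto
    have "G \<subseteq> fmod.span ?H"
    proof
      fix g assume g: "g \<in> G"
      have "(\<Sum>t\<in>T g. vcomp e t g) \<in> fmod.span ?H"
        using g by (intro fmod.span_sum fmod.span_base) auto
      then show "g \<in> fmod.span ?H" using T g by simp
    qed
    then show "N \<subseteq> fmod.span ?H"
      using G(3) fmod.span_minimal[of G "fmod.span ?H"] by auto
    show "\<forall>g\<in>?H. \<exists>t. hvec e t g" by (auto intro: hvec_vcomp)
  qed
  from ex_has_least_nat[of gens, OF this, of card]
  obtain H where H: "gens H" and least: "\<forall>H'. gens H' \<longrightarrow> card H \<le> card H'" by (elim exE conjE)
  have "g \<notin> fmod.span (H - {g})" if g: "g \<in> H" for g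
  proof
    assume *: "g \<in> fmod.span (H - {g})"
    have "H \<subseteq> fmod.span (H - {g})"
    proof
      fix h assume "h \<in> H"
      then show "h \<in> fmod.span (H - {g})"
        using * fmod.span_base[of h "H - {g}"] by (cases "h = g") simp_all
    qed
    then have "fmod.span H \<subseteq> fmod.span (H - {g})" by (intro fmod.span_minimal) auto
    then have "gens (H - {g})" using H by (auto simp: gens_def)
    then have "card H \<le> card (H - {g})" using least by blast
    moreover have "card (H - {g}) < card H" using H g by (intro card_Diff1_less) (auto simp: gens_def)
    ultimately show False by simp
  qed
  then show ?thesis using H by (intro exI[of _ H]) (simp add: gens_def)
qed

text \<open>In a homogeneous relation, a coefficient outside the irrelevant ideal is a nonzero constant and
  would allow the corresponding generator to be dropped.\<close>

lemma graded_submodule_presentation: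
  fixes N :: "(nat \<Rightarrow> ('v::finite, 'k::field) mpoly) set"
  assumes N: "graded_submodule e N"
  shows "\<exists>e' A. graded_matrix e e' A \<and> irredundant e e' A \<and>
    (\<forall>c<length e'. (\<lambda>r. A r c) \<in> N) \<and>
    (\<forall>u\<in>N. \<exists>w. \<forall>r. u r = act (length e') A w r)"
proof -
  obtain G where G: "finite G" "G \<subseteq> N" "N \<subseteq> fmod.span G" "\<forall>g\<in>G. \<exists>t. hvec e t g"
    "\<forall>g\<in>G. g \<notin> fmod.span (G - {g})"
    using minimal_homogeneous_generators[OF N] by (elim exE conjE)
  from bchoice[OF G(4)] obtain t where t: "\<forall>g\<in>G. hvec e (t g) g" ..
  obtain gs where gs: "set gs = G" "distinct gs" using finite_distinct_list[OF G(1)] by blast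
  define e' where "e' = map t gs"
  define A where "A r c = (gs ! c) r" for r c
  have len: "length e' = length gs" by (simp add: e'_def)
  have act: "act (length e') A w r = (\<Sum>c<length gs. w c * (gs ! c) r)" for w r
    by (simp add: act_def len A_def mult.commute)
  have bij: "bij_betw ((!) gs) {..<length gs} G"
    using bij_betw_nth[OF gs(2)] gs(1) by blast
  have "graded_matrix e e' A"
    unfolding graded_matrix_def A_def e'_def using t gs(1) by (auto simp: hvec_def)
  moreover have "\<forall>c<length e'. (\<lambda>r. A r c) \<in> N"
    using G(2) gs(1) by (auto simp: A_def len)
  moreover have "\<exists>w. \<forall>r. u r = act (length e') A w r" if "u \<in> N" for u
  proof -
    have "u \<in> range (\<lambda>q. \<Sum>g\<in>G. fscale (q g) g)"
      using that G(3) unfolding fmod.span_finite[OF G(1)] by (rule subsetD[rotated])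
    then obtain q where q: "u = (\<Sum>g\<in>G. fscale (q g) g)" by (rule rangeE)
    have "u r = act (length e') A (\<lambda>c. q (gs ! c)) r" for r
      unfolding q act fun_sum_apply by (simp add: sum.reindex_bij_betw[OF bij, symmetric])
    then show ?thesis by blast
  qed
  moreover have "irredundant e e' A"
    unfolding irredundant_def
  proof (intro allI impI)
    fix s u c assume u: "hvec e' s u" "\<forall>r<length e. act (length e') A u r = 0" and c: "c < length e'"
    show "u c \<in> irrelevant_ideal"
    proof (rule ccontr)
      assume not: "u c \<notin> irrelevant_ideal"
      define k where "k = lookup (u c) 0"
      have k: "k \<noteq> 0" using not by (simp add: mem_irrelevant_iff k_def)
      have hom: "homogeneous_of_degree (s - e' ! c) (u c)" using u(1) c by (simp add: hvec_def)
      have s: "s - e' ! c = 0" using homogeneous_irrelevant[OF hom] not by blast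
      have uc: "u c = single 0 k"
      proof (rule poly_mapping_eqI)
        fix m :: "'v \<Rightarrow>\<^sub>0 nat"
        have "m = 0" if "m \<in> keys (u c)"
        proof -
          have "mon_degree m = 0" using hom that s by (auto simp: homogeneous_of_degree_def)
          then show ?thesis by (intro poly_mapping_eqI) (simp add: mon_degree_def)
        qed
        then show "lookup (u c) m = lookup (single 0 k) m"
          by (auto simp: lookup_single when_def k_def in_keys_iff)
      qed
      have c': "c < length gs" using c len by simp
      let ?g = "gs ! c"
      have gG: "?g \<in> G" using c' gs(1) by auto
      have supp: "\<And>g r. g \<in> G \<Longrightarrow> length e \<le> r \<Longrightarrow> g r = 0"
        using N G(2) by (auto simp: graded_submodule_def)
      let ?others = "\<Sum>d\<in>{..<length gs} - {c}. fscale (u d) (gs ! d)"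
      have rel: "(\<Sum>d<length gs. u d * (gs ! d) r) = 0" for r
      proof (cases "r < length e")
        case True
        then show ?thesis using u(2) act by simp
      next
        case False
        then have "(gs ! d) r = 0" if "d < length gs" for d
          using that gs(1) by (intro supp) auto
        then show ?thesis by (intro sum.neutral) simp
      qed
      have eq: "fscale (u c) ?g = - ?others"
      proof
        fix r
        have "(\<Sum>d<length gs. u d * (gs ! d) r) = u c * ?g r + (\<Sum>d\<in>{..<length gs} - {c}. u d * (gs ! d) r)"
          using c' by (intro sum.remove) auto
        then show "fscale (u c) ?g r = (- ?others) r"
          using rel[of r] by (simp add: fun_sum_apply eq_neg_iff_add_eq_0)
      qed
      have "gs ! d \<in> G - {?g}" if "d \<in> {..<length gs} - {c}" for d
        using that c' gs by (auto simp: nth_eq_iff_index_eq)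
      then have "- ?others \<in> fmod.span (G - {?g})"
        by (intro fmod.span_neg fmod.span_sum fmod.span_scale fmod.span_base) auto
      then have "fscale (single 0 (inverse k)) (fscale (u c) ?g) \<in> fmod.span (G - {?g})"
        unfolding eq by (rule fmod.span_scale)
      moreover have "fscale (single 0 (inverse k)) (fscale (u c) ?g) = ?g"
        using k by (simp add: fun_eq_iff uc mult_single flip: mult.assoc)
      ultimately show False using G(5) gG by simp
    qed
  qed
  ultimately show ?thesis by blast
qed

section \<open>Existence of minimal resolutions\<close>

text \<open>The conditions on a minimal graded free resolution in terms of functions. Coordinates beyond the
  rank are left unconstrained, which avoids all bookkeeping of dimensions; \<open>min_resolution_iff\<close>
  translates between the two forms.\<close>

definition min_resolution :: "('v::finite, 'k::field) mpoly set \<Rightarrow> (nat \<Rightarrow> int list) \<Rightarrow>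
    (nat \<Rightarrow> ('v, 'k) mpoly) \<Rightarrow> (nat \<Rightarrow> nat \<Rightarrow> nat \<Rightarrow> ('v, 'k) mpoly) \<Rightarrow> bool" where
  "min_resolution I ds a A \<longleftrightarrow>
     (\<forall>r<length (ds 0). homogeneous_of_degree (ds 0 ! r) (a r)) \<and>
     (\<forall>i. graded_matrix (ds i) (ds (Suc i)) (A i)) \<and>
     (\<forall>i. \<forall>r<length (ds i). \<forall>c<length (ds (Suc i)). A i r c \<in> irrelevant_ideal) \<and>
     (\<forall>f. \<exists>u. f - (\<Sum>r<length (ds 0). a r * u r) \<in> I) \<and>
     (\<forall>u. (\<Sum>r<length (ds 0). a r * u r) \<in> I \<longleftrightarrow>
        (\<exists>w. \<forall>r<length (ds 0). u r = act (length (ds 1)) (A 0) w r)) \<and>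
     (\<forall>i u. (\<forall>r<length (ds i). act (length (ds (Suc i))) (A i) u r = 0) \<longleftrightarrow>
        (\<exists>w. \<forall>r<length (ds (Suc i)). u r = act (length (ds (Suc (Suc i)))) (A (Suc i)) w r))"

lemma mult_mat_vec_act:
  assumes "D \<in> carrier_mat n m" "w \<in> carrier_vec m" "r < n"
  shows "(D *\<^sub>v w) $ r = act m (\<lambda>r c. D $$ (r, c)) (\<lambda>c. w $ c) r"
  using assms by (auto simp: act_def scalar_prod_def atLeast0LessThan intro!: sum.cong)

lemma act_cong: "(\<And>c. c < m \<Longrightarrow> u c = v c) \<Longrightarrow> act m A u r = act m A v r"
  by (simp add: act_def)

text \<open>The common form of the exactness conditions at \<open>F\<^sub>0\<close> and at \<open>F\<^bsub>i+1\<^esub>\<close>.\<close>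

lemma image_mat_iff:
  fixes D :: "'a::comm_ring_1 mat"
  assumes D: "D \<in> carrier_mat n m" and PQ: "\<And>v. v \<in> carrier_vec n \<Longrightarrow> P v \<longleftrightarrow> Q (\<lambda>r. v $ r)"
    and Q: "\<And>u u'. (\<And>r. r < n \<Longrightarrow> u r = u' r) \<Longrightarrow> Q u \<Longrightarrow> Q u'"
  shows "{v \<in> carrier_vec n. P v} = (\<lambda>w. D *\<^sub>v w) ` carrier_vec m \<longleftrightarrow>
    (\<forall>u. Q u \<longleftrightarrow> (\<exists>w. \<forall>r<n. u r = act m (\<lambda>r c. D $$ (r, c)) w r))"
proof -
  have img: "v \<in> (\<lambda>w. D *\<^sub>v w) ` carrier_vec m \<longleftrightarrow>
      (\<exists>w. \<forall>r<n. v $ r = act m (\<lambda>r c. D $$ (r, c)) w r)" if v: "v \<in> carrier_vec n" for v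
  proof
    assume "v \<in> (\<lambda>w. D *\<^sub>v w) ` carrier_vec m"
    then obtain w where "w \<in> carrier_vec m" "v = D *\<^sub>v w" by blast
    then show "\<exists>w. \<forall>r<n. v $ r = act m (\<lambda>r c. D $$ (r, c)) w r"
      using mult_mat_vec_act[OF D] by blast
  next
    assume "\<exists>w. \<forall>r<n. v $ r = act m (\<lambda>r c. D $$ (r, c)) w r"
    then obtain w where w: "\<forall>r<n. v $ r = act m (\<lambda>r c. D $$ (r, c)) w r" ..
    have "v = D *\<^sub>v vec m w"
    proof (rule eq_vecI)
      show "dim_vec v = dim_vec (D *\<^sub>v vec m w)" using v D by simp
      fix r assume "r < dim_vec (D *\<^sub>v vec m w)"
      then have r: "r < n" using D by simp
      have "(D *\<^sub>v vec m w) $ r = act m (\<lambda>r c. D $$ (r, c)) (\<lambda>c. vec m w $ c) r"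
        by (rule mult_mat_vec_act[OF D _ r]) simp
      also have "\<dots> = act m (\<lambda>r c. D $$ (r, c)) w r" by (rule act_cong) simp
      finally show "v $ r = (D *\<^sub>v vec m w) $ r" using w r by simp
    qed
    then show "v \<in> (\<lambda>w. D *\<^sub>v w) ` carrier_vec m" by simp
  qed
  have sub: "(\<lambda>w. D *\<^sub>v w) ` carrier_vec m \<subseteq> carrier_vec n" using D by auto
  have "{v \<in> carrier_vec n. P v} = (\<lambda>w. D *\<^sub>v w) ` carrier_vec m \<longleftrightarrow>
    (\<forall>v\<in>carrier_vec n. P v \<longleftrightarrow> v \<in> (\<lambda>w. D *\<^sub>v w) ` carrier_vec m)"
    using sub by auto
  also have "\<dots> \<longleftrightarrow> (\<forall>v\<in>carrier_vec n. Q (\<lambda>r. v $ r) \<longleftrightarrow>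
      (\<exists>w. \<forall>r<n. v $ r = act m (\<lambda>r c. D $$ (r, c)) w r))"
    using PQ img by simp
  also have "\<dots> \<longleftrightarrow> (\<forall>u. Q u \<longleftrightarrow> (\<exists>w. \<forall>r<n. u r = act m (\<lambda>r c. D $$ (r, c)) w r))"
  proof
    assume *: "\<forall>v\<in>carrier_vec n. Q (\<lambda>r. v $ r) \<longleftrightarrow> (\<exists>w. \<forall>r<n. v $ r = act m (\<lambda>r c. D $$ (r, c)) w r)"
    show "\<forall>u. Q u \<longleftrightarrow> (\<exists>w. \<forall>r<n. u r = act m (\<lambda>r c. D $$ (r, c)) w r)"
    proof
      fix u
      have "Q u \<longleftrightarrow> Q (\<lambda>r. vec n u $ r)" using Q[of u "\<lambda>r. vec n u $ r"] Q[of "\<lambda>r. vec n u $ r" u] by auto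
      then show "Q u \<longleftrightarrow> (\<exists>w. \<forall>r<n. u r = act m (\<lambda>r c. D $$ (r, c)) w r)"
        using *[rule_format, of "vec n u"] by auto
    qed
  qed blast
  finally show ?thesis .
qed

lemma min_resolution_iff:
  "minimal_graded_free_resolution I ds a D \<longleftrightarrow>
    a \<in> carrier_vec (length (ds 0)) \<and>
    (\<forall>i. D i \<in> carrier_mat (length (ds i)) (length (ds (Suc i)))) \<and>
    min_resolution I ds (\<lambda>r. a $ r) (\<lambda>i r c. D i $$ (r, c))"
proof (cases "a \<in> carrier_vec (length (ds 0)) \<and>
    (\<forall>i. D i \<in> carrier_mat (length (ds i)) (length (ds (Suc i))))")
  case True
  then have a: "a \<in> carrier_vec (length (ds 0))"
    and D: "\<And>i. D i \<in> carrier_mat (length (ds i)) (length (ds (Suc i)))" by auto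
  have av: "a \<bullet> v = (\<Sum>r<length (ds 0). a $ r * v $ r)" if "v \<in> carrier_vec (length (ds 0))" for v
    using that by (simp add: scalar_prod_def atLeast0LessThan)
  have "(\<forall>f. \<exists>v\<in>carrier_vec (length (ds 0)). f - a \<bullet> v \<in> I) \<longleftrightarrow>
    (\<forall>f. \<exists>u. f - (\<Sum>r<length (ds 0). a $ r * u r) \<in> I)"
  proof -
    have "(\<exists>v\<in>carrier_vec (length (ds 0)). f - a \<bullet> v \<in> I) \<longleftrightarrow>
      (\<exists>u. f - (\<Sum>r<length (ds 0). a $ r * u r) \<in> I)" for f
    proof
      assume "\<exists>u. f - (\<Sum>r<length (ds 0). a $ r * u r) \<in> I"
      then obtain u where "f - (\<Sum>r<length (ds 0). a $ r * u r) \<in> I" ..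
      then show "\<exists>v\<in>carrier_vec (length (ds 0)). f - a \<bullet> v \<in> I"
        by (intro bexI[of _ "vec (length (ds 0)) u"]) (simp_all add: av)
    qed (auto simp: av)
    then show ?thesis by simp
  qed
  moreover have "{v \<in> carrier_vec (length (ds 0)). a \<bullet> v \<in> I} = (\<lambda>w. D 0 *\<^sub>v w) ` carrier_vec (length (ds 1)) \<longleftrightarrow>
    (\<forall>u. (\<Sum>r<length (ds 0). a $ r * u r) \<in> I \<longleftrightarrow>
      (\<exists>w. \<forall>r<length (ds 0). u r = act (length (ds 1)) (\<lambda>r c. D 0 $$ (r, c)) w r))"
  proof (rule image_mat_iff)
    show "D 0 \<in> carrier_mat (length (ds 0)) (length (ds 1))" using D[of 0] by simp
    show "(\<Sum>r<length (ds 0). a $ r * u' r) \<in> I"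
      if "\<And>r. r < length (ds 0) \<Longrightarrow> u r = u' r" "(\<Sum>r<length (ds 0). a $ r * u r) \<in> I" for u u'
    proof -
      have "(\<Sum>r<length (ds 0). a $ r * u' r) = (\<Sum>r<length (ds 0). a $ r * u r)"
        by (rule sum.cong) (use that(1) in auto)
      then show ?thesis using that(2) by simp
    qed
  qed (simp add: av)
  moreover have "{v \<in> carrier_vec (length (ds (Suc i))). D i *\<^sub>v v = 0\<^sub>v (length (ds i))} =
       (\<lambda>w. D (Suc i) *\<^sub>v w) ` carrier_vec (length (ds (Suc (Suc i)))) \<longleftrightarrow>
    (\<forall>u. (\<forall>r<length (ds i). act (length (ds (Suc i))) (\<lambda>r c. D i $$ (r, c)) u r = 0) \<longleftrightarrow>
      (\<exists>w. \<forall>r<length (ds (Suc i)). u r = act (length (ds (Suc (Suc i)))) (\<lambda>r c. D (Suc i) $$ (r, c)) w r))" for i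
  proof (rule image_mat_iff)
    show "D (Suc i) \<in> carrier_mat (length (ds (Suc i))) (length (ds (Suc (Suc i))))" by (rule D)
    show "D i *\<^sub>v v = 0\<^sub>v (length (ds i)) \<longleftrightarrow>
      (\<forall>r<length (ds i). act (length (ds (Suc i))) (\<lambda>r c. D i $$ (r, c)) (\<lambda>r. v $ r) r = 0)"
      if v: "v \<in> carrier_vec (length (ds (Suc i)))" for v
    proof -
      have "D i *\<^sub>v v = 0\<^sub>v (length (ds i)) \<longleftrightarrow> (\<forall>r<length (ds i). (D i *\<^sub>v v) $ r = 0)"
      proof
        assume "D i *\<^sub>v v = 0\<^sub>v (length (ds i))"
        then show "\<forall>r<length (ds i). (D i *\<^sub>v v) $ r = 0" by (metis index_zero_vec(1))
      next
        assume *: "\<forall>r<length (ds i). (D i *\<^sub>v v) $ r = 0"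
        show "D i *\<^sub>v v = 0\<^sub>v (length (ds i))"
          by (rule eq_vecI) (use D[of i] * in auto)
      qed
      then show ?thesis using mult_mat_vec_act[OF D v] by simp
    qed
    show "\<forall>r<length (ds i). act (length (ds (Suc i))) (\<lambda>r c. D i $$ (r, c)) u' r = 0"
      if eq: "\<And>r. r < length (ds (Suc i)) \<Longrightarrow> u r = u' r"
        and 0: "\<forall>r<length (ds i). act (length (ds (Suc i))) (\<lambda>r c. D i $$ (r, c)) u r = 0" for u u'
    proof -
      have "act (length (ds (Suc i))) (\<lambda>r c. D i $$ (r, c)) u r = act (length (ds (Suc i))) (\<lambda>r c. D i $$ (r, c)) u' r" for r
        by (rule act_cong) (rule eq)
      then show ?thesis using 0 by simp
    qed
  qed
  moreover have "elements_mat (D i) \<subseteq> irrelevant_ideal \<longleftrightarrow>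
    (\<forall>r<length (ds i). \<forall>c<length (ds (Suc i)). D i $$ (r, c) \<in> irrelevant_ideal)" for i
    using D[of i] by (fastforce intro: elements_matI elim: elements_matD)
  ultimately show ?thesis
    using True unfolding minimal_graded_free_resolution_def graded_free_resolution_def
      min_resolution_def graded_matrix_def by auto
next
  case False
  then show ?thesis
    unfolding minimal_graded_free_resolution_def graded_free_resolution_def by blast
qed

lemma act_add: "act m A (\<lambda>c. u c + v c) r = act m A u r + act m A v r"
  and act_diff: "act m A (\<lambda>c. u c - v c) r = act m A u r - act m A v r"
  and act_mult: "act m A (\<lambda>c. f * u c) r = f * act m A u r"
  by (simp_all add: act_def distrib_left right_diff_distrib sum.distrib sum_subtractf sum_distrib_left mult_ac)

lemma hcomp_act:
  assumes "graded_matrix e e' A" "r < length e"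
  shows "hcomp (t - e ! r) (act (length e') A u r) = act (length e') A (\<lambda>c. hcomp (t - e' ! c) (u c)) r"
proof -
  have "hcomp (t - e ! r) (A r c * u c) = A r c * hcomp (t - e' ! c) (u c)" if "c < length e'" for c
    using assms that by (intro hcomp_mult[where e = "e' ! c - e ! r"]) (auto simp: graded_matrix_def)
  then show ?thesis by (simp add: act_def hcomp_sum)
qed

definition kernel :: "int list \<Rightarrow> int list \<Rightarrow> (nat \<Rightarrow> nat \<Rightarrow> ('v::finite, 'k::field) mpoly) \<Rightarrow> (nat \<Rightarrow> ('v, 'k) mpoly) set" where
  "kernel e e' A = {u. (\<forall>c\<ge>length e'. u c = 0) \<and> (\<forall>r<length e. act (length e') A u r = 0)}"

lemma graded_kernel:
  assumes "graded_matrix e e' A"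
  shows "graded_submodule e' (kernel e e' A)"
  unfolding graded_submodule_def
proof (intro conjI ballI allI impI)
  have "act m A (u + v) r = act m A u r + act m A v r" "act m A (fscale f u) r = f * act m A u r" for m u v f r
    using act_add[of m A u v r] act_mult[of m A f u r] by (simp_all add: act_def)
  moreover have "act m A 0 r = 0" for m r by (simp add: act_def)
  ultimately show "fmod.subspace (kernel e e' A)"
    by (intro fmod.subspaceI) (auto simp: kernel_def)
  fix u assume u: "u \<in> kernel e e' A"
  show "u c = 0" if "length e' \<le> c" for c using u that by (simp add: kernel_def)
  fix t
  have "act (length e') A (vcomp e' t u) r = 0" if "r < length e" for r
  proof -
    have "act (length e') A (vcomp e' t u) r = act (length e') A (\<lambda>c. hcomp (t - e' ! c) (u c)) r"
      by (rule act_cong) (simp add: vcomp_def)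
    also have "\<dots> = 0" using hcomp_act[OF assms that, of t u] u that by (simp add: kernel_def)
    finally show ?thesis .
  qed
  then show "vcomp e' t u \<in> kernel e e' A" by (simp add: kernel_def vcomp_def)
qed

text \<open>One step of the construction of a resolution. Irredundancy of the columns of \<open>A\<close> makes the
  entries of the next matrix lie in the irrelevant ideal, and the new columns are again chosen
  irredundant.\<close>

lemma next_syzygies:
  assumes A: "graded_matrix e e' A" and irr: "irredundant e e' A"
  shows "\<exists>e'' A'. graded_matrix e' e'' A' \<and> irredundant e' e'' A' \<and>
    (\<forall>r<length e'. \<forall>c<length e''. A' r c \<in> irrelevant_ideal) \<and>
    (\<forall>u. (\<forall>r<length e. act (length e') A u r = 0) \<longleftrightarrow> (\<exists>w. \<forall>r<length e'. u r = act (length e'') A' w r))"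
proof -
  obtain e'' A' where A': "graded_matrix e' e'' A'" "irredundant e' e'' A'"
    and cols: "\<forall>c<length e''. (\<lambda>r. A' r c) \<in> kernel e e' A"
    and gen: "\<forall>u\<in>kernel e e' A. \<exists>w. \<forall>r. u r = act (length e'') A' w r"
    using graded_submodule_presentation[OF graded_kernel[OF A]] by (elim exE conjE)
  have "A' r c \<in> irrelevant_ideal" if "r < length e'" "c < length e''" for r c
  proof -
    have "hvec e' (e'' ! c) (\<lambda>r. A' r c)" using A'(1) that by (simp add: hvec_def graded_matrix_def)
    moreover have "\<forall>r<length e. act (length e') A (\<lambda>r. A' r c) r = 0" using cols that by (simp add: kernel_def)
    ultimately show ?thesis using irr that unfolding irredundant_def by blast
  qed
  moreover have "(\<forall>r<length e. act (length e') A u r = 0) \<longleftrightarrow> (\<exists>w. \<forall>r<length e'. u r = act (length e'') A' w r)" for u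
  proof
    assume 0: "\<forall>r<length e. act (length e') A u r = 0"
    define u' where "u' c = (if c < length e' then u c else 0)" for c
    have "act (length e') A u' r = act (length e') A u r" for r by (rule act_cong) (simp add: u'_def)
    then have "u' \<in> kernel e e' A" using 0 by (simp add: kernel_def u'_def)
    then obtain w where w: "\<forall>r. u' r = act (length e'') A' w r" using gen by blast
    have "u r = act (length e'') A' w r" if "r < length e'" for r
      using w[rule_format, of r] that by (simp add: u'_def)
    then show "\<exists>w. \<forall>r<length e'. u r = act (length e'') A' w r" by blast
  next
    assume "\<exists>w. \<forall>r<length e'. u r = act (length e'') A' w r"
    then obtain w where w: "\<forall>r<length e'. u r = act (length e'') A' w r" ..
    show "\<forall>r<length e. act (length e') A u r = 0"
    proof (intro allI impI)
      fix r assume r: "r < length e"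
      have "act (length e') A u r = act (length e') A (act (length e'') A' w) r"
        by (rule act_cong) (use w in simp)
      also have "\<dots> = (\<Sum>c<length e''. act (length e') A (\<lambda>r. A' r c) r * w c)"
        unfolding act_def sum_distrib_left sum_distrib_right
        by (subst sum.swap) (simp add: mult.assoc)
      also have "\<dots> = 0" using cols r by (intro sum.neutral) (auto simp: kernel_def)
      finally show "act (length e') A u r = 0" .
    qed
  qed
  ultimately show ?thesis using A' by blast
qed

text \<open>The resolution starts with \<open>F\<^sub>0 = R\<close>, so that the first matrix is a row of minimal generators
  of \<open>J\<close>. It lies in the irrelevant ideal because \<open>J\<close> does.\<close>

lemma min_resolution_exists:
  fixes J :: "('v::finite, 'k::field) mpoly set"
  assumes J: "graded_ideal J" and proper: "J \<subseteq> irrelevant_ideal"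
  shows "\<exists>ds a A. min_resolution J ds a A"
proof -
  have id: "is_ideal J" using J by (simp add: graded_ideal_def)
  let ?N = "{u. u 0 \<in> J \<and> (\<forall>r\<ge>1. u r = 0)} :: (nat \<Rightarrow> ('v, 'k) mpoly) set"
  have "graded_submodule [0] ?N"
    unfolding graded_submodule_def
  proof (intro conjI ballI allI impI)
    show "fmod.subspace ?N"
      by (rule fmod.subspaceI) (auto intro: ideal_zero[OF id] ideal_add[OF id] ideal_mult_left[OF id])
  qed (use J in \<open>auto simp: vcomp_def graded_ideal_def\<close>)
  from graded_submodule_presentation[OF this]
  obtain e1 A0 where A0: "graded_matrix [0] e1 A0" "irredundant [0] e1 A0"
    and cols: "\<forall>c<length e1. (\<lambda>r. A0 r c) \<in> ?N"
    and gen: "\<forall>u\<in>?N. \<exists>w. \<forall>r. u r = act (length e1) A0 w r" by (elim exE conjE)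
  \<comment> \<open>Dependent choice along the stages: two consecutive free modules with the map between them.\<close>
  define P where "P s \<longleftrightarrow> (case s of (e, e', A) \<Rightarrow> graded_matrix e e' A \<and> irredundant e e' A \<and>
      (\<forall>r<length e. \<forall>c<length e'. A r c \<in> (irrelevant_ideal :: ('v, 'k) mpoly set)))" for s
  define Q where "Q s s' \<longleftrightarrow> (case (s, s') of ((e, e', A), (f, e'', A')) \<Rightarrow> f = e' \<and>
      (\<forall>u :: nat \<Rightarrow> ('v, 'k) mpoly. (\<forall>r<length e. act (length e') A u r = 0) \<longleftrightarrow>
        (\<exists>w. \<forall>r<length e'. u r = act (length e'') A' w r)))"
    for s s' :: "int list \<times> int list \<times> (nat \<Rightarrow> nat \<Rightarrow> ('v, 'k) mpoly)"
  have P0: "P ([0], e1, A0)"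
    using A0 cols proper by (auto simp: P_def)
  have step: "\<exists>s'. P s' \<and> Q s s'" if "P s" for s
  proof -
    obtain e e' A where s: "s = (e, e', A)" by (cases s) auto
    then have "graded_matrix e e' A" "irredundant e e' A" using that by (auto simp: P_def)
    from next_syzygies[OF this] obtain e'' A' where "graded_matrix e' e'' A'" "irredundant e' e'' A'"
      "\<forall>r<length e'. \<forall>c<length e''. A' r c \<in> irrelevant_ideal"
      "\<forall>u. (\<forall>r<length e. act (length e') A u r = 0) \<longleftrightarrow> (\<exists>w. \<forall>r<length e'. u r = act (length e'') A' w r)"
      by (elim exE conjE)
    then show ?thesis by (intro exI[of _ "(e', e'', A')"]) (simp add: P_def Q_def s)
  qed
  have "\<exists>f. f 0 = ([0], e1, A0) \<and> (\<forall>n. P (f n) \<and> Q (f n) (f (Suc n)))"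
  proof -
    have "\<exists>f. \<forall>n. (P (f n) \<and> (n = 0 \<longrightarrow> f n = ([0], e1, A0))) \<and> Q (f n) (f (Suc n))"
      by (rule dependent_nat_choice[where P = "\<lambda>n s. P s \<and> (n = 0 \<longrightarrow> s = ([0], e1, A0))" and Q = "\<lambda>n. Q"])
        (use P0 step in auto)
    then show ?thesis by blast
  qed
  then obtain f where f0: "f 0 = ([0], e1, A0)" and f: "\<And>n. P (f n)" "\<And>n. Q (f n) (f (Suc n))"
    by (elim exE conjE) auto
  define ds where "ds n = fst (f n)" for n
  define A where "A n = snd (snd (f n))" for n
  have next_ds: "fst (snd (f n)) = ds (Suc n)" for n
    using f(2)[of n] by (auto simp: Q_def ds_def split: prod.splits)
  have fn: "f n = (ds n, ds (Suc n), A n)" for n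
    by (simp add: ds_def A_def next_ds[unfolded ds_def, symmetric])
  have ds0: "ds 0 = [0]" "ds (Suc 0) = e1" "A 0 = A0" using f0 fn[of 0] by auto
  have "min_resolution J ds (\<lambda>r. 1) A"
    unfolding min_resolution_def
  proof (intro conjI)
    show "\<forall>r<length (ds 0). homogeneous_of_degree (ds 0 ! r) (1 :: ('v, 'k) mpoly)"
      by (simp add: ds0 homogeneous_one)
    show "\<forall>i. graded_matrix (ds i) (ds (Suc i)) (A i)"
      "\<forall>i. \<forall>r<length (ds i). \<forall>c<length (ds (Suc i)). A i r c \<in> irrelevant_ideal"
      using f(1) by (auto simp: fn P_def)
    show "\<forall>i u. (\<forall>r<length (ds i). act (length (ds (Suc i))) (A i) u r = 0) \<longleftrightarrow>
        (\<exists>w. \<forall>r<length (ds (Suc i)). u r = act (length (ds (Suc (Suc i)))) (A (Suc i)) w r)"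
      using f(2) by (simp add: fn Q_def)
    show "\<forall>g. \<exists>u. g - (\<Sum>r<length (ds 0). 1 * u r) \<in> J"
    proof
      fix g
      have "g - (\<Sum>r<length (ds 0). 1 * (\<lambda>_. g) r) \<in> J" by (simp add: ds0 ideal_zero[OF id])
      then show "\<exists>u. g - (\<Sum>r<length (ds 0). 1 * u r) \<in> J" by (rule exI[of _ "\<lambda>_. g"])
    qed
    show "\<forall>u. (\<Sum>r<length (ds 0). 1 * u r) \<in> J \<longleftrightarrow>
        (\<exists>w. \<forall>r<length (ds 0). u r = act (length (ds 1)) (A 0) w r)"
    proof
      fix u :: "nat \<Rightarrow> ('v, 'k) mpoly"
      have "u 0 \<in> J \<longleftrightarrow> (\<exists>w. u 0 = act (length e1) A0 w 0)"
      proof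
        assume "u 0 \<in> J"
        then have "(\<lambda>r. if r = 0 then u 0 else 0) \<in> ?N" by simp
        from bspec[OF gen this] obtain w where "\<forall>r. (if r = 0 then u 0 else 0) = act (length e1) A0 w r" ..
        from spec[OF this, of 0] have "u 0 = act (length e1) A0 w 0" by simp
        then show "\<exists>w. u 0 = act (length e1) A0 w 0" by (rule exI[of _ w])
      next
        assume "\<exists>w. u 0 = act (length e1) A0 w 0"
        then show "u 0 \<in> J" using cols by (auto simp: act_def intro!: ideal_sum[OF id] ideal_mult_right[OF id])
      qed
      then show "(\<Sum>r<length (ds 0). 1 * u r) \<in> J \<longleftrightarrow>
        (\<exists>w. \<forall>r<length (ds 0). u r = act (length (ds 1)) (A 0) w r)"
        by (simp add: ds0)
    qed
  qed
  then show ?thesis by blast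
qed

lemma minimal_graded_free_resolution_exists:
  fixes J :: "('v::finite, 'k::field) mpoly set"
  assumes "graded_ideal J" "J \<subseteq> irrelevant_ideal"
  shows "\<exists>ds a D. minimal_graded_free_resolution J ds a D"
proof -
  obtain ds a A where *: "min_resolution J ds a A"
    using min_resolution_exists[OF assms] by (elim exE)
  define D where "D i = mat (length (ds i)) (length (ds (Suc i))) (\<lambda>(r, c). A i r c)" for i
  have act: "act (length (ds (Suc i))) (\<lambda>r c. D i $$ (r, c)) w r = act (length (ds (Suc i))) (A i) w r"
    if "r < length (ds i)" for i w r
    using that by (simp add: act_def D_def)
  have "min_resolution J ds (\<lambda>r. vec (length (ds 0)) a $ r) (\<lambda>i r c. D i $$ (r, c))"
    using * act[of _ 0] unfolding min_resolution_def graded_matrix_def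
    by (simp add: act) (simp add: D_def)
  then have "minimal_graded_free_resolution J ds (vec (length (ds 0)) a) D"
    unfolding min_resolution_iff by (simp add: D_def)
  then show ?thesis by blast
qed

section \<open>Graded Betti numbers from Koszul homology\<close>

text \<open>Koszul chains with coefficients in a graded free module, one component for each basis element.\<close>

definition vchain :: "int list \<Rightarrow> int \<Rightarrow> nat \<Rightarrow> (nat \<Rightarrow> 'v::finite set \<Rightarrow> ('v, 'k::field) mpoly) \<Rightarrow> bool" where
  "vchain e j i z \<longleftrightarrow> (\<forall>r<length e. kchain (Some (j - e ! r)) i (z r))"

text \<open>\<open>H\<^sub>i(F/N)\<close> vanishes in degree \<open>j\<close>, for a submodule \<open>N\<close> of the graded free module \<open>F\<close> whose basis
  elements have the degrees \<open>e\<close>.\<close>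

definition tor_vanishes :: "int list \<Rightarrow> (nat \<Rightarrow> ('v::finite, 'k::field) mpoly) set \<Rightarrow> int \<Rightarrow> nat \<Rightarrow> bool" where
  "tor_vanishes e N j i \<longleftrightarrow> (\<forall>z. vchain e j i z \<longrightarrow> (\<forall>S. (\<lambda>r. kdiff (z r) S) \<in> N) \<longrightarrow>
     (\<exists>w. vchain e j (Suc i) w \<and> (\<forall>S. (\<lambda>r. z r S - kdiff (w r) S) \<in> N)))"

definition image_space :: "nat \<Rightarrow> nat \<Rightarrow> (nat \<Rightarrow> nat \<Rightarrow> 'a::comm_ring_1) \<Rightarrow> (nat \<Rightarrow> 'a) set" where
  "image_space n m A = {u. \<exists>w. \<forall>r<n. u r = act m A w r}"

definition kernel_space :: "nat \<Rightarrow> nat \<Rightarrow> (nat \<Rightarrow> nat \<Rightarrow> 'a::comm_ring_1) \<Rightarrow> (nat \<Rightarrow> 'a) set" where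
  "kernel_space n m A = {u. \<forall>r<n. act m A u r = 0}"

lemma kchain_diff: "kchain jo i y \<Longrightarrow> kchain jo i z \<Longrightarrow> kchain jo i (\<lambda>S. y S - z S)"
  by (simp add: kchain_def homogeneous_diff)

lemma vchain_diff: "vchain e j i y \<Longrightarrow> vchain e j i z \<Longrightarrow> vchain e j i (\<lambda>r S. y r S - z r S)"
  by (simp add: vchain_def kchain_diff)

lemma vchain_kdiff: "vchain e j (Suc i) y \<Longrightarrow> vchain e j i (\<lambda>r. kdiff (y r))"
  by (simp add: vchain_def kchain_kdiff)

lemma kdiff_act: "kdiff (\<lambda>S. act m A (\<lambda>c. y c S) r) S = act m A (\<lambda>c. kdiff (y c) S) r"
  by (simp add: act_def kdiff_sum kdiff_mult)

lemma kdiff_irrelevant: "kdiff z S \<in> irrelevant_ideal"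
  unfolding kdiff_def
  by (intro ideal_sum ideal_mult_right ideal_mult_left) simp_all

lemma vchain_act:
  assumes A: "graded_matrix e e' A" and y: "vchain e' j i y"
  shows "vchain e j i (\<lambda>r S. act (length e') A (\<lambda>c. y c S) r)"
  unfolding vchain_def
proof (intro allI impI)
  fix r assume r: "r < length e"
  have "homogeneous_of_degree (j - e ! r - int i) (A r c * y c S)" if c: "c < length e'" for c S
  proof (rule homogeneous_mult)
    show "homogeneous_of_degree (e' ! c - e ! r) (A r c)" using A r c by (simp add: graded_matrix_def)
    show "homogeneous_of_degree (j - e' ! c - int i) (y c S)" using y c by (simp add: vchain_def kchain_def)
  qed simp
  then have "homogeneous_of_degree (j - e ! r - int i) (act (length e') A (\<lambda>c. y c S) r)" for S
    unfolding act_def by (intro homogeneous_sum) simp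
  moreover have "act (length e') A (\<lambda>c. y c S) r = 0" if "card S \<noteq> i" for S
    unfolding act_def using y that by (intro sum.neutral) (simp add: vchain_def kchain_def)
  ultimately show "kchain (Some (j - e ! r)) i (\<lambda>S. act (length e') A (\<lambda>c. y c S) r)"
    by (simp add: kchain_def)
qed

text \<open>A homogeneous chain with values in the image of a graded matrix has a homogeneous preimage,
  obtained from any preimage by passing to homogeneous components.\<close>

lemma vchain_lift:
  assumes A: "graded_matrix e e' A" and x: "vchain e j i x"
    and im: "\<And>S. (\<lambda>r. x r S) \<in> image_space (length e) (length e') A"
  shows "\<exists>y. vchain e' j i y \<and> (\<forall>r S. r < length e \<longrightarrow> x r S = act (length e') A (\<lambda>c. y c S) r)"
proof -
  have "\<forall>S. \<exists>w. \<forall>r<length e. x r S = act (length e') A w r"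
    using im by (simp add: image_space_def)
  from choice[OF this] obtain U where U: "\<forall>S. \<forall>r<length e. x r S = act (length e') A (U S) r" ..
  define y where "y c S = (if card S = i then hcomp (j - int i - e' ! c) (U S c) else 0)" for c S
  have "vchain e' j i y"
    unfolding vchain_def kchain_def
  proof (intro allI impI conjI)
    fix c j' S assume "Some (j - e' ! c) = Some j'"
    then have degree: "j' - int i = j - int i - e' ! c" by simp
    show "homogeneous_of_degree (j' - int i) (y c S)" unfolding degree by (simp add: y_def)
  qed (simp add: y_def)
  moreover have "x r S = act (length e') A (\<lambda>c. y c S) r" if r: "r < length e" for r S
  proof (cases "card S = i")
    case True
    have degree: "j - int i - e ! r = j - e ! r - int i" by simp
    have "homogeneous_of_degree (j - int i - e ! r) (x r S)"
      unfolding degree using x r by (simp add: vchain_def kchain_def)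
    then have "x r S = hcomp (j - int i - e ! r) (x r S)" by (simp add: hcomp_homogeneous)
    also have "\<dots> = hcomp (j - int i - e ! r) (act (length e') A (U S) r)" using U r by simp
    also have "\<dots> = act (length e') A (\<lambda>c. y c S) r"
      unfolding hcomp_act[OF A r] y_def using True by simp
    finally show ?thesis .
  next
    case False
    then show ?thesis using x r by (simp add: act_def y_def vchain_def kchain_def)
  qed
  ultimately show ?thesis by blast
qed

text \<open>A polynomial in the irrelevant ideal is a combination of the variables, and is the boundary of
  the chain of the coefficients.\<close>

lemma koszul_exact_bottom:
  fixes x :: "'v::finite set \<Rightarrow> ('v, 'k::field) mpoly"
  assumes x: "kchain (Some j) 0 x" and irr: "x {} \<in> irrelevant_ideal"
  shows "\<exists>z. kchain (Some j) (Suc 0) z \<and> (\<forall>S. x S = kdiff z S)"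
proof -
  obtain q where q: "x {} = (\<Sum>v\<in>UNIV. var v * q v)"
    using irr ideal_gen_vars_sum unfolding irrelevant_ideal_def by metis
  define z where "z S = (\<Sum>v\<in>UNIV. if S = {v} then hcomp (j - 1) (q v) else 0)" for S
  have z: "kchain (Some j) (Suc 0) z"
    unfolding kchain_def
  proof (intro allI impI conjI)
    fix S :: "'v set" assume "card S \<noteq> Suc 0"
    then show "z S = 0" unfolding z_def by (intro sum.neutral) auto
  next
    fix j' S assume "Some j = Some j'"
    then show "homogeneous_of_degree (j' - int (Suc 0)) (z S)"
      unfolding z_def by (intro homogeneous_sum) simp
  qed
  have "x S = kdiff z S" for S
  proof (cases "S = {}")
    case True
    have zv: "z {v} = hcomp (j - 1) (q v)" for v by (simp add: z_def)
    have "x {} = hcomp j (x {})" using x by (simp add: kchain_def hcomp_homogeneous)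
    also have "\<dots> = (\<Sum>v\<in>UNIV. var v * hcomp (j - 1) (q v))"
      unfolding q hcomp_sum by (intro sum.cong hcomp_mult[OF homogeneous_var]) simp_all
    also have "\<dots> = kdiff z {}" by (simp add: kdiff_def zv ksign_def)
    finally show ?thesis using True by simp
  next
    case False
    then have "card S \<noteq> 0" by simp
    then show ?thesis using x kchain_kdiff[OF z] by (simp add: kchain_def)
  qed
  then show ?thesis using z by blast
qed

lemma koszul_exact_irrelevant:
  assumes x: "kchain (Some j) i x" and dx: "\<And>S. kdiff x S = 0" and irr: "\<And>S. x S \<in> irrelevant_ideal"
  shows "\<exists>z. kchain (Some j) (Suc i) z \<and> (\<forall>S. x S = kdiff z S)"
proof (cases i)
  case 0
  then show ?thesis using koszul_exact_bottom[of j x] x irr by simp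
next
  case (Suc k)
  obtain z where "kchain (Some j) (Suc (Suc k)) z" "\<And>S. x S = kdiff z S"
    using koszul_exact[of "Some j" k x] x dx Suc by blast
  then show ?thesis using Suc by blast
qed

text \<open>Let \<open>F' \<rightarrow> F\<close> have image \<open>N\<close> and kernel \<open>N'\<close>. This is one half of the isomorphism
  \<open>H\<^sub>i\<^sub>+\<^sub>1(F/N) \<cong> H\<^sub>i(N) \<cong> H\<^sub>i(F'/N')\<close>, which holds because \<open>F\<close> has no homology in positive degrees.
  Given \<open>z\<close>, lift \<open>dz\<close> to \<open>y\<close>, write \<open>y = dw\<close> modulo \<open>N'\<close> and subtract the image of \<open>w\<close> from \<open>z\<close> to
  obtain a cycle in \<open>F\<close>.\<close>

lemma tor_vanishes_shift_up:
  assumes A: "graded_matrix e e' A"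
    and van: "tor_vanishes e' (kernel_space (length e) (length e') A) j i"
  shows "tor_vanishes e (image_space (length e) (length e') A) j (Suc i)"
  unfolding tor_vanishes_def
proof (intro allI impI)
  let ?n = "length e" and ?m = "length e'"
  fix z :: "nat \<Rightarrow> 'a set \<Rightarrow> ('a, 'b) mpoly"
  assume z: "vchain e j (Suc i) z" and dz: "\<forall>S. (\<lambda>r. kdiff (z r) S) \<in> image_space ?n ?m A"
  obtain y where y: "vchain e' j i y"
    and zy: "\<forall>r S. r < ?n \<longrightarrow> kdiff (z r) S = act ?m A (\<lambda>c. y c S) r"
    using vchain_lift[OF A vchain_kdiff[OF z]] dz by blast
  have "(\<lambda>c. kdiff (y c) S) \<in> kernel_space ?n ?m A" for S
    unfolding kernel_space_def
  proof (intro CollectI allI impI)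
    fix r assume r: "r < ?n"
    have "kdiff (z r) = (\<lambda>S. act ?m A (\<lambda>c. y c S) r)" using zy r by (simp add: fun_eq_iff)
    then have "act ?m A (\<lambda>c. kdiff (y c) S) r = kdiff (kdiff (z r)) S" by (simp add: kdiff_act)
    then show "act ?m A (\<lambda>c. kdiff (y c) S) r = 0" by simp
  qed
  then obtain w where w: "vchain e' j (Suc i) w"
    and yw: "\<forall>S. (\<lambda>c. y c S - kdiff (w c) S) \<in> kernel_space ?n ?m A"
    using van y unfolding tor_vanishes_def by blast
  define z' where "z' r S = z r S - act ?m A (\<lambda>c. w c S) r" for r S
  have z': "vchain e j (Suc i) z'"
    unfolding z'_def by (intro vchain_diff z vchain_act[OF A w])
  have "\<forall>r\<in>{..<?n}. \<exists>v. kchain (Some (j - e ! r)) (Suc (Suc i)) v \<and> (\<forall>S. z' r S = kdiff v S)"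
  proof
    fix r assume "r \<in> {..<?n}"
    then have r: "r < ?n" by simp
    have "kdiff (z' r) S = 0" for S
    proof -
      have "kdiff (z' r) S = kdiff (z r) S - act ?m A (\<lambda>c. kdiff (w c) S) r"
        unfolding z'_def by (simp add: kdiff_diff kdiff_act)
      also have "\<dots> = act ?m A (\<lambda>c. y c S - kdiff (w c) S) r"
        using zy r by (simp add: act_diff)
      also have "\<dots> = 0" using yw r by (simp add: kernel_space_def)
      finally show ?thesis .
    qed
    then show "\<exists>v. kchain (Some (j - e ! r)) (Suc (Suc i)) v \<and> (\<forall>S. z' r S = kdiff v S)"
      using koszul_exact[of "Some (j - e ! r)" i "z' r"] z' r unfolding vchain_def by blast
  qed
  from bchoice[OF this] obtain v where
    v: "\<forall>r\<in>{..<?n}. kchain (Some (j - e ! r)) (Suc (Suc i)) (v r) \<and> (\<forall>S. z' r S = kdiff (v r) S)" ..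
  have "(\<lambda>r. z r S - kdiff (v r) S) \<in> image_space ?n ?m A" for S
    unfolding image_space_def
  proof (intro CollectI exI allI impI)
    fix r assume "r < ?n"
    then have "kdiff (v r) S = z' r S" using v by simp
    then show "z r S - kdiff (v r) S = act ?m A (\<lambda>c. w c S) r" by (simp add: z'_def)
  qed
  moreover have "vchain e j (Suc (Suc i)) v" using v by (simp add: vchain_def)
  ultimately show "\<exists>v. vchain e j (Suc (Suc i)) v \<and>
    (\<forall>S. (\<lambda>r. z r S - kdiff (v r) S) \<in> image_space ?n ?m A)" by blast
qed

lemma act_irrelevant:
  assumes "\<And>c. c < m \<Longrightarrow> A r c \<in> irrelevant_ideal"
  shows "act m A u r \<in> irrelevant_ideal"
  unfolding act_def using assms by (intro ideal_sum ideal_mult_right) simp_all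

text \<open>The other half. For \<open>i = 0\<close> it depends on minimality: the image of \<open>y\<close> in \<open>F\<close> must be a boundary,
  which it is because the entries of \<open>A\<close> lie in the irrelevant ideal.\<close>

lemma tor_vanishes_shift_down:
  assumes A: "graded_matrix e e' A"
    and minimal: "\<And>r c. r < length e \<Longrightarrow> c < length e' \<Longrightarrow> A r c \<in> irrelevant_ideal"
    and van: "tor_vanishes e (image_space (length e) (length e') A) j (Suc i)"
  shows "tor_vanishes e' (kernel_space (length e) (length e') A) j i"
  unfolding tor_vanishes_def
proof (intro allI impI)
  let ?n = "length e" and ?m = "length e'"
  fix y :: "nat \<Rightarrow> 'a set \<Rightarrow> ('a, 'b) mpoly"
  assume y: "vchain e' j i y" and dy: "\<forall>S. (\<lambda>c. kdiff (y c) S) \<in> kernel_space ?n ?m A"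
  define x where "x r S = act ?m A (\<lambda>c. y c S) r" for r S
  have x: "vchain e j i x" unfolding x_def by (rule vchain_act[OF A y])
  have "\<forall>r\<in>{..<?n}. \<exists>z. kchain (Some (j - e ! r)) (Suc i) z \<and> (\<forall>S. x r S = kdiff z S)"
  proof
    fix r assume "r \<in> {..<?n}"
    then have r: "r < ?n" by simp
    show "\<exists>z. kchain (Some (j - e ! r)) (Suc i) z \<and> (\<forall>S. x r S = kdiff z S)"
    proof (rule koszul_exact_irrelevant)
      show "kchain (Some (j - e ! r)) i (x r)" using x r by (simp add: vchain_def)
      have "x r = (\<lambda>S. act ?m A (\<lambda>c. y c S) r)" by (simp add: fun_eq_iff x_def)
      then show "kdiff (x r) S = 0" for S
        using dy r by (simp add: kdiff_act kernel_space_def)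
      show "x r S \<in> irrelevant_ideal" for S
        unfolding x_def using minimal r by (intro act_irrelevant) simp
    qed
  qed
  from bchoice[OF this] obtain z where
    z: "\<forall>r\<in>{..<?n}. kchain (Some (j - e ! r)) (Suc i) (z r) \<and> (\<forall>S. x r S = kdiff (z r) S)" ..
  have zc: "vchain e j (Suc i) z" using z by (simp add: vchain_def)
  have "(\<lambda>r. kdiff (z r) S) \<in> image_space ?n ?m A" for S
    unfolding image_space_def
  proof (intro CollectI exI allI impI)
    fix r assume "r < ?n"
    then have "kdiff (z r) S = x r S" using z by simp
    then show "kdiff (z r) S = act ?m A (\<lambda>c. y c S) r" by (simp add: x_def)
  qed
  then obtain v where v: "vchain e j (Suc (Suc i)) v"
    and zv: "\<forall>S. (\<lambda>r. z r S - kdiff (v r) S) \<in> image_space ?n ?m A"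
    using van zc unfolding tor_vanishes_def by blast
  have "vchain e j (Suc i) (\<lambda>r S. z r S - kdiff (v r) S)"
    by (intro vchain_diff zc vchain_kdiff v)
  from vchain_lift[OF A this] zv obtain w where w: "vchain e' j (Suc i) w"
    and zvw: "\<forall>r S. r < ?n \<longrightarrow> z r S - kdiff (v r) S = act ?m A (\<lambda>c. w c S) r"
    by blast
  have "(\<lambda>c. y c S - kdiff (w c) S) \<in> kernel_space ?n ?m A" for S
    unfolding kernel_space_def
  proof (intro CollectI allI impI)
    fix r assume r: "r < ?n"
    have "(\<lambda>S. act ?m A (\<lambda>c. w c S) r) = (\<lambda>S. z r S - kdiff (v r) S)"
      using zvw r by (simp add: fun_eq_iff)
    then have "act ?m A (\<lambda>c. kdiff (w c) S) r = kdiff (\<lambda>S. z r S - kdiff (v r) S) S"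
      by (simp add: kdiff_act[symmetric])
    also have "\<dots> = x r S" using z r by (simp add: kdiff_diff)
    finally show "act ?m A (\<lambda>c. y c S - kdiff (w c) S) r = 0" by (simp add: act_diff x_def)
  qed
  then show "\<exists>w. vchain e' j (Suc i) w \<and> (\<forall>S. (\<lambda>c. y c S - kdiff (w c) S) \<in> kernel_space ?n ?m A)"
    using w by blast
qed

text \<open>If \<open>N\<close> is contained in the irrelevant ideal times \<open>F\<close>, then \<open>H\<^sub>0(F/N)\<close> is \<open>F\<close> modulo the
  irrelevant ideal, with a basis in the degrees \<open>e\<close>.\<close>

lemma tor_vanishes_bottom:
  assumes minimal: "\<And>r c. r < length e \<Longrightarrow> c < m \<Longrightarrow> A r c \<in> (irrelevant_ideal :: ('v::finite, 'k::field) mpoly set)"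
  shows "tor_vanishes e (image_space (length e) m A) j 0 \<longleftrightarrow> j \<notin> set e"
proof
  have zero_im: "(\<lambda>r. 0) \<in> image_space (length e) m A"
    unfolding image_space_def by (auto simp: act_def intro!: exI[of _ "\<lambda>_. 0"])
  {
    assume van: "tor_vanishes e (image_space (length e) m A) j 0"
    show "j \<notin> set e"
    proof
      assume "j \<in> set e"
      then obtain k where k: "k < length e" "e ! k = j" by (auto simp: in_set_conv_nth)
      define z where "z r S = (if r = k \<and> S = {} then 1 else 0 :: ('v, 'k) mpoly)" for r and S :: "'v set"
      have z: "vchain e j 0 z"
        using k(2) homogeneous_one by (auto simp: vchain_def kchain_def z_def)
      have "kdiff (z r) S = 0" for r S by (auto simp: kdiff_def z_def)
      then obtain w where "\<forall>S. (\<lambda>r. z r S - kdiff (w r) S) \<in> image_space (length e) m A"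
        using van z zero_im unfolding tor_vanishes_def by auto
      then obtain u where u: "z k {} - kdiff (w k) {} = act m A u k"
        using k(1) unfolding image_space_def by blast
      have "act m A u k + kdiff (w k) {} \<in> irrelevant_ideal"
        using minimal k(1) by (intro ideal_add act_irrelevant kdiff_irrelevant) simp_all
      moreover have "act m A u k + kdiff (w k) {} = 1"
        unfolding u[symmetric] by (simp add: z_def)
      ultimately show False by simp
    qed
  }
  {
    assume j: "j \<notin> set e"
    show "tor_vanishes e (image_space (length e) m A) j 0"
      unfolding tor_vanishes_def
    proof (intro allI impI)
      fix z :: "nat \<Rightarrow> 'v set \<Rightarrow> ('v, 'k) mpoly"
      assume z: "vchain e j 0 z"
      have "\<forall>r\<in>{..<length e}. \<exists>w. kchain (Some (j - e ! r)) (Suc 0) w \<and> (\<forall>S. z r S = kdiff w S)"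
      proof
        fix r assume "r \<in> {..<length e}"
        then have r: "r < length e" by simp
        then have "j - e ! r \<noteq> 0" using j by auto
        then have "z r {} \<in> irrelevant_ideal"
          using z r homogeneous_irrelevant[of "j - e ! r" "z r {}"] by (simp add: vchain_def kchain_def)
        then show "\<exists>w. kchain (Some (j - e ! r)) (Suc 0) w \<and> (\<forall>S. z r S = kdiff w S)"
          using z r by (intro koszul_exact_bottom) (simp_all add: vchain_def)
      qed
      from bchoice[OF this] obtain w where
        w: "\<forall>r\<in>{..<length e}. kchain (Some (j - e ! r)) (Suc 0) (w r) \<and> (\<forall>S. z r S = kdiff (w r) S)" ..
      have "(\<lambda>r. z r S - kdiff (w r) S) \<in> image_space (length e) m A" for S
        unfolding image_space_def
        by (intro CollectI exI[of _ "\<lambda>_. 0"]) (use w in \<open>simp add: act_def\<close>)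
      moreover have "vchain e j (Suc 0) w" using w by (simp add: vchain_def)
      ultimately show "\<exists>w. vchain e j (Suc 0) w \<and> (\<forall>S. (\<lambda>r. z r S - kdiff (w r) S) \<in> image_space (length e) m A)"
        by blast
    qed
  }
qed

text \<open>The representatives \<open>a\<close> induce an isomorphism from \<open>F\<^sub>0\<close> modulo the preimage of \<open>J\<close> to \<open>R/J\<close>, along
  which cycles and boundaries can be transported in both directions.\<close>

lemma koszul_vanishes_iff_tor_vanishes:
  fixes J :: "('v::finite, 'k::field) mpoly set"
  assumes J: "graded_ideal J"
    and a: "\<And>r. r < length e \<Longrightarrow> homogeneous_of_degree (e ! r) (a r)"
    and gen: "\<And>f. \<exists>u. f - (\<Sum>r<length e. a r * u r) \<in> J"
  shows "koszul_vanishes (Some j) i J \<longleftrightarrow> tor_vanishes e {u. (\<Sum>r<length e. a r * u r) \<in> J} j i"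
proof -
  have id: "is_ideal J" using J by (simp add: graded_ideal_def)
  define \<phi> where "\<phi> u = act (length e) (\<lambda>_. a) u 0" for u
  have A: "graded_matrix [0] e (\<lambda>_. a)" using a by (simp add: graded_matrix_def)
  have N: "{u. (\<Sum>r<length e. a r * u r) \<in> J} = {u. \<phi> u \<in> J}" by (simp add: \<phi>_def act_def)
  have gen: "\<forall>f. \<exists>u. f - \<phi> u \<in> J" using gen by (simp add: \<phi>_def act_def)
  have \<phi>_diff: "\<phi> (\<lambda>c. u c - v c) = \<phi> u - \<phi> v" for u v by (simp add: \<phi>_def act_diff)
  have kdiff_\<phi>: "kdiff (\<lambda>S. \<phi> (\<lambda>c. y c S)) S = \<phi> (\<lambda>c. kdiff (y c) S)" for y S
    by (simp add: \<phi>_def kdiff_act)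
  have \<phi>_chain: "kchain (Some j) i (\<lambda>S. \<phi> (\<lambda>c. y c S))" if "vchain e j i y" for y i
    using vchain_act[OF A that] by (simp add: vchain_def \<phi>_def)
  have lift: "\<exists>y. vchain e j i y \<and> (\<forall>S. x S - \<phi> (\<lambda>c. y c S) \<in> J)" if x: "kchain (Some j) i x" for x i
  proof -
    have "\<forall>S. \<exists>u. x S - \<phi> u \<in> J" using gen by simp
    from choice[OF this] obtain U where U: "\<forall>S. x S - \<phi> (U S) \<in> J" ..
    define y where "y c S = (if card S = i then hcomp (j - int i - e ! c) (U S c) else 0)" for c S
    have "vchain e j i y"
      unfolding vchain_def kchain_def
    proof (intro allI impI conjI)
      fix c j' S assume "Some (j - e ! c) = Some j'"
    then have degree: "j' - int i = j - int i - e ! c" by simp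
    show "homogeneous_of_degree (j' - int i) (y c S)" unfolding degree by (simp add: y_def)
    qed (simp add: y_def)
    moreover have "x S - \<phi> (\<lambda>c. y c S) \<in> J" for S
    proof (cases "card S = i")
      case True
      have "hcomp (j - int i) (\<phi> (U S)) = \<phi> (\<lambda>c. y c S)"
        using hcomp_act[OF A, of 0 "j - int i" "U S"] True by (simp add: \<phi>_def y_def)
      moreover have "hcomp (j - int i) (x S) = x S" using x by (simp add: kchain_def hcomp_homogeneous)
      ultimately have "x S - \<phi> (\<lambda>c. y c S) = hcomp (j - int i) (x S - \<phi> (U S))"
        by (simp add: hcomp_diff)
      then show ?thesis using U J by (simp add: graded_ideal_def)
    next
      case False
      then show ?thesis using x by (simp add: \<phi>_def act_def y_def kchain_def ideal_zero[OF id])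
    qed
    ultimately show ?thesis by blast
  qed
  show ?thesis
    unfolding N
  proof
    assume van: "koszul_vanishes (Some j) i J"
    show "tor_vanishes e {u. \<phi> u \<in> J} j i"
      unfolding tor_vanishes_def mem_Collect_eq
    proof (intro allI impI)
      fix z :: "nat \<Rightarrow> 'v set \<Rightarrow> ('v, 'k) mpoly"
      assume z: "vchain e j i z" and dz: "\<forall>S. \<phi> (\<lambda>r. kdiff (z r) S) \<in> J"
      then obtain w where w: "kchain (Some j) (Suc i) w" "\<forall>S. \<phi> (\<lambda>c. z c S) - kdiff w S \<in> J"
        using van \<phi>_chain[OF z] unfolding koszul_vanishes_def kdiff_\<phi>[symmetric] by blast
      obtain y where y: "vchain e j (Suc i) y" "\<forall>S. w S - \<phi> (\<lambda>c. y c S) \<in> J"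
        using lift[OF w(1)] by blast
      have "\<phi> (\<lambda>r. z r S - kdiff (y r) S) \<in> J" for S
      proof -
        have "kdiff (\<lambda>S. w S - \<phi> (\<lambda>c. y c S)) S \<in> J" using y(2) by (intro kdiff_mem[OF id]) simp
        then have "kdiff w S - \<phi> (\<lambda>c. kdiff (y c) S) \<in> J" by (simp add: kdiff_diff kdiff_\<phi>)
        from ideal_add[OF id w(2)[rule_format, of S] this] show ?thesis by (simp add: \<phi>_diff)
      qed
      then show "\<exists>w. vchain e j (Suc i) w \<and> (\<forall>S. \<phi> (\<lambda>r. z r S - kdiff (w r) S) \<in> J)"
        using y(1) by blast
    qed
  next
    assume van: "tor_vanishes e {u. \<phi> u \<in> J} j i"
    show "koszul_vanishes (Some j) i J"
      unfolding koszul_vanishes_def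
    proof (intro allI impI)
      fix z :: "'v set \<Rightarrow> ('v, 'k) mpoly"
      assume z: "kchain (Some j) i z" and dz: "\<forall>S. kdiff z S \<in> J"
      obtain y where y: "vchain e j i y" "\<forall>S. z S - \<phi> (\<lambda>c. y c S) \<in> J"
        using lift[OF z] by blast
      have "\<phi> (\<lambda>c. kdiff (y c) S) \<in> J" for S
      proof -
        have "kdiff (\<lambda>S. z S - \<phi> (\<lambda>c. y c S)) S \<in> J" using y(2) by (intro kdiff_mem[OF id]) simp
        then have "kdiff z S - \<phi> (\<lambda>c. kdiff (y c) S) \<in> J" by (simp add: kdiff_diff kdiff_\<phi>)
        from ideal_diff[OF id dz[rule_format, of S] this] show ?thesis by simp
      qed
      then obtain w where w: "vchain e j (Suc i) w" "\<forall>S. \<phi> (\<lambda>r. y r S - kdiff (w r) S) \<in> J"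
        using van y(1) unfolding tor_vanishes_def mem_Collect_eq by blast
      have "z S - kdiff (\<lambda>S. \<phi> (\<lambda>c. w c S)) S \<in> J" for S
        using ideal_add[OF id y(2)[rule_format, of S] w(2)[rule_format, of S]]
        by (simp add: kdiff_\<phi> \<phi>_diff)
      then show "\<exists>w. kchain (Some j) (Suc i) w \<and> (\<forall>S. z S - kdiff w S \<in> J)"
        using \<phi>_chain[OF w(1)] by blast
    qed
  qed
qed

text \<open>Iterating the shift identifies \<open>H\<^sub>i(R/J)\<close> with \<open>H\<^sub>0\<close> of the \<open>i\<close>-th syzygy module.\<close>

theorem min_resolution_degrees:
  assumes J: "graded_ideal J" and res: "min_resolution J ds a A"
  shows "j \<in> set (ds i) \<longleftrightarrow> \<not> koszul_vanishes (Some j) i J"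
proof -
  define N where "N i = image_space (length (ds i)) (length (ds (Suc i))) (A i)" for i
  have graded: "graded_matrix (ds i) (ds (Suc i)) (A i)" for i
    using res by (simp add: min_resolution_def)
  have minimal: "A i r c \<in> irrelevant_ideal" if "r < length (ds i)" "c < length (ds (Suc i))" for i r c
    using res that by (simp add: min_resolution_def)
  have ker: "kernel_space (length (ds i)) (length (ds (Suc i))) (A i) = N (Suc i)" for i
    using res by (simp add: min_resolution_def kernel_space_def N_def image_space_def)
  have shift: "tor_vanishes (ds k) (N k) j (Suc i) \<longleftrightarrow> tor_vanishes (ds (Suc k)) (N (Suc k)) j i" for k i
    using tor_vanishes_shift_up[OF graded[of k], of j i] tor_vanishes_shift_down[OF graded[of k] minimal, of j i]
    unfolding ker N_def[symmetric] by blast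
  have "tor_vanishes (ds k) (N k) j i \<longleftrightarrow> tor_vanishes (ds (k + i)) (N (k + i)) j 0" for k
    by (induction i arbitrary: k) (simp_all add: shift)
  from this[of 0] have "tor_vanishes (ds 0) (N 0) j i \<longleftrightarrow> j \<notin> set (ds i)"
    using tor_vanishes_bottom[of "ds i" "length (ds (Suc i))" "A i" j] minimal[of _ i] by (simp add: N_def)
  moreover have "koszul_vanishes (Some j) i J \<longleftrightarrow> tor_vanishes (ds 0) {u. (\<Sum>r<length (ds 0). a r * u r) \<in> J} j i"
    using res by (intro koszul_vanishes_iff_tor_vanishes[OF J]) (simp_all add: min_resolution_def)
  moreover have "{u. (\<Sum>r<length (ds 0). a r * u r) \<in> J} = N 0"
    using res by (simp add: min_resolution_def N_def image_space_def)
  ultimately show ?thesis by simp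
qed

theorem graded_betti_nonzero_iff:
  assumes J: "graded_ideal J" "J \<subseteq> irrelevant_ideal"
  shows "graded_betti J i j \<noteq> 0 \<longleftrightarrow> \<not> koszul_vanishes (Some j) i J"
proof -
  define ds where "ds = (SOME ds. \<exists>a D. minimal_graded_free_resolution J ds a D)"
  have "\<exists>a D. minimal_graded_free_resolution J ds a D"
    using minimal_graded_free_resolution_exists[OF J] unfolding ds_def by (rule someI_ex)
  then obtain a D where "minimal_graded_free_resolution J ds a D" by (elim exE)
  then have "min_resolution J ds (\<lambda>r. a $ r) (\<lambda>i r c. D i $$ (r, c))"
    by (simp add: min_resolution_iff)
  from min_resolution_degrees[OF J(1) this, of j i] show ?thesis
    by (simp add: graded_betti_def ds_def[symmetric] count_list_0_iff)
qed

text \<open>A nonzero Betti number of \<open>R/(I : x)\<close> in position \<open>(i, j)\<close> comes with one of \<open>R/I\<close> in position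
  \<open>(i, j)\<close> or \<open>(i, j + 1)\<close>.\<close>

theorem reg_quot_colon_var:
  assumes I: "monomial_ideal I" and proper: "colon I (var x) \<noteq> UNIV"
  shows "reg_quot (colon I (var x)) \<le> reg_quot I"
proof -
  have mon: "monomial_ideal (colon I (var x))"
    unfolding var_def by (rule monomial_ideal_colon[OF I])
  have id: "is_ideal I" using I by (simp add: monomial_ideal_def)
  have "I \<subseteq> colon I (var x)" using ideal_mult_left[OF id] by (auto simp: mem_colon)
  then have "I \<noteq> UNIV" using proper by auto
  note betti_I = graded_betti_nonzero_iff[OF monomial_graded[OF I] monomial_ideal_subset_irrelevant[OF I this]]
  note betti_colon = graded_betti_nonzero_iff[OF monomial_graded[OF mon] monomial_ideal_subset_irrelevant[OF mon proper]]
  show ?thesis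
    unfolding reg_quot_def betti_I betti_colon
  proof (rule SUP_least)
    let ?A = "{(i, j). \<not> koszul_vanishes (Some j) i I}"
    let ?d = "\<lambda>(i, j). ereal (real_of_int (j - int i))"
    fix p assume "p \<in> {(i, j). \<not> koszul_vanishes (Some j) i (colon I (var x))}"
    then obtain i j where p: "p = (i, j)" "\<not> koszul_vanishes (Some j) i (colon I (var x))" by auto
    then consider "(i, j) \<in> ?A" | "(i, j + 1) \<in> ?A"
      using koszul_vanishes_colon[OF I, of "Some j" i x] by auto
    then show "?d p \<le> (SUP p\<in>?A. ?d p)"
    proof cases
      case 1
      then show ?thesis unfolding p(1) by (rule SUP_upper)
    next
      case 2
      have "?d p \<le> ?d (i, j + 1)" by (simp add: p(1))
      also have "\<dots> \<le> (SUP p\<in>?A. ?d p)" using 2 by (rule SUP_upper)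
      finally show ?thesis .
    qed
  qed
qed

theorem colon_monomial_depth_reg:
  fixes I :: "('v::finite, 'k::field) mpoly set"
  assumes "monomial_ideal I" "colon I (xm m) \<noteq> UNIV"
  shows "depth_quot I \<le> depth_quot (colon I (xm m)) \<and> reg_quot (colon I (xm m)) \<le> reg_quot I"
  using assms
proof (induction "mon_degree m" arbitrary: I m)
  case 0
  then have "m = 0" by (intro poly_mapping_eqI) (simp add: mon_degree_def)
  then have "colon I (xm m) = I" by (simp add: colon_def)
  then show ?case by simp
next
  case (Suc d)
  then have "m \<noteq> 0" by auto
  then obtain x where "lookup m x \<noteq> 0" by (metis lookup_zero poly_mapping_eqI)
  then obtain m' where m: "m = single x 1 + m'"
    using poly_mapping_add_single_iff[of m x] by blast
  let ?I' = "colon I (var x)"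
  have colon: "colon I (xm m) = colon ?I' (xm m')"
    unfolding m xm_add by (simp add: colon_def var_def mult.assoc)
  have mon: "monomial_ideal ?I'"
    unfolding var_def by (rule monomial_ideal_colon[OF Suc.prems(1)])
  have "?I' \<noteq> UNIV" using Suc.prems(2) unfolding colon by (auto simp: colon_def)
  note step = depth_quot_colon_var[OF Suc.prems(1) this] reg_quot_colon_var[OF Suc.prems(1) this]
  have "d = mon_degree m'" using Suc.hyps(2) by (simp add: m mon_degree_add)
  then have "depth_quot ?I' \<le> depth_quot (colon ?I' (xm m')) \<and> reg_quot (colon ?I' (xm m')) \<le> reg_quot ?I'"
    using Suc.hyps(1)[OF _ mon] Suc.prems(2) unfolding colon by simp
  then show ?case unfolding colon using step by (meson order_trans)
qed

section \<open>Powers of monomial ideals\<close>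

text \<open>The products of \<open>k\<close> elements of \<open>M\<close>, written additively as exponent vectors.\<close>

primrec mon_power :: "('v \<Rightarrow>\<^sub>0 nat) set \<Rightarrow> nat \<Rightarrow> ('v \<Rightarrow>\<^sub>0 nat) set" where
  "mon_power M 0 = {0}"
| "mon_power M (Suc k) = {a + b | a b. a \<in> M \<and> b \<in> mon_power M k}"

lemma ideal_power_monomials:
  "ideal_power (ideal_gen (xm ` M)) k = (ideal_gen (xm ` mon_power M k) :: ('v, 'k::field) mpoly set)"
proof (induction k)
  case 0
  have "1 \<in> (ideal_gen (xm ` {0}) :: ('v, 'k) mpoly set)"
    using ideal_gen_base[of "1 :: ('v, 'k) mpoly" "xm ` {0}"] by simp
  then have "ideal_gen (xm ` {0}) = (UNIV :: ('v, 'k) mpoly set)"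
    using ideal_UNIV_iff[OF is_ideal_ideal_gen] by blast
  then show ?case by simp
next
  case (Suc k)
  let ?I = "ideal_gen (xm ` M) :: ('v, 'k) mpoly set"
  let ?Ik = "ideal_gen (xm ` mon_power M k) :: ('v, 'k) mpoly set"
  have "ideal_gen {f * g | f g. f \<in> ?I \<and> g \<in> ?Ik} = ideal_gen (xm ` mon_power M (Suc k))"
  proof
    show "ideal_gen {f * g | f g. f \<in> ?I \<and> g \<in> ?Ik} \<subseteq> ideal_gen (xm ` mon_power M (Suc k))"
    proof (rule ideal_gen_minimal, rule subsetI)
      fix h assume "h \<in> {f * g | f g. f \<in> ?I \<and> g \<in> ?Ik}"
      then obtain f g where h: "h = f * g" and f: "f \<in> ?I" and g: "g \<in> ?Ik" by blast
      show "h \<in> ideal_gen (xm ` mon_power M (Suc k))"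
        unfolding mem_ideal_gen_monomials
      proof
        fix m assume "m \<in> keys h"
        then obtain p q where pq: "m = p + q" "p \<in> keys f" "q \<in> keys g"
          using keys_mult[of f g] h by auto
        from f pq(2) obtain a b where a: "a \<in> M" "p = a + b" unfolding mem_ideal_gen_monomials by blast
        from g pq(3) obtain c d where c: "c \<in> mon_power M k" "q = c + d" unfolding mem_ideal_gen_monomials by blast
        have "m = (a + c) + (b + d)" using pq(1) a(2) c(2) by (simp add: ac_simps)
        moreover have "a + c \<in> mon_power M (Suc k)" using a(1) c(1) by auto
        ultimately show "\<exists>a\<in>mon_power M (Suc k). \<exists>b. m = a + b" by blast
      qed
    qed simp
    show "ideal_gen (xm ` mon_power M (Suc k)) \<subseteq> ideal_gen {f * g | f g. f \<in> ?I \<and> g \<in> ?Ik}"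
    proof (rule ideal_gen_minimal, rule subsetI)
      fix h :: "('v, 'k) mpoly" assume "h \<in> xm ` mon_power M (Suc k)"
      then obtain a b where "h = xm a * xm b" "a \<in> M" "b \<in> mon_power M k" by (auto simp: xm_add)
      then show "h \<in> ideal_gen {f * g | f g. f \<in> ?I \<and> g \<in> ?Ik}"
        by (intro ideal_gen_base CollectI exI[of _ "xm a"] exI[of _ "xm b"]) (auto intro: ideal_gen_base)
    qed simp
  qed
  then show ?case using Suc.IH by simp
qed

lemma xm_mem_ideal_gen: "xm m \<in> (ideal_gen (xm ` M) :: ('v, 'k::field) mpoly set) \<longleftrightarrow> (\<exists>a\<in>M. \<exists>b. m = a + b)"
  by (simp add: mem_ideal_gen_monomials)

lemma xm_mem_colon: "xm m \<in> colon I (xm g) \<longleftrightarrow> xm (g + m) \<in> I"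
  by (simp add: mem_colon mult_single)

text \<open>The first assumption expresses \<open>I\<^bsup>k+1\<^esup> : x\<^sup>g = I\<^sup>k\<close> on monomials, the second that \<open>I\<^sup>k\<close> is a
  proper ideal.\<close>

lemma depth_reg_of_colon_powers:
  fixes M :: "('v::finite \<Rightarrow>\<^sub>0 nat) set"
  defines "I \<equiv> ideal_gen (xm ` M) :: ('v, 'k::field) mpoly set"
  assumes colon: "\<And>m. (\<exists>a\<in>mon_power M (Suc k). \<exists>b. g + m = a + b) \<longleftrightarrow> (\<exists>a\<in>mon_power M k. \<exists>b. m = a + b)"
    and proper: "0 \<notin> mon_power M k"
  shows "depth_quot (ideal_power I (Suc k)) \<le> depth_quot (ideal_power I k)"
    and "reg_quot (ideal_power I k) \<le> reg_quot (ideal_power I (Suc k))"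
proof -
  have pow: "ideal_power I j = ideal_gen (xm ` mon_power M j)" for j
    by (simp only: I_def ideal_power_monomials)
  have eq: "colon (ideal_power I (Suc k)) (xm g) = ideal_power I k"
    unfolding pow by (intro monomial_ideal_eqI monomial_ideal_colon monomial_ideal_ideal_gen)
      (simp only: xm_mem_colon xm_mem_ideal_gen colon)
  have "a + b \<noteq> 0" if "a \<in> mon_power M k" for a b
  proof
    assume "a + b = 0"
    then have "lookup a v + lookup b v = 0" for v
      by (metis lookup_add lookup_zero)
    then have "a = 0" by (intro poly_mapping_eqI) auto
    then show False using that proper by simp
  qed
  then have "xm 0 \<notin> ideal_power I k"
    unfolding pow xm_mem_ideal_gen by (metis (no_types))
  then have "ideal_power I k \<noteq> UNIV" by blast
  moreover have mon: "monomial_ideal (ideal_power I (Suc k))"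
    unfolding pow by (rule monomial_ideal_ideal_gen)
  ultimately have "depth_quot (ideal_power I (Suc k)) \<le> depth_quot (ideal_power I k) \<and>
    reg_quot (ideal_power I k) \<le> reg_quot (ideal_power I (Suc k))"
    by (intro colon_monomial_depth_reg[OF mon, of g, unfolded eq])
  then show "depth_quot (ideal_power I (Suc k)) \<le> depth_quot (ideal_power I k)"
    and "reg_quot (ideal_power I k) \<le> reg_quot (ideal_power I (Suc k))"
    by blast+
qed

section \<open>Powers of ideals of covers\<close>

definition bipartition :: "'v set set \<Rightarrow> 'v set \<Rightarrow> 'v set \<Rightarrow> bool" where
  "bipartition E A B \<longleftrightarrow> A \<union> B = UNIV \<and> A \<inter> B = {} \<and> (\<forall>e\<in>E. \<exists>a\<in>A. \<exists>b\<in>B. e = {a, b})"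

lemma bipartition_edge:
  assumes "bipartition E A B" "e \<in> E"
  shows "\<exists>a b. a \<in> A \<and> b \<in> B \<and> a \<notin> B \<and> b \<notin> A \<and> e = {a, b}"
proof -
  have "A \<inter> B = {}" "\<exists>a\<in>A. \<exists>b\<in>B. e = {a, b}"
    using assms by (simp_all add: bipartition_def)
  then show ?thesis by (meson disjoint_iff)
qed

lemma minimal_vertex_cover_within:
  fixes C :: "'v::finite set"
  assumes "vertex_cover E C"
  shows "\<exists>C'\<subseteq>C. minimal_vertex_cover E C'"
  using finite[of C] assms
proof (induction C rule: finite_psubset_induct)
  case (psubset C)
  show ?case
  proof (cases "minimal_vertex_cover E C")
    case False
    then obtain C' where C': "C' \<subset> C" "vertex_cover E C'"
      using psubset.prems unfolding minimal_vertex_cover_def by blast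
    from psubset.IH[OF this] obtain D where "D \<subseteq> C'" "minimal_vertex_cover E D" by (elim exE conjE)
    then show ?thesis using C'(1) by (intro exI[of _ D]) auto
  qed blast
qed

definition set_mon :: "'v::finite set \<Rightarrow> ('v \<Rightarrow>\<^sub>0 nat)" where
  "set_mon C = (\<Sum>v\<in>C. single v 1)"

lemma lookup_set_mon: "lookup (set_mon C) v = (if v \<in> C then 1 else 0)"
  by (simp add: set_mon_def lookup_sum lookup_single when_def)

lemma cover_ideal_monomials:
  "cover_ideal E = (ideal_gen (xm ` (set_mon ` {C. minimal_vertex_cover E C})) :: ('v::finite, 'k::field) mpoly set)"
proof -
  have "(\<Prod>v\<in>C. var v :: ('v, 'k) mpoly) = xm (set_mon C)" for C
    unfolding set_mon_def by (induction C rule: infinite_finite_induct) (simp_all add: var_def mult_single)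
  then have "{(\<Prod>v\<in>C. var v :: ('v, 'k) mpoly) | C. minimal_vertex_cover E C} =
    xm ` (set_mon ` {C. minimal_vertex_cover E C})" by auto
  then show ?thesis by (simp add: cover_ideal_def)
qed

definition edge_weight :: "'v set \<Rightarrow> ('v \<Rightarrow>\<^sub>0 nat) \<Rightarrow> nat" where
  "edge_weight e m = (\<Sum>v\<in>e. lookup m v)"

lemma edge_weight_add: "edge_weight e (m + m') = edge_weight e m + edge_weight e m'"
  by (simp add: edge_weight_def lookup_add sum.distrib)

text \<open>This says that the ordinary and the symbolic powers of the ideal of covers agree. Given a monomial
  \<open>m\<close> of degree at least \<open>k + 1\<close> on every edge, the vertices of \<open>A\<close> of exponent greater than \<open>k\<close>
  together with the vertices of \<open>B\<close> of positive exponent form a cover. Let \<open>C'\<close> be a minimal cover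
  inside it. Removing one copy of \<open>C'\<close> from \<open>m\<close> leaves degree at least \<open>k\<close> on every edge \<open>{a, b}\<close>: if \<open>a\<close> is
  in \<open>C'\<close>, then \<open>a\<close> alone still contributes \<open>k\<close>, and otherwise the degree drops by at most one.\<close>

lemma cover_power_iff:
  fixes E :: "'v::finite set set"
  assumes E: "bipartition E A B"
  shows "(\<exists>a\<in>mon_power (set_mon ` {C. minimal_vertex_cover E C}) k. \<exists>b. m = a + b) \<longleftrightarrow>
    (\<forall>e\<in>E. k \<le> edge_weight e m)"
proof (induction k arbitrary: m)
  case 0
  show ?case by simp
next
  case (Suc k)
  let ?M = "set_mon ` {C. minimal_vertex_cover E C}"
  show ?case
  proof
    assume "\<exists>a\<in>mon_power ?M (Suc k). \<exists>b. m = a + b"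
    then obtain C c b where C: "minimal_vertex_cover E C" and c: "c \<in> mon_power ?M k"
      and m: "m = (set_mon C + c) + b" by auto
    have "\<forall>e\<in>E. k \<le> edge_weight e (c + b)"
      unfolding Suc.IH[symmetric] using c by blast
    moreover have "1 \<le> edge_weight e (set_mon C)" if "e \<in> E" for e
    proof -
      have "e \<inter> C \<noteq> {}" using C that by (simp add: minimal_vertex_cover_def vertex_cover_def)
      then obtain v where "v \<in> e" "v \<in> C" by blast
      then have "lookup (set_mon C) v \<le> edge_weight e (set_mon C)"
        unfolding edge_weight_def by (intro member_le_sum) auto
      then show ?thesis using \<open>v \<in> C\<close> by (simp add: lookup_set_mon)
    qed
    ultimately show "\<forall>e\<in>E. Suc k \<le> edge_weight e m"
      unfolding m add.assoc edge_weight_add[of _ "set_mon C"]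
      by (metis add_mono plus_1_eq_Suc)
  next
    assume weight: "\<forall>e\<in>E. Suc k \<le> edge_weight e m"
    define C where "C = {a \<in> A. k < lookup m a} \<union> {b \<in> B. 0 < lookup m b}"
    have "vertex_cover E C"
      unfolding vertex_cover_def
    proof
      fix e assume e: "e \<in> E"
      from bipartition_edge[OF E e] obtain a b
        where ab: "a \<in> A" "b \<in> B" "a \<notin> B" "b \<notin> A" "e = {a, b}" by (elim exE conjE)
      have "a \<noteq> b" using ab by blast
      have "Suc k \<le> lookup m a + lookup m b"
        using weight e ab \<open>a \<noteq> b\<close> by (auto simp: edge_weight_def)
      then have "a \<in> C \<or> b \<in> C" using ab by (auto simp: C_def)
      then show "e \<inter> C \<noteq> {}" using ab by auto
    qed
    from minimal_vertex_cover_within[OF this]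
    obtain C' where C': "C' \<subseteq> C" "minimal_vertex_cover E C'" by (elim exE conjE)
    have "\<forall>v. lookup (set_mon C') v \<le> lookup m v"
      using C'(1) by (auto simp: lookup_set_mon C_def Suc_le_eq)
    then obtain m' where m': "m = set_mon C' + m'"
      using poly_mapping_le_iff_add[of m "set_mon C'"] by blast
    have "k \<le> edge_weight e m'" if e: "e \<in> E" for e
    proof -
      from bipartition_edge[OF E e] obtain a b
        where ab: "a \<in> A" "b \<in> B" "a \<notin> B" "b \<notin> A" "e = {a, b}" by (elim exE conjE)
      have "a \<noteq> b" using ab by blast
      have "Suc k \<le> lookup m a + lookup m b"
        using weight e ab \<open>a \<noteq> b\<close> by (auto simp: edge_weight_def)
      moreover have "a \<in> C' \<Longrightarrow> k < lookup m a"
        using C'(1) ab by (auto simp: C_def)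
      ultimately have "k \<le> lookup m' a + lookup m' b"
        by (auto simp: m' lookup_add lookup_set_mon split: if_splits)
      then show ?thesis using ab \<open>a \<noteq> b\<close> by (simp add: edge_weight_def)
    qed
    then have "\<exists>c\<in>mon_power ?M k. \<exists>d. m' = c + d" unfolding Suc.IH by simp
    then obtain c d where cd: "c \<in> mon_power ?M k" "m' = c + d" by (elim bexE exE)
    have "set_mon C' + c \<in> mon_power ?M (Suc k)" using cd(1) C'(2) by auto
    moreover have "m = (set_mon C' + c) + d" by (simp add: m' cd(2) add.assoc)
    ultimately show "\<exists>a\<in>mon_power ?M (Suc k). \<exists>b. m = a + b" by blast
  qed
qed

text \<open>Without edges the only minimal cover is empty, so all powers are the unit ideal and there is
  nothing to compare.\<close>

lemma cover_ideal_depth_reg: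
  fixes E :: "'v::finite set set"
  assumes E: "bipartition E A B" and k: "1 \<le> k"
  defines "I \<equiv> cover_ideal E :: ('v, 'k::field) mpoly set"
  shows "depth_quot (ideal_power I (Suc k)) \<le> depth_quot (ideal_power I k) \<and>
    reg_quot (ideal_power I k) \<le> reg_quot (ideal_power I (Suc k))"
proof (cases "E = {}")
  case True
  let ?M = "set_mon ` {C. minimal_vertex_cover E C}"
  have "ideal_power I j = UNIV" for j
  proof -
    have "xm 0 \<in> (ideal_gen (xm ` mon_power ?M j) :: ('v, 'k) mpoly set)"
      unfolding xm_mem_ideal_gen cover_power_iff[OF E] using True by simp
    then show ?thesis
      unfolding I_def cover_ideal_monomials ideal_power_monomials
      using ideal_UNIV_iff[OF is_ideal_ideal_gen] by (metis single_one)
  qed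
  then show ?thesis by (metis order_refl)
next
  case False
  let ?M = "set_mon ` {C. minimal_vertex_cover E C}"
  have "edge_weight e (set_mon A) = 1" if "e \<in> E" for e
  proof -
    from bipartition_edge[OF E that] obtain a b
      where ab: "a \<in> A" "b \<in> B" "a \<notin> B" "b \<notin> A" "e = {a, b}" by (elim exE conjE)
    then have "a \<noteq> b" by blast
    then show ?thesis using ab by (simp add: edge_weight_def lookup_set_mon)
  qed
  then have "(\<exists>a\<in>mon_power ?M (Suc k). \<exists>b. set_mon A + m = a + b) \<longleftrightarrow> (\<exists>a\<in>mon_power ?M k. \<exists>b. m = a + b)" for m
    unfolding cover_power_iff[OF E] edge_weight_add by simp
  moreover have "0 \<notin> mon_power ?M k"
  proof
    assume "0 \<in> mon_power ?M k"
    then have "\<exists>a\<in>mon_power ?M k. \<exists>b. 0 = a + b" by (intro bexI[of _ 0] exI[of _ 0]) simp_all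
    then show False unfolding cover_power_iff[OF E] using False k by (auto simp: edge_weight_def)
  qed
  ultimately show ?thesis
    using depth_reg_of_colon_powers[of ?M k "set_mon A", where 'k = 'k]
    unfolding I_def cover_ideal_monomials by blast
qed

section \<open>Powers of edge ideals of unmixed graphs\<close>

definition edge_mons :: "'v set set \<Rightarrow> ('v \<Rightarrow>\<^sub>0 nat) set" where
  "edge_mons E = {single v 1 + single w 1 | v w. {v, w} \<in> E}"

lemma edge_ideal_monomials: "edge_ideal E = (ideal_gen (xm ` edge_mons E) :: ('v, 'k::field) mpoly set)"
proof -
  have "{var v * var w | v w. {v, w} \<in> E} = (xm ` edge_mons E :: ('v, 'k) mpoly set)"
    by (auto simp: edge_mons_def var_def mult_single image_iff)
  then show ?thesis by (simp add: edge_ideal_def)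
qed

text \<open>If \<open>x\<close> divides a product of \<open>k\<close> edges, one of the edges contains \<open>x\<close> and can be split off.\<close>

lemma edge_power_factor:
  assumes "a \<in> mon_power (edge_mons E) k" "lookup a x \<noteq> 0"
  shows "\<exists>w a'. {x, w} \<in> E \<and> k = Suc (k - 1) \<and> a' \<in> mon_power (edge_mons E) (k - 1) \<and>
    a = single x 1 + (single w 1 + a')"
  using assms
proof (induction k arbitrary: a)
  case (Suc k)
  then obtain p q a1 where pq: "{p, q} \<in> E" and a1: "a1 \<in> mon_power (edge_mons E) k"
    and a: "a = single p 1 + single q 1 + a1"
    by (auto simp: edge_mons_def)
  consider "x = p" | "x = q" | "lookup a1 x \<noteq> 0"
    using Suc.prems(2) by (auto simp: a lookup_add lookup_single when_def split: if_splits)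
  then show ?case
  proof cases
    case 1
    then show ?thesis using pq a1 by (intro exI[of _ q] exI[of _ a1]) (simp add: a add.assoc)
  next
    case 2
    then show ?thesis using pq a1
      by (intro exI[of _ p] exI[of _ a1]) (simp add: a insert_commute ac_simps)
  next
    case 3
    from Suc.IH[OF a1 3] obtain w a2 where w: "{x, w} \<in> E" "k = Suc (k - 1)"
      "a2 \<in> mon_power (edge_mons E) (k - 1)" "a1 = single x 1 + (single w 1 + a2)"
      by blast
    have "single p 1 + single q 1 + a2 \<in> mon_power (edge_mons E) (Suc (k - 1))"
      using pq w(3) by (auto simp: edge_mons_def)
    then show ?thesis using w
      by (intro exI[of _ w] exI[of _ "single p 1 + single q 1 + a2"])
        (simp add: a ac_simps)
  qed
qed simp

lemma single_factor:
  "lookup m v \<noteq> 0 \<Longrightarrow> \<exists>b. m = single v (1::nat) + b"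
  using poly_mapping_add_single_iff[of m v] by blast

text \<open>Let \<open>xym\<close> be a product \<open>a\<close> of \<open>k + 1\<close> edges times a cofactor \<open>b\<close>. If \<open>x\<close> or \<open>y\<close> divides \<open>b\<close>, it is
  cancelled there, and at most one edge is lost in cancelling the other. If both occur only in edges, either \<open>{x, y}\<close>
  is one of these edges, or there are two edges \<open>{x, w}\<close> and \<open>{y, z}\<close>, which are replaced by \<open>{w, z}\<close>.\<close>

lemma edge_power_colon:
  assumes xy: "{x, y} \<in> E" and swap: "\<And>w z. {x, w} \<in> E \<Longrightarrow> {y, z} \<in> E \<Longrightarrow> {w, z} \<in> E"
    and "x \<noteq> y"
  shows "(\<exists>a\<in>mon_power (edge_mons E) (Suc k). \<exists>b. single x 1 + single y 1 + m = a + b) \<longleftrightarrow>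
    (\<exists>a\<in>mon_power (edge_mons E) k. \<exists>b. m = a + b)"
proof
  let ?M = "mon_power (edge_mons E)" and ?s = "\<lambda>v. single v (1::nat)"
  assume "\<exists>a\<in>?M k. \<exists>b. m = a + b"
  then obtain a b where ab: "a \<in> ?M k" "m = a + b" by blast
  have "?s x + ?s y + a \<in> ?M (Suc k)" using xy ab(1) by (auto simp: edge_mons_def)
  moreover have "?s x + ?s y + m = (?s x + ?s y + a) + b" by (simp add: ab(2) ac_simps)
  ultimately show "\<exists>a\<in>?M (Suc k). \<exists>b. ?s x + ?s y + m = a + b" by blast
next
  let ?M = "mon_power (edge_mons E)" and ?s = "\<lambda>v. single v (1::nat)"
  assume "\<exists>a\<in>?M (Suc k). \<exists>b. ?s x + ?s y + m = a + b"
  then obtain a b where a: "a \<in> ?M (Suc k)" and eq: "?s x + (?s y + m) = a + b"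
    by (auto simp: add.assoc)
  have "lookup (?s x + (?s y + m)) x \<noteq> 0" by (simp add: lookup_add)
  then consider "lookup b x \<noteq> 0" | "lookup a x \<noteq> 0"
    unfolding eq by (auto simp: lookup_add)
  then show "\<exists>a\<in>?M k. \<exists>b. m = a + b"
  proof cases
    case 1
    from single_factor[OF 1] obtain b' where b: "b = ?s x + b'" ..
    have "?s x + (?s y + m) = ?s x + (a + b')" using eq by (simp add: b ac_simps)
    then have eq': "?s y + m = a + b'" by simp
    have "lookup (?s y + m) y \<noteq> 0" by (simp add: lookup_add)
    then consider "lookup b' y \<noteq> 0" | "lookup a y \<noteq> 0"
      unfolding eq' by (auto simp: lookup_add)
    then show ?thesis
    proof cases
      case 1
      from single_factor[OF 1] obtain b'' where b': "b' = ?s y + b''" ..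
      have "?s y + m = ?s y + (a + b'')" using eq' by (simp add: b' ac_simps)
      then have "m = a + b''" by simp
      moreover obtain c d where "c \<in> ?M k" "a = d + c" using a by auto
      ultimately have "m = c + (d + b'')" by (simp add: ac_simps)
      then show ?thesis using \<open>c \<in> ?M k\<close> by blast
    next
      case 2
      from edge_power_factor[OF a 2] obtain w a' where
        a': "a' \<in> ?M k" "a = ?s y + (?s w + a')" by auto
      have "?s y + m = ?s y + (a' + (?s w + b'))" using eq' by (simp add: a'(2) ac_simps)
      then have "m = a' + (?s w + b')" by simp
      then show ?thesis using a'(1) by blast
    qed
  next
    case 2
    from edge_power_factor[OF a 2] obtain w a' where
      w: "{x, w} \<in> E" and a': "a' \<in> ?M k" "a = ?s x + (?s w + a')" by auto
    have "?s x + (?s y + m) = ?s x + (?s w + a' + b)" using eq by (simp add: a'(2) ac_simps)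
    then have eq': "?s y + m = ?s w + a' + b" by simp
    show ?thesis
    proof (cases "w = y")
      case True
      have "?s y + m = ?s y + (a' + b)" using eq' True by (simp add: ac_simps)
      then have "m = a' + b" by simp
      then show ?thesis using a'(1) by blast
    next
      case False
      have "lookup (?s y + m) y \<noteq> 0" by (simp add: lookup_add)
      then consider "lookup b y \<noteq> 0" | "lookup a' y \<noteq> 0"
        unfolding eq' using False by (auto simp: lookup_add lookup_single when_def)
      then show ?thesis
      proof cases
        case 1
        from single_factor[OF 1] obtain b' where b: "b = ?s y + b'" ..
        have "?s y + m = ?s y + (a' + (?s w + b'))" using eq' by (simp add: b ac_simps)
        then have "m = a' + (?s w + b')" by simp
        then show ?thesis using a'(1) by blast
      next
        case 2
        from edge_power_factor[OF a'(1) 2] obtain z a'' where z: "{y, z} \<in> E" "k = Suc (k - 1)"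
          and a'': "a'' \<in> ?M (k - 1)" "a' = ?s y + (?s z + a'')" by blast
        have "?s y + m = ?s y + ((?s w + ?s z + a'') + b)" using eq' by (simp add: a''(2) ac_simps)
        then have "m = (?s w + ?s z + a'') + b" by simp
        moreover have "?s w + ?s z + a'' \<in> ?M (Suc (k - 1))"
          using swap[OF w z(1)] a''(1) by (auto simp: edge_mons_def)
        ultimately show ?thesis using z(2) by metis
      qed
    qed
  qed
qed

text \<open>For a set \<open>U\<close> of non-isolated vertices in \<open>B\<close> with neighbourhood \<open>N(U)\<close>, let \<open>cl(U)\<close> be the set
  of all non-isolated vertices of \<open>B\<close> whose neighbours lie in \<open>N(U)\<close>. Then \<open>N(U)\<close> together with the
  non-isolated vertices of \<open>B\<close> outside \<open>cl(U)\<close> is a minimal cover, and comparing it with the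
  case of empty \<open>U\<close> gives \<open>|cl(U)| = |N(U)|\<close>. Choose \<open>y\<close> with as few neighbours as possible, and a neighbour
  \<open>x\<close> of \<open>y\<close>. By the choice of \<open>y\<close>, the vertices of \<open>cl({y})\<close> have the same neighbours as \<open>y\<close>. If a neighbour \<open>w\<close>
  of \<open>x\<close> missed a neighbour of \<open>y\<close>, then \<open>cl({y})\<close> and \<open>cl({w})\<close> would be disjoint subsets of
  \<open>cl({y, w})\<close>, so \<open>|N(y)| + |N(w)| \<le> |N(y) \<union> N(w)|\<close>, which is impossible because \<open>x\<close> lies in both
  neighbourhoods.\<close>

lemma unmixed_swap_edge:
  fixes E :: "'v::finite set set"
  assumes E: "bipartition E A B" and unmixed: "unmixed E" and "E \<noteq> {}"
  shows "\<exists>x y. {x, y} \<in> E \<and> x \<noteq> y \<and> (\<forall>w z. {x, w} \<in> E \<longrightarrow> {y, z} \<in> E \<longrightarrow> {w, z} \<in> E)"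
proof -
  have AB: "A \<inter> B = {}" and edge: "\<And>e. e \<in> E \<Longrightarrow> \<exists>a\<in>A. \<exists>b\<in>B. e = {a, b}"
    using E by (simp_all add: bipartition_def)
  have AE: "w \<in> B" if "{a, w} \<in> E" "a \<in> A" for a w
    using edge[OF that(1)] that(2) AB by (auto simp: doubleton_eq_iff)
  have BE: "z \<in> A" if "{b, z} \<in> E" "b \<in> B" for b z
    using edge[OF that(1)] that(2) AB by (auto simp: doubleton_eq_iff)
  define N where "N b = {a. {a, b} \<in> E}" for b
  have NA: "N b \<subseteq> A" if "b \<in> B" for b using BE that by (auto simp: N_def insert_commute)
  define B0 where "B0 = {b \<in> B. N b \<noteq> {}}"
  define NU where "NU U = (\<Union>b\<in>U. N b)" for U
  define cl where "cl U = {b \<in> B0. N b \<subseteq> NU U}" for U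
  have card_cl: "card (cl U) = card (NU U)" if U: "U \<subseteq> B0" for U
  proof -
    have cover: "minimal_vertex_cover E (NU V \<union> (B0 - cl V))" if V: "V \<subseteq> B0" for V
      unfolding minimal_vertex_cover_def vertex_cover_def
    proof (intro conjI ballI allI impI notI)
      fix e assume e: "e \<in> E" "e \<inter> (NU V \<union> (B0 - cl V)) = {}"
      from edge[OF e(1)] obtain a b where ab: "a \<in> A" "b \<in> B" "e = {a, b}" by (elim bexE)
      then have "a \<in> N b" using e(1) by (simp add: N_def)
      then have "b \<in> B0" using ab by (auto simp: B0_def)
      then have "b \<in> cl V" using e(2) ab by auto
      then have "a \<in> NU V" using \<open>a \<in> N b\<close> by (auto simp: cl_def)
      then show False using e(2) ab by auto
    next
      fix C' assume C': "C' \<subset> NU V \<union> (B0 - cl V)" "\<forall>e\<in>E. e \<inter> C' \<noteq> {}"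
      have NVA: "NU V \<subseteq> A" using V NA by (auto simp: NU_def B0_def)
      obtain v where v: "v \<in> NU V \<union> (B0 - cl V)" "v \<notin> C'" using C'(1) by blast
      show False
      proof (cases "v \<in> NU V")
        case True
        then obtain b where b: "b \<in> V" "{v, b} \<in> E" by (auto simp: NU_def N_def)
        have "b \<in> cl V" using b(1) V by (auto simp: cl_def NU_def)
        moreover have "b \<notin> NU V" using NVA V AB b(1) by (auto simp: B0_def)
        ultimately have "b \<notin> C'" using C'(1) by auto
        then show False using C'(2) b(2) v(2) by auto
      next
        case False
        then have "v \<in> B0" "v \<notin> cl V" using v(1) by auto
        then obtain a where a: "a \<in> N v" "a \<notin> NU V" by (auto simp: cl_def)
        have "a \<in> A" using NA a(1) \<open>v \<in> B0\<close> by (auto simp: B0_def)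
        then have "a \<notin> C'" using C'(1) a(2) AB by (auto simp: B0_def)
        then show False using C'(2) a(1) v(2) by (auto simp: N_def)
      qed
    qed
    have "card (NU U \<union> (B0 - cl U)) = card (NU {} \<union> (B0 - cl {}))"
      using unmixed cover[OF U] cover[of "{}"] unfolding unmixed_def by blast
    also have "NU {} \<union> (B0 - cl {}) = B0" by (auto simp: NU_def cl_def B0_def)
    finally have "card (NU U \<union> (B0 - cl U)) = card B0" .
    moreover have "card (NU U \<union> (B0 - cl U)) = card (NU U) + card (B0 - cl U)"
      using U NA AB by (intro card_Un_disjoint) (auto simp: NU_def B0_def)
    moreover have "card (B0 - cl U) = card B0 - card (cl U)" "card (cl U) \<le> card B0"
      by (auto simp: cl_def intro!: card_Diff_subset card_mono)
    ultimately show ?thesis by simp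
  qed
  from \<open>E \<noteq> {}\<close> obtain e0 where "e0 \<in> E" by blast
  with edge[OF this] obtain a0 b0 where ab0: "a0 \<in> A" "b0 \<in> B" "{a0, b0} \<in> E" by auto
  then have "b0 \<in> B0" by (auto simp: B0_def N_def)
  from ex_has_least_nat[of "\<lambda>b. b \<in> B0", OF this, of "\<lambda>b. card (N b)"]
  obtain y where y: "y \<in> B0" and least: "\<And>b. b \<in> B0 \<Longrightarrow> card (N y) \<le> card (N b)" by blast
  obtain x where x: "x \<in> N y" using y by (auto simp: B0_def)
  have xA: "x \<in> A" and yB: "y \<in> B" using x y NA by (auto simp: B0_def)
  have "{w, z} \<in> E" if w: "{x, w} \<in> E" and z: "{y, z} \<in> E" for w z
  proof (rule ccontr)
    assume not: "{w, z} \<notin> E"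
    have xw: "x \<in> N w" using w by (simp add: N_def)
    have zy: "z \<in> N y" using z by (simp add: N_def insert_commute)
    have zw: "z \<notin> N w" using not by (simp add: N_def insert_commute)
    have wB: "w \<in> B0" using AE[OF w xA] xw by (auto simp: B0_def)
    have Nb: "N b = N y" if "b \<in> cl {y}" for b
      using that least[of b] by (intro card_seteq) (auto simp: cl_def NU_def)
    have disj: "cl {y} \<inter> cl {w} = {}"
    proof (rule ccontr)
      assume "cl {y} \<inter> cl {w} \<noteq> {}"
      then obtain b where "b \<in> cl {y}" "b \<in> cl {w}" by blast
      then show False using Nb[of b] zy zw by (auto simp: cl_def NU_def)
    qed
    have "card (N y) + card (N w) = card (cl {y} \<union> cl {w})"
      using card_cl[of "{y}"] card_cl[of "{w}"] y wB disj by (simp add: card_Un_disjoint NU_def)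
    also have "\<dots> \<le> card (cl {y, w})"
      by (rule card_mono) (auto simp: cl_def NU_def)
    also have "\<dots> = card (N y \<union> N w)" using card_cl[of "{y, w}"] y wB by (simp add: NU_def)
    finally have "card (N y) + card (N w) \<le> card (N y \<union> N w)" .
    moreover have "card (N y) + card (N w) = card (N y \<union> N w) + card (N y \<inter> N w)"
      by (rule card_Un_Int) auto
    moreover have "card (N y \<inter> N w) > 0" using x xw by (auto simp: card_gt_0_iff)
    ultimately show False by simp
  qed
  moreover have "{x, y} \<in> E" using x by (simp add: N_def)
  moreover have "x \<noteq> y" using xA yB AB by blast
  ultimately show ?thesis by blast
qed

lemma edge_ideal_depth:
  fixes E :: "'v::finite set set"
  assumes E: "bipartition E A B" and unmixed: "unmixed E" and k: "1 \<le> k"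
  defines "I \<equiv> edge_ideal E :: ('v, 'k::field) mpoly set"
  shows "depth_quot (ideal_power I (Suc k)) \<le> depth_quot (ideal_power I k)"
proof -
  obtain l where l: "k = Suc l" using k by (cases k) auto
  show ?thesis
  proof (cases "E = {}")
    case True
    then have "ideal_power I (Suc k) = ideal_power I k"
      unfolding I_def edge_ideal_monomials ideal_power_monomials by (simp add: edge_mons_def l)
    then show ?thesis by simp
  next
    case False
    obtain x y where xy: "{x, y} \<in> E" "x \<noteq> y"
      and swap: "\<And>w z. {x, w} \<in> E \<Longrightarrow> {y, z} \<in> E \<Longrightarrow> {w, z} \<in> E"
      using unmixed_swap_edge[OF E unmixed False] by blast
    have colon: "(\<exists>a\<in>mon_power (edge_mons E) (Suc k). \<exists>b.
          single x 1 + single y 1 + m = a + b) \<longleftrightarrow>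
        (\<exists>a\<in>mon_power (edge_mons E) k. \<exists>b. m = a + b)" for m
      using xy(1) swap xy(2) by (rule edge_power_colon)
    have "0 \<notin> mon_power (edge_mons E) k"
    proof
      assume "0 \<in> mon_power (edge_mons E) k"
      then obtain v w c where "(0 :: 'v \<Rightarrow>\<^sub>0 nat) = single v 1 + single w 1 + c"
        by (auto simp: l edge_mons_def)
      then have "lookup (0 :: 'v \<Rightarrow>\<^sub>0 nat) v =
        lookup (single v 1 + single w 1 + c) v" by simp
      then show False by (simp add: lookup_add)
    qed
    then show ?thesis
      unfolding I_def edge_ideal_monomials
      by (rule depth_reg_of_colon_powers(1)[OF colon])
  qed
qed

theorem corollary5p3:
  fixes E :: "'v::finite set set"
  assumes "simple_graph E" and "bipartite E"
  shows "(unmixed E \<longrightarrow> non_increasing_depth (edge_ideal E :: ('v, 'k::field) mpoly set)) \<and>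
    non_increasing_depth (cover_ideal E :: ('v, 'k) mpoly set) \<and>
    non_decreasing_regularity (cover_ideal E :: ('v, 'k) mpoly set)"
proof -
  obtain A B where E: "bipartition E A B"
    using assms(2) unfolding bipartite_def bipartition_def by blast
  show ?thesis
    unfolding non_increasing_depth_def non_decreasing_regularity_def Suc_eq_plus1[symmetric]
    using edge_ideal_depth[OF E, where 'k = 'k] cover_ideal_depth_reg[OF E, where 'k = 'k] by blast
qed

end
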